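(* Let $\theta>0$ and $a>-1$, and let $p_n$, $q_n$, $K_N$ be the biorthogonal functions and correlation kernel of the Laguerre Muttalib–Borodin ensemble (in the variables of the context). Define $$\tilde p_n(x)=\frac{(-1)^n}{\Gamma(\theta n+a+1)}\,p_n(x),\qquad \tilde q_n(x)=(-1)^n\,\Gamma(\theta n+a+1)\,q_n(x).$$ Also define $$F(x)=\sum_{j=0}^\infty\frac{(-x)^j}{j!\,\Gamma(\theta j+a+1)},\qquad G(x)=\frac1{2\pi i}\int_{c-i\infty}^{c+i\infty}\frac{\Gamma(-\theta(s+1)+a+1)}{\Gamma(s+1)}\,x^s\,ds,$$ where ${\rm Re}\,s=c$ is a vertical line with the poles of $\Gamma(-\theta(s+1)+a+1)$ to its right. Then, as $N\to\infty$, $$\tilde p_{N-1}(x/N)=\bigg(1-\frac1{2N}\Big(x\frac d{dx}+\Big(x\frac d{dx}\Big)^2\Big)\bigg)F(x)+O\Big(\frac1{N^2}\Big),$$ $$\tilde q_N(x/N)=\bigg(1+\frac1{2N}\Big(x\frac d{dx}+\Big(x\frac d{dx}\Big)^2\Big)\bigg)G(x)+O\Big(\frac1{N^2}\Big),$$ and furthermore $$\frac1NK_N\Big(\frac xN,\frac yN\Big)=\int_0^1F(xt)\,G(yt)\,dt-\frac1{2N}\Big(x\frac\partial{\partial x}-y\frac\partial{\partial y}\Big)F(x)\,G(y)+O\Big(\frac1{N^2}\Big).$$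
   Context: The Laguerre Muttalib–Borodin ensemble is the eigenvalue density on $(0,\infty)^N$ proportional to $\prod_lx_l^ae^{-x_l}\prod_{j<k}(x_j-x_k)(x_j^\theta-x_k^\theta)$. After the change of variables $x_l\mapsto x_l^{1/\theta}$ it is a Pólya ensemble with weight $$w(x)=\frac1{\theta\,\Gamma(a+1)}x^{-1+(a+1)/\theta}e^{-x^{1/\theta}},\quad x>0,\qquad \mathcal M[w](s)=\int_0^\infty y^{s-1}w(y)\,dy=\frac{\Gamma(\theta(s-1)+a+1)}{\Gamma(a+1)}.$$ In these variables the biorthogonal functions and kernel are $$p_n(x)=(-1)^nn!\,\mathcal M[w](n+1)\sum_{j=0}^n\frac{(-x)^j}{j!(n-j)!\,\mathcal M[w](j+1)},\qquad q_n(x)=\frac1{n!\,\mathcal M[w](n+1)}\frac{d^n}{dx^n}\Big((-x)^nw(x)\Big),$$ $$K_N(x,y)=\sum_{j=0}^{N-1}p_j(x)q_j(y).$$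
   Formalization: The vertical-line integral for G diverges if θ<1, or if θ=1 and c<(a-1)/2; the vertical line is kept for θ>1 and for θ=1 with c≥(a-1)/2, and for every θ>0 contours s=c+κ|t|+it (κ>0), bent towards the poles, are also allowed (for θ<1, only these). *)

theory Defs
  imports
    "HOL-Complex_Analysis.Complex_Analysis"
    "HOL-Library.Landau_Symbols"
begin

definition mellin :: "(real \<Rightarrow> real) \<Rightarrow> real \<Rightarrow> real" where
  "mellin f s = (LINT y:{0<..}|lborel. y powr (s - 1) * f y)"

definition w_LMB :: "real \<Rightarrow> real \<Rightarrow> real \<Rightarrow> real" where
  "w_LMB \<theta> a x =
     1 / (\<theta> * Gamma (a + 1)) * x powr (-1 + (a + 1) / \<theta>) * exp (- (x powr (1 / \<theta>)))"

definition p_LMB :: "real \<Rightarrow> real \<Rightarrow> nat \<Rightarrow> real \<Rightarrow> real" where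
  "p_LMB \<theta> a n x =
     (-1) ^ n * fact n * mellin (w_LMB \<theta> a) (real n + 1) *
     (\<Sum>j=0..n. (- x) ^ j / (fact j * fact (n - j) * mellin (w_LMB \<theta> a) (real j + 1)))"

definition q_LMB :: "real \<Rightarrow> real \<Rightarrow> nat \<Rightarrow> real \<Rightarrow> real" where
  "q_LMB \<theta> a n x =
     1 / (fact n * mellin (w_LMB \<theta> a) (real n + 1)) *
     (deriv ^^ n) (\<lambda>u. (- u) ^ n * w_LMB \<theta> a u) x"

definition K_LMB :: "real \<Rightarrow> real \<Rightarrow> nat \<Rightarrow> real \<Rightarrow> real \<Rightarrow> real" where
  "K_LMB \<theta> a N x y = (\<Sum>j<N. p_LMB \<theta> a j x * q_LMB \<theta> a j y)"

definition p_tilde :: "real \<Rightarrow> real \<Rightarrow> nat \<Rightarrow> real \<Rightarrow> real" where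
  "p_tilde \<theta> a n x = (-1) ^ n / Gamma (\<theta> * real n + a + 1) * p_LMB \<theta> a n x"

definition q_tilde :: "real \<Rightarrow> real \<Rightarrow> nat \<Rightarrow> real \<Rightarrow> real" where
  "q_tilde \<theta> a n x = (-1) ^ n * Gamma (\<theta> * real n + a + 1) * q_LMB \<theta> a n x"

definition F_LMB :: "real \<Rightarrow> real \<Rightarrow> real \<Rightarrow> real" where
  "F_LMB \<theta> a x = (\<Sum>j. (- x) ^ j / (fact j * Gamma (\<theta> * real j + a + 1)))"

definition G_integrand :: "real \<Rightarrow> real \<Rightarrow> real \<Rightarrow> complex \<Rightarrow> complex" where
  "G_integrand \<theta> a x s =
     Gamma (- of_real \<theta> * (s + 1) + of_real a + 1) / Gamma (s + 1) * of_real x powr s"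

text \<open>
  The part of the contour with imaginary part between \<open>-T\<close> and \<open>T\<close>, traversed upwards.
  For \<open>\<kappa> = 0\<close> the contour is the vertical line \<open>Re s = c\<close>; for \<open>\<kappa> > 0\<close> both halves of that line
  are tilted to the right, towards the (real) poles of the integrand. The tilt is needed since for
  \<open>\<theta> < 1\<close> the integrand grows exponentially along every vertical line, at the rate
  \<open>exp (pi * (1 - \<theta>) * \<bar>Im s\<bar> / 2)\<close>; on a tilted contour the integral converges absolutely
  for every \<open>\<theta> > 0\<close>.
\<close>

definition G_contour :: "real \<Rightarrow> real \<Rightarrow> real \<Rightarrow> real \<Rightarrow> complex" where
  "G_contour c \<kappa> T =
     linepath (Complex (c + \<kappa> * T) (- T)) (of_real c) +++
     linepath (of_real c) (Complex (c + \<kappa> * T) T)"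

definition G_LMB :: "real \<Rightarrow> real \<Rightarrow> real \<Rightarrow> real \<Rightarrow> real \<Rightarrow> complex" where
  "G_LMB \<theta> a c \<kappa> x =
     1 / (2 * of_real pi * \<i>) *
     Lim at_top (\<lambda>T. contour_integral (G_contour c \<kappa> T) (G_integrand \<theta> a x))"

definition poles_to_right :: "real \<Rightarrow> real \<Rightarrow> real \<Rightarrow> bool" where
  "poles_to_right \<theta> a c \<longleftrightarrow>
     (\<forall>s::complex. - of_real \<theta> * (s + 1) + of_real a + 1 \<in> \<int>\<^sub>\<le>\<^sub>0 \<longrightarrow> c < Re s)"

text \<open>
  The parameters for which the integral converges. On the vertical line \<open>Re s = c\<close> it converges
  absolutely for \<open>\<theta> > 1\<close> and diverges for \<open>\<theta> < 1\<close>. For \<open>\<theta> = 1\<close> the modulus of the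
  integrand is of the order of \<open>\<bar>Im s\<bar> powr (a - 2 * c - 1)\<close> and its phase has a derivative of
  logarithmic growth, so that the improper integral converges exactly if \<open>c \<ge> (a - 1) / 2\<close>.
\<close>

definition convergent_contour :: "real \<Rightarrow> real \<Rightarrow> real \<Rightarrow> real \<Rightarrow> bool" where
  "convergent_contour \<theta> a c \<kappa> \<longleftrightarrow>
     \<kappa> > 0 \<or> \<kappa> = 0 \<and> (\<theta> > 1 \<or> \<theta> = 1 \<and> (a - 1) / 2 \<le> c)"

definition euler_op :: "(real \<Rightarrow> 'a::real_normed_vector) \<Rightarrow> real \<Rightarrow> 'a" where
  "euler_op f x = x *\<^sub>R vector_derivative f (at x)"

end

theory Submission
  imports Defs "HOL-Real_Asymp.Real_Asymp"
begin

text \<open>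
  Closing the contour to the right turns \<open>G\<close> into the residue series
  \<open>\<Sum>k. g k * x powr s k\<close> over the poles \<open>s k = (a + 1 + k) / \<theta> - 1\<close>, for every admissible contour:
  since \<open>Re (Digamma z)\<close> tends to infinity with \<open>\<bar>Im z\<bar>\<close>, uniformly in \<open>Re z\<close>, the integrand decays on
  horizontal rays at an arbitrarily large exponential rate, so that the horizontal sides of the
  rectangles vanish even where the integrand is merely bounded at their left end.

  The functions \<open>p\<close>, \<open>q\<close> at \<open>x / N\<close> have the same expansions as \<open>F\<close>, \<open>G\<close>, with the \<open>j\<close>-th coefficient of \<open>F\<close>
  multiplied by \<open>\<Prod>i=1..j. 1 - i / N = 1 - j (j + 1) / (2 N) + O(N^-2)\<close> and the \<open>k\<close>-th coefficient of \<open>G\<close> by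
  \<open>\<Gamma>(N + 1 + s) / (\<Gamma>(N + 1) N^s) = 1 + s (s + 1) / (2 N) + O(N^-2)\<close> at \<open>s = s k\<close>. Both error terms grow
  slowly enough in \<open>j\<close> and \<open>k\<close> to be summed against the factorials in the coefficients. In the
  kernel the sum over the degree telescopes, which leaves the product of the two factors divided by
  \<open>s k + j + 1\<close>, and \<open>1 / (s + j + 1)\<close> is the integral of \<open>t powr (s + j)\<close> over the unit interval.
\<close>

subsection \<open>Growth of the Gamma function in the complex plane\<close>

text \<open>The contour integral is only a limit of truncated integrals, and for
  \<open>\<theta> = 1\<close> on a vertical line the integrand need not decay. The estimates are
  therefore made at the two ends of the truncated contour: if the modulus there stays below C and
  the decay rate to the right is \<beta>, the truncation differs from 2 pi i times the residue
  series by at most 2 C / \<beta>, and \<beta> is at choice. No Stirling expansion enters. The real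
  part of \<open>Digamma\<close> governs horizontal directions, and the exact modulus of Gamma on Re
  z = 1, a consequence of the reflection formula, gives the vertical growth exponent pi (1 -
  \<theta>) / 2. The shape of the correction to the kernel comes from s (s + 1) - j (j + 1) = (s -
  j) (s + j + 1). The second factor cancels the denominator s + j + 1, so the terms of order 1/N
  separate into a series in x times a series in y, in which j and s are the eigenvalues of the two
  Euler operators.\<close>

lemma Re_inverse_le_inverse_Im:
  assumes "Im z \<noteq> 0"
  shows "Re (inverse z) \<le> 1 / (2 * \<bar>Im z\<bar>)"
proof -
  have "0 \<le> (Re z - \<bar>Im z\<bar>)\<^sup>2" by simp
  then have "2 * \<bar>Im z\<bar> * Re z \<le> (Re z)\<^sup>2 + (Im z)\<^sup>2"
    by (simp add: power2_diff mult_ac)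
  moreover have "(Re z)\<^sup>2 + (Im z)\<^sup>2 > 0" using assms by (simp add: sum_power2_gt_zero_iff)
  ultimately have "Re z / ((Re z)\<^sup>2 + (Im z)\<^sup>2) \<le> 1 / (2 * \<bar>Im z\<bar>)"
    using assms by (simp add: frac_le_eq divide_simps mult_ac)
  then show ?thesis by simp
qed

lemma Re_inverse_le_inverse_Re: "Re z > 0 \<Longrightarrow> Re (inverse z) \<le> 1 / Re z"
proof -
  assume h: "Re z > 0"
  then have "Re z / ((Re z)\<^sup>2 + (Im z)\<^sup>2) \<le> Re z / (Re z)\<^sup>2"
    by (intro divide_left_mono) (auto simp: zero_less_mult_iff intro!: add_pos_nonneg mult_pos_pos)
  with h show ?thesis by (simp add: power2_eq_square)
qed

text \<open>In the series of terms 1/(k + 1) - 1/(z + k) every term has nonnegative real part once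
  Re z \<ge> 1, so each partial sum bounds the whole from below. The M reciprocals 1/(z + k) in it
  cost at most 1/(2 |Im z|) each. M stays free, to be fixed before |Im z| is made large.\<close>

lemma Re_Digamma_ge:
  assumes "Re z \<ge> 1" "\<bar>Im z\<bar> > 0"
  shows "Re (Digamma z) \<ge> harm M - real M / (2 * \<bar>Im z\<bar>) - euler_mascheroni"
proof -
  let ?f = "\<lambda>k. inverse (of_nat (Suc k)) - inverse (z + of_nat k)"
  have z: "z \<noteq> 0" using assms by auto
  have sm: "summable ?f" using summable_Digamma[OF z] .
  have smR: "summable (\<lambda>k. Re (?f k))" using summable_Re[OF sm] .
  have nn: "Re (?f k) \<ge> 0" for k
  proof -
    have "Re (inverse (z + of_nat k)) \<le> 1 / Re (z + of_nat k)"
      using assms by (intro Re_inverse_le_inverse_Re) auto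
    also have "\<dots> \<le> 1 / real (Suc k)" using assms by (intro divide_left_mono) auto
    also have "\<dots> = Re (inverse (of_nat (Suc k)))"
      by (metis Re_complex_of_real inverse_eq_divide of_real_inverse of_real_of_nat_eq)
    finally show ?thesis by (simp only: minus_complex.sel)
  qed
  have "(\<Sum>k<M. Re (?f k)) \<ge> (\<Sum>k<M. inverse (real (Suc k)) - 1 / (2 * \<bar>Im z\<bar>))"
  proof (rule sum_mono)
    fix k
    have "Re (inverse (z + of_nat k)) \<le> 1 / (2 * \<bar>Im z\<bar>)"
      using Re_inverse_le_inverse_Im[of "z + of_nat k"] assms by simp
    moreover have "Re (inverse (of_nat (Suc k))) = inverse (real (Suc k))"
      by (metis Re_complex_of_real of_real_inverse of_real_of_nat_eq)
    ultimately show "inverse (real (Suc k)) - 1 / (2 * \<bar>Im z\<bar>) \<le> Re (?f k)"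
      by (simp only: minus_complex.sel)
  qed
  also have "(\<Sum>k<M. inverse (real (Suc k)) - 1 / (2 * \<bar>Im z\<bar>)) = harm M - real M / (2 * \<bar>Im z\<bar>)"
  proof -
    have "(\<Sum>k<M. inverse (real (Suc k))) = harm M"
      unfolding harm_def by (rule sum.reindex_bij_witness[of _ "\<lambda>k. k - 1" Suc]) auto
    then show ?thesis by (simp add: sum_subtractf)
  qed
  finally have 1: "(\<Sum>k<M. Re (?f k)) \<ge> harm M - real M / (2 * \<bar>Im z\<bar>)" .
  have "Re (Digamma z) = Re (\<Sum>k. ?f k) - euler_mascheroni"
  proof -
    have "Digamma z = (\<Sum>k. ?f k) - complex_of_real euler_mascheroni"
      by (simp add: Digamma_def)
    then show ?thesis by (simp only: minus_complex.sel Re_complex_of_real)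
  qed
  moreover have "Re (\<Sum>k. ?f k) = (\<Sum>k. Re (?f k))" by (rule Re_suminf[OF sm])
  moreover have "(\<Sum>k. Re (?f k)) \<ge> (\<Sum>k<M. Re (?f k))" by (rule sum_le_suminf[OF smR]) (use nn in auto)
  ultimately show ?thesis using 1 by linarith
qed

text \<open>The bound on Re z \<ge> 1 is carried leftwards by Digamma z = Digamma (z + 1) - 1/z.
  Only the passage through 0 < Re z < 1 can lose anything, at most 1, because Re (1/z) \<le> 0 when
  Re z \<le> 0. Hence one threshold for |Im z| works for all real parts; the base value K + 2 leaves
  room for the loss.\<close>

lemma Re_Digamma_at_top:
  "\<exists>T0>0. \<forall>z. \<bar>Im z\<bar> \<ge> T0 \<longrightarrow> Re (Digamma z) \<ge> K"
proof -
  have "filterlim (harm :: nat \<Rightarrow> real) at_top sequentially" by (rule harm_at_top)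
  then obtain M where M: "harm M \<ge> K + 3 + euler_mascheroni"
    unfolding filterlim_at_top eventually_sequentially by blast
  have base: "Re (Digamma z) \<ge> K + 2" if "Re z \<ge> 1" "\<bar>Im z\<bar> \<ge> real M + 1" for z
  proof -
    have "real M / (2 * \<bar>Im z\<bar>) \<le> 1" using that by (simp add: field_simps)
    moreover have "\<bar>Im z\<bar> > 0" using that by linarith
    ultimately show ?thesis using Re_Digamma_ge[of z M] M that(1) by linarith
  qed
  have step: "\<forall>z. Re z \<ge> 1 - real m \<and> \<bar>Im z\<bar> \<ge> real M + 1 \<longrightarrow> Re (Digamma z) \<ge> K + (if Re z > 0 then 1 else 0)" for m
  proof (induction m)
    case 0 then show ?case using base by fastforce
  next
    case (Suc m)
    show ?case
    proof safe
      fix z assume z: "1 - real (Suc m) \<le> Re z" "real M + 1 \<le> \<bar>Im z\<bar>"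
      then have z0: "z \<noteq> 0" by auto
      have D: "Re (Digamma z) = Re (Digamma (z + 1)) - Re (inverse z)"
        using Digamma_plus1[OF z0] by (simp add: inverse_eq_divide)
      have IH: "Re (Digamma (z + 1)) \<ge> K + (if Re (z+1) > 0 then 1 else 0)"
        using Suc.IH[rule_format, of "z + 1"] z by auto
      show "Re (Digamma z) \<ge> K + (if Re z > 0 then 1 else 0)"
      proof (cases "Re z > 0")
        case True
        have "Re (inverse z) \<le> 1 / (2 * \<bar>Im z\<bar>)" using z by (intro Re_inverse_le_inverse_Im) auto
        also have "\<dots> \<le> 1" using z by (simp add: field_simps)
        finally have "Re (inverse z) \<le> 1" .
        moreover have "Re (Digamma (z + 1)) \<ge> K + 2" using base[of "z+1"] True z by simp
        ultimately show ?thesis using D True by simp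
      next
        case False
        then have "Re (inverse z) \<le> 0" by (simp add: divide_nonpos_nonneg)
        then show ?thesis using D IH False by (auto split: if_splits)
      qed
    qed
  qed
  have "\<forall>z. \<bar>Im z\<bar> \<ge> real M + 1 \<longrightarrow> Re (Digamma z) \<ge> K"
  proof safe
    fix z assume "real M + 1 \<le> \<bar>Im z\<bar>"
    moreover obtain m where "1 - Re z \<le> real m" using real_arch_simple by blast
    ultimately show "Re (Digamma z) \<ge> K" using step[of m, rule_format, of z] by (auto split: if_splits)
  qed
  then show ?thesis by (intro exI[of _ "real M + 1"]) auto
qed

text \<open>The function exp (2 \<beta> \<sigma>) |f|^2 has derivative 2 exp (2 \<beta> \<sigma>)
  |f|^2 (\<beta> + Re L) \<le> 0. Here \<open>L\<close> stands for f'/f; the squared modulus avoids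
  a branch of log f and copes with zeros.\<close>

lemma norm_exp_antimono_horizontal:
  fixes f L :: "complex \<Rightarrow> complex"
  assumes d: "\<And>\<sigma>. (f has_field_derivative (f (Complex \<sigma> T) * L (Complex \<sigma> T))) (at (Complex \<sigma> T))"
    and L: "\<And>\<sigma>. Re (L (Complex \<sigma> T)) \<le> - \<beta>" and le: "\<sigma>1 \<le> \<sigma>2"
  shows "norm (f (Complex \<sigma>2 T)) \<le> norm (f (Complex \<sigma>1 T)) * exp (- \<beta> * (\<sigma>2 - \<sigma>1))"
proof -
  define u where "u = (\<lambda>\<sigma>. f (Complex \<sigma> T))"
  define h where "h = (\<lambda>\<sigma>. exp (2 * \<beta> * \<sigma>) * ((Re (u \<sigma>))\<^sup>2 + (Im (u \<sigma>))\<^sup>2))"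
  have vd: "(u has_vector_derivative (u \<sigma> * L (Complex \<sigma> T))) (at \<sigma>)" for \<sigma>
  proof -
    have "((\<lambda>\<sigma>. Complex \<sigma> T) has_vector_derivative 1) (at \<sigma>)"
      by (auto simp: has_vector_derivative_complex_iff)
    from field_vector_diff_chain_at[OF this d[of \<sigma>]] show ?thesis by (simp add: u_def o_def)
  qed
  define v where "v = (\<lambda>\<sigma>. u \<sigma> * L (Complex \<sigma> T))"
  have r: "((\<lambda>\<sigma>. Re (u \<sigma>)) has_real_derivative Re (v \<sigma>)) (at \<sigma>)"
    and i: "((\<lambda>\<sigma>. Im (u \<sigma>)) has_real_derivative Im (v \<sigma>)) (at \<sigma>)" for \<sigma>
    using vd[of \<sigma>] by (auto simp: has_vector_derivative_complex_iff v_def)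
  have hd: "(h has_real_derivative (exp (2 * \<beta> * \<sigma>) * (2 * \<beta> * ((Re (u \<sigma>))\<^sup>2 + (Im (u \<sigma>))\<^sup>2)
      + 2 * (Re (u \<sigma>) * Re (v \<sigma>) + Im (u \<sigma>) * Im (v \<sigma>))))) (at \<sigma>)" for \<sigma>
    unfolding h_def
    by (rule derivative_eq_intros r i refl | simp)+ (simp add: algebra_simps)
  have neg: "2 * \<beta> * ((Re (u \<sigma>))\<^sup>2 + (Im (u \<sigma>))\<^sup>2) + 2 * (Re (u \<sigma>) * Re (v \<sigma>) + Im (u \<sigma>) * Im (v \<sigma>)) \<le> 0" for \<sigma>
  proof -
    have "Re (u \<sigma>) * Re (v \<sigma>) + Im (u \<sigma>) * Im (v \<sigma>) = ((Re (u \<sigma>))\<^sup>2 + (Im (u \<sigma>))\<^sup>2) * Re (L (Complex \<sigma> T))"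
      by (simp add: v_def algebra_simps power2_eq_square)
    also have "\<dots> \<le> ((Re (u \<sigma>))\<^sup>2 + (Im (u \<sigma>))\<^sup>2) * (- \<beta>)"
      by (intro mult_left_mono L) auto
    finally show ?thesis by (simp add: algebra_simps)
  qed
  have "h \<sigma>2 \<le> h \<sigma>1"
    using le
  proof (rule DERIV_nonpos_imp_nonincreasing)
    fix x
    show "\<exists>y. (h has_real_derivative y) (at x) \<and> y \<le> 0"
      using hd[of x] mult_left_mono[OF neg[of x], of "exp (2 * \<beta> * x)"] by auto
  qed
  then have "(exp (\<beta> * \<sigma>2) * norm (u \<sigma>2))\<^sup>2 \<le> (exp (\<beta> * \<sigma>1) * norm (u \<sigma>1))\<^sup>2"
    by (simp add: h_def power_mult_distrib cmod_power2 exp_double[symmetric] mult.assoc)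
  then have "exp (\<beta> * \<sigma>2) * norm (u \<sigma>2) \<le> exp (\<beta> * \<sigma>1) * norm (u \<sigma>1)"
    by (rule power2_le_imp_le) simp
  then have "norm (u \<sigma>2) \<le> norm (u \<sigma>1) * (exp (\<beta> * \<sigma>1) / exp (\<beta> * \<sigma>2))"
    by (simp add: field_simps)
  then show ?thesis by (simp add: u_def exp_diff[symmetric] algebra_simps)
qed

text \<open>The preceding estimate at rate 0 for \<open>rGamma\<close>, an entire function with
  logarithmic derivative \<open>- Digamma\<close>. Since the threshold for |T| serves all u and v,
  Gamma can be compared on any two vertical lines.\<close>

lemma norm_Gamma_mono_Re:
  "\<exists>T0>0. \<forall>u v T. \<bar>T\<bar> \<ge> T0 \<and> u \<le> v \<longrightarrow> norm (Gamma (Complex u T)) \<le> norm (Gamma (Complex v T))"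
proof -
  obtain T0 where T0: "T0 > 0" "\<And>z. \<bar>Im z\<bar> \<ge> T0 \<Longrightarrow> Re (Digamma z) \<ge> 0"
    using Re_Digamma_at_top[of 0] by auto
  have "norm (Gamma (Complex u T)) \<le> norm (Gamma (Complex v T))" if "\<bar>T\<bar> \<ge> T0" "u \<le> v" for u v T
  proof -
    have nz: "Complex \<sigma> T \<notin> \<int>\<^sub>\<le>\<^sub>0" for \<sigma>
      using that T0(1) by (auto elim!: nonpos_Ints_cases simp: complex_eq_iff)
    have nz': "Complex \<sigma> (-T) \<notin> \<int>\<^sub>\<le>\<^sub>0" for \<sigma>
      using that T0(1) by (auto elim!: nonpos_Ints_cases simp: complex_eq_iff)
    have "norm (rGamma (Complex v T)) \<le> norm (rGamma (Complex u T)) * exp (- 0 * (v - u))"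
    proof (rule norm_exp_antimono_horizontal[where L = "\<lambda>z. - Digamma z"])
      fix \<sigma>
      show "(rGamma has_field_derivative rGamma (Complex \<sigma> T) * - Digamma (Complex \<sigma> T)) (at (Complex \<sigma> T))"
        using has_field_derivative_rGamma_no_nonpos_int[OF nz] by simp
      show "Re (- Digamma (Complex \<sigma> T)) \<le> - 0" using T0(2)[of "Complex \<sigma> T"] that by simp
    qed fact
    moreover have "rGamma (Complex v T) \<noteq> 0" using nz by (simp add: rGamma_eq_zero_iff)
    moreover have "rGamma (Complex u T) \<noteq> 0" using nz by (simp add: rGamma_eq_zero_iff)
    ultimately show ?thesis by (simp add: Gamma_def norm_inverse)
  qed
  then show ?thesis using T0(1) by blast
qed

text \<open>Reflection formula at z = i T: 1 - z is the conjugate of 1 + z, and Gamma (1 + z) = z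
  Gamma z, so both Gamma factors are known multiples of the same modulus.\<close>

lemma norm_Gamma_1_plus_ii:
  assumes "T > 0"
  shows "(norm (Gamma (Complex 1 T)))\<^sup>2 = pi * T / sinh (pi * T)"
proof -
  define z where "z = Complex 0 T"
  have z: "z \<notin> \<int>\<^sub>\<le>\<^sub>0" using assms by (auto simp: z_def elim!: nonpos_Ints_cases simp: complex_eq_iff)
  have "Gamma (z + 1) = z * Gamma z" using z by (rule Gamma_plus1)
  then have 1: "norm (Gamma (Complex 1 T)) = T * norm (Gamma z)"
  proof -
    assume "Gamma (z + 1) = z * Gamma z"
    moreover have "z + 1 = Complex 1 T" by (simp add: z_def complex_eq_iff)
    moreover have "norm z = T" using assms by (simp add: z_def cmod_def)
    ultimately show ?thesis by (simp add: norm_mult)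
  qed
  have "1 - z = cnj (Complex 1 T)" by (simp add: z_def complex_eq_iff)
  then have 2: "norm (Gamma (1 - z)) = norm (Gamma (Complex 1 T))" by (metis cnj_Gamma complex_mod_cnj)
  have sn: "norm (sin (of_real pi * z)) = sinh (pi * T)"
  proof -
    have "of_real pi * z = \<i> * of_real (pi * T)" by (simp add: z_def complex_eq_iff)
    then have "sin (of_real pi * z) = \<i> * of_real (sinh (pi * T))"
      by (simp add: sin_i_times sinh_def exp_of_real exp_minus flip: of_real_mult)
    then show ?thesis using assms by (simp add: norm_mult)
  qed
  have "norm (Gamma z) * norm (Gamma (1 - z)) = norm (of_real pi / sin (of_real pi * z) :: complex)"
    unfolding norm_mult[symmetric] Gamma_reflection_complex ..
  also have "\<dots> = pi / sinh (pi * T)" by (simp add: norm_divide sn)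
  finally have 3: "norm (Gamma z) * norm (Gamma (1 - z)) = pi / sinh (pi * T)" .
  have "(norm (Gamma (Complex 1 T)))\<^sup>2 = T * (norm (Gamma z) * norm (Gamma (1 - z)))"
    using 1 2 by (simp add: power2_eq_square)
  with 3 show ?thesis by simp
qed

lemma norm_pochhammer_le:
  fixes z :: "'a :: real_normed_field"
  shows "norm (pochhammer z n) \<le> (norm z + real n) ^ n"
proof -
  have "norm (pochhammer z n) = (\<Prod>i<n. norm (z + of_nat i))"
    by (simp add: pochhammer_prod prod_norm atLeast0LessThan)
  also have "\<dots> \<le> (\<Prod>i<n. norm z + real n)"
  proof (intro prod_mono conjI)
    fix i assume "i \<in> {..<n}"
    have "norm (z + of_nat i) \<le> norm z + norm (of_nat i :: 'a)" by (rule norm_triangle_ineq)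
    with \<open>i \<in> {..<n}\<close> show "norm (z + of_nat i) \<le> norm z + real n" by simp
  qed auto
  finally show ?thesis by simp
qed

lemma norm_Gamma_plus_of_nat_le:
  assumes "z \<notin> \<int>\<^sub>\<le>\<^sub>0"
  shows "norm (Gamma (z + of_nat n :: complex)) \<le> (norm z + real n) ^ n * norm (Gamma z)"
proof -
  have "Gamma (z + of_nat n) = pochhammer z n * Gamma z"
    using pochhammer_Gamma[OF assms, of n] assms by (simp add: Gamma_eq_zero_iff)
  then show ?thesis
    by (simp add: norm_mult mult_right_mono norm_pochhammer_le)
qed

text \<open>Monotonicity in Re z and integer shifts reduce both Gamma values to the line Re z = 1 at
  the price of powers of T. On that line the sinh formula gives a ratio asymptotic to sqrt \<theta>
  exp (pi (1 - \<theta>) T / 2). The strict inequality for D leaves a factor exp (- \<delta> T) that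
  absorbs the powers.\<close>

lemma norm_Gamma_Complex_growth:
  assumes \<theta>: "\<theta> > 0" and D: "D > pi * (1 - \<theta>) / 2"
  shows "\<exists>C>0. eventually (\<lambda>T. norm (Gamma (Complex u (\<theta> * T))) \<le> C * exp (D * T) * norm (Gamma (Complex v T))) at_top"
proof -
  obtain T0 where T0: "T0 > 0"
    "\<And>u v T. \<bar>T\<bar> \<ge> T0 \<Longrightarrow> u \<le> v \<Longrightarrow> norm (Gamma (Complex u T)) \<le> norm (Gamma (Complex v T))"
    using norm_Gamma_mono_Re by blast
  \<comment> \<open>Then u \<le> 1 + m and -m \<le> v, so integer shifts from the line Re z = 1
    reach past both abscissae.\<close>
  obtain m :: nat where m: "\<bar>u\<bar> + \<bar>v\<bar> + 1 \<le> real m" using real_arch_simple by blast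
  define \<delta> where "\<delta> = D - pi * (1 - \<theta>) / 2"
  have \<delta>: "\<delta> > 0" using D by (simp add: \<delta>_def)
  define K where "K = 2 + 2 * real m + \<theta>"
  have K: "K > 0" using \<theta> by (simp add: K_def)
  have lim: "((\<lambda>T. (K + K * T) ^ (2 * m + 1) * exp (- \<delta> * T)) \<longlongrightarrow> 0) at_top"
    using K \<delta> by real_asymp
  have ev1: "eventually (\<lambda>T. (K + K * T) ^ (2 * m + 1) * exp (- \<delta> * T) \<le> 1) at_top"
    using order_tendstoD(2)[OF lim, of 1] by (auto elim: eventually_mono)
  \<comment> \<open>This makes the negative exponential in sinh (pi \<theta> T) at most half of the
    positive one, which yields the lower bound exp (pi \<theta> T) / 4.\<close>
  have ev2: "eventually (\<lambda>T. exp (- (2 * pi * \<theta>) * T) \<le> 1 / 2) at_top"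
  proof -
    have "((\<lambda>T. exp (- (2 * pi * \<theta>) * T)) \<longlongrightarrow> 0) at_top"
      using \<theta> by real_asymp
    from order_tendstoD(2)[OF this, of "1/2"] show ?thesis by (auto elim: eventually_mono)
  qed
  have "eventually (\<lambda>T. norm (Gamma (Complex u (\<theta> * T))) \<le> sqrt (2 * \<theta>) * exp (D * T) * norm (Gamma (Complex v T))) at_top"
    using ev1 ev2 eventually_ge_at_top[of T0] eventually_ge_at_top[of "T0 / \<theta>"] eventually_gt_at_top[of 0]
  proof eventually_elim
    case (elim T)
    have T\<theta>: "T0 \<le> \<theta> * T" using elim(4) \<theta> by (simp add: field_simps)
    have np: "Complex \<sigma> S \<notin> \<int>\<^sub>\<le>\<^sub>0" if "S > 0" for \<sigma> S
      using that by (auto elim!: nonpos_Ints_cases simp: complex_eq_iff)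
    have nle: "norm (Complex \<sigma> S) \<le> \<bar>\<sigma>\<bar> + \<bar>S\<bar>" for \<sigma> S
      using cmod_le[of "Complex \<sigma> S"] by simp
    have a: "norm (Gamma (Complex u (\<theta> * T))) \<le> (K + K * T) ^ m * norm (Gamma (Complex 1 (\<theta> * T)))"
    proof -
      have "norm (Gamma (Complex u (\<theta> * T))) \<le> norm (Gamma (Complex (1 + real m) (\<theta> * T)))"
        using T0(2)[of "\<theta> * T" u "1 + real m"] T\<theta> m T0(1) by linarith
      also have "Complex (1 + real m) (\<theta> * T) = Complex 1 (\<theta> * T) + of_nat m" by (simp add: complex_eq_iff)
      also have "norm (Gamma \<dots>) \<le> (norm (Complex 1 (\<theta> * T)) + real m) ^ m * norm (Gamma (Complex 1 (\<theta> * T)))"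
        using np \<theta> elim by (intro norm_Gamma_plus_of_nat_le) auto
      also have "\<dots> \<le> (K + K * T) ^ m * norm (Gamma (Complex 1 (\<theta> * T)))"
      proof (intro mult_right_mono power_mono)
        have "norm (Complex 1 (\<theta> * T)) \<le> 1 + \<theta> * T" using nle[of 1 "\<theta> * T"] \<theta> elim by simp
        moreover have "\<theta> * T \<le> K * T" using elim by (intro mult_right_mono) (auto simp: K_def)
        ultimately show "norm (Complex 1 (\<theta> * T)) + real m \<le> K + K * T" using \<theta> by (simp add: K_def)
      qed auto
      finally show ?thesis .
    qed
    have b: "norm (Gamma (Complex 1 T)) \<le> (K + K * T) ^ (m + 1) * norm (Gamma (Complex v T))"
    proof -
      have "Complex 1 T = Complex (- real m) T + of_nat (m + 1)" by (simp add: complex_eq_iff)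
      also have "norm (Gamma \<dots>) \<le> (norm (Complex (- real m) T) + real (m + 1)) ^ (m + 1) * norm (Gamma (Complex (- real m) T))"
        using np elim by (intro norm_Gamma_plus_of_nat_le) auto
      also have "\<dots> \<le> (K + K * T) ^ (m + 1) * norm (Gamma (Complex v T))"
      proof (intro mult_mono power_mono)
        have "norm (Complex (- real m) T) \<le> real m + T" using nle[of "- real m" "T"] elim by simp
        moreover have "1 * T \<le> K * T" using elim \<theta> by (intro mult_right_mono) (auto simp: K_def)
        ultimately show "norm (Complex (- real m) T) + real (m + 1) \<le> K + K * T" using \<theta> by (simp add: K_def)
        show "norm (Gamma (Complex (- real m) T)) \<le> norm (Gamma (Complex v T))"
          using T0(2)[of T "- real m" v] elim T0(1) m by linarith
        show "0 \<le> (K + K * T) ^ (m + 1)" using K elim by simp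
      qed auto
      finally show ?thesis .
    qed
    have c: "norm (Gamma (Complex 1 (\<theta> * T))) \<le> sqrt (2 * \<theta>) * exp (pi * (1 - \<theta>) / 2 * T) * norm (Gamma (Complex 1 T))"
    proof (rule power2_le_imp_le)
      have s1: "sinh (pi * T) \<le> exp (pi * T) / 2" by (simp add: sinh_def exp_minus)
      have s2: "sinh (pi * (\<theta> * T)) \<ge> exp (pi * \<theta> * T) / 4"
      proof -
        have "exp (- (pi * (\<theta> * T))) = exp (pi * \<theta> * T) * exp (- (2 * pi * \<theta>) * T)"
          by (simp add: exp_add[symmetric] algebra_simps)
        also have "\<dots> \<le> exp (pi * \<theta> * T) * (1 / 2)" using elim(2) by (intro mult_left_mono) auto
        finally show ?thesis by (simp add: sinh_def mult.assoc)
      qed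
      have s0: "sinh (pi * T) > 0" using elim by simp
      have "(norm (Gamma (Complex 1 (\<theta> * T))))\<^sup>2 = pi * (\<theta> * T) / sinh (pi * (\<theta> * T))"
        using elim \<theta> by (intro norm_Gamma_1_plus_ii) auto
      also have "\<dots> \<le> pi * (\<theta> * T) / (exp (pi * \<theta> * T) / 4)"
        using s2 elim \<theta> by (intro divide_left_mono mult_pos_pos) (auto intro: mult_pos_pos)
      also have "\<dots> = 2 * \<theta> * exp (pi * (1 - \<theta>) * T) * (pi * T / (exp (pi * T) / 2))"
      proof -
        have "exp (pi * (1 - \<theta>) * T) = exp (pi * T) / exp (pi * \<theta> * T)"
          by (simp add: exp_diff[symmetric] algebra_simps)
        then show ?thesis by (simp add: field_simps)
      qed
      also have "\<dots> \<le> 2 * \<theta> * exp (pi * (1 - \<theta>) * T) * (pi * T / sinh (pi * T))"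
        using s1 s0 elim \<theta> by (intro mult_left_mono divide_left_mono mult_pos_pos) auto
      also have "pi * T / sinh (pi * T) = (norm (Gamma (Complex 1 T)))\<^sup>2"
        using norm_Gamma_1_plus_ii[of T] elim by simp
      also have "2 * \<theta> * exp (pi * (1 - \<theta>) * T) * \<dots> = (sqrt (2 * \<theta>) * exp (pi * (1 - \<theta>) / 2 * T) * norm (Gamma (Complex 1 T)))\<^sup>2"
        using \<theta> by (simp add: power_mult_distrib exp_double[symmetric] algebra_simps)
      finally show "(norm (Gamma (Complex 1 (\<theta> * T))))\<^sup>2 \<le> (sqrt (2 * \<theta>) * exp (pi * (1 - \<theta>) / 2 * T) * norm (Gamma (Complex 1 T)))\<^sup>2" .
    qed (use \<theta> in auto)
    have KT: "K + K * T \<ge> 0" using K elim by simp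
    have "norm (Gamma (Complex u (\<theta> * T))) \<le>
       (K + K * T) ^ m * (sqrt (2 * \<theta>) * exp (pi * (1 - \<theta>) / 2 * T) * ((K + K * T) ^ (m + 1) * norm (Gamma (Complex v T))))"
      using a order.trans[OF c mult_left_mono[OF b, of "sqrt (2 * \<theta>) * exp (pi * (1 - \<theta>) / 2 * T)"]] \<theta> KT
      by (meson mult_left_mono order.trans zero_le_power mult_nonneg_nonneg real_sqrt_ge_zero exp_ge_zero zero_le_numeral less_imp_le)
    also have "\<dots> = (K + K * T) ^ (2 * m + 1) * exp (- \<delta> * T) * (sqrt (2 * \<theta>) * exp (D * T) * norm (Gamma (Complex v T)))"
    proof -
      have "exp (pi * (1 - \<theta>) / 2 * T) = exp (- \<delta> * T) * exp (D * T)"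
        by (simp add: exp_add[symmetric] \<delta>_def algebra_simps)
      moreover have "(K + K * T) ^ (2 * m + 1) = (K + K * T) ^ m * (K + K * T) ^ (m + 1)"
        by (simp only: power_add[symmetric]) (simp add: mult_2)
      ultimately show ?thesis by (simp only: mult_ac)
    qed
    also have "\<dots> \<le> 1 * (sqrt (2 * \<theta>) * exp (D * T) * norm (Gamma (Complex v T)))"
      using elim(1) \<theta> by (intro mult_right_mono) auto
    finally show ?case by simp
  qed
  then show ?thesis using \<theta> by (intro exI[of _ "sqrt (2 * \<theta>)"]) auto
qed

subsection \<open>The contour integral as a residue series\<close>

definition G_pole :: "real \<Rightarrow> real \<Rightarrow> nat \<Rightarrow> real" where
  "G_pole \<theta> a k = (a + 1 + real k) / \<theta> - 1"

lemma G_pole_gt: "\<theta> > 0 \<Longrightarrow> a > -1 \<Longrightarrow> G_pole \<theta> a k > -1"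
  by (simp add: G_pole_def)

lemma G_pole_less_iff: "\<theta> > 0 \<Longrightarrow> G_pole \<theta> a j < G_pole \<theta> a k \<longleftrightarrow> j < k"
  by (simp add: G_pole_def divide_less_cancel)

lemma G_argument_nonpos_Int_iff:
  assumes "\<theta> > 0"
  shows "- of_real \<theta> * (s + 1) + of_real a + 1 \<in> (\<int>\<^sub>\<le>\<^sub>0 :: complex set)
    \<longleftrightarrow> (\<exists>k. s = of_real (G_pole \<theta> a k))"
proof -
  have "- of_real \<theta> * (s + 1) + of_real a + 1 = (- of_nat k :: complex) \<longleftrightarrow> s = of_real (G_pole \<theta> a k)" for k
  proof -
    have "s = of_real (G_pole \<theta> a k) \<longleftrightarrow> of_real \<theta> * (s + 1) = of_real (a + 1 + real k)"
      using assms unfolding G_pole_def by (auto simp: field_simps)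
    also have "\<dots> \<longleftrightarrow> - of_real \<theta> * (s + 1) + of_real a + 1 = - of_nat k"
      by (auto simp: algebra_simps add_eq_0_iff)
    finally show ?thesis by simp
  qed
  moreover have "z \<in> \<int>\<^sub>\<le>\<^sub>0 \<longleftrightarrow> (\<exists>k. z = - of_nat k)" for z :: complex
    by (auto elim!: nonpos_Ints_cases')
  ultimately show ?thesis by simp
qed

lemma poles_to_right_iff:
  assumes "\<theta> > 0"
  shows "poles_to_right \<theta> a c \<longleftrightarrow> c < G_pole \<theta> a 0"
proof
  assume "poles_to_right \<theta> a c"
  then show "c < G_pole \<theta> a 0"
    unfolding poles_to_right_def G_argument_nonpos_Int_iff[OF assms] by force
next
  assume "c < G_pole \<theta> a 0"
  moreover have "G_pole \<theta> a 0 \<le> G_pole \<theta> a k" for k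
    using assms by (simp add: G_pole_def divide_right_mono)
  ultimately show "poles_to_right \<theta> a c"
    unfolding poles_to_right_def G_argument_nonpos_Int_iff[OF assms] by (auto intro: less_le_trans)
qed

text \<open>In this form all factors but the numerator Gamma are entire, so its poles are the only
  possible singularities. The equation holds at every s: \<open>Gamma\<close> has the value 0 at its
  poles, and division by it gives 0, the value of \<open>rGamma\<close> there.\<close>

lemma G_integrand_eq:
  assumes "x > 0"
  shows "G_integrand \<theta> a x s =
    Gamma (- of_real \<theta> * (s + 1) + of_real a + 1) * rGamma (s + 1) * exp (s * of_real (ln x))"
  using assms by (simp add: G_integrand_def powr_def Ln_of_real Gamma_def divide_inverse)

lemma G_integrand_holomorphic_on:
  assumes "\<theta> > 0" "x > 0" "\<And>k. complex_of_real (G_pole \<theta> a k) \<notin> A"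
  shows "G_integrand \<theta> a x holomorphic_on A"
proof -
  have "(\<lambda>s. Gamma (- of_real \<theta> * (s + 1) + of_real a + 1) * rGamma (s + 1) * exp (s * of_real (ln x))) holomorphic_on A"
  proof (intro holomorphic_intros)
    fix s assume "s \<in> A"
    then show "- complex_of_real \<theta> * (s + 1) + complex_of_real a + 1 \<notin> \<int>\<^sub>\<le>\<^sub>0"
      using assms(3) unfolding G_argument_nonpos_Int_iff[OF assms(1)] by auto
  qed
  then show ?thesis by (simp only: G_integrand_eq[OF assms(2), abs_def])
qed

text \<open>\<open>L\<close> below is the logarithmic derivative of the integrand. Both digamma
  terms enter it with a negative sign; the first is made large enough to outweigh ln x and the
  prescribed \<beta>, and of the second only nonnegativity is used.\<close>

lemma G_integrand_horizontal_decay: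
  assumes "\<theta> > 0" "x > 0"
  shows "\<exists>T0>0. \<forall>T \<sigma>1 \<sigma>2. \<bar>T\<bar> \<ge> T0 \<and> \<sigma>1 \<le> \<sigma>2 \<longrightarrow>
    norm (G_integrand \<theta> a x (Complex \<sigma>2 T)) \<le> norm (G_integrand \<theta> a x (Complex \<sigma>1 T)) * exp (- \<beta> * (\<sigma>2 - \<sigma>1))"
proof -
  define K where "K = (\<bar>\<beta>\<bar> + \<bar>ln x\<bar>)"
  define K1 where "K1 = K / \<theta>"
  obtain T1 where T1: "T1 > 0" "\<And>z. \<bar>Im z\<bar> \<ge> T1 \<Longrightarrow> Re (Digamma z) \<ge> K1"
    using Re_Digamma_at_top[of K1] by auto
  obtain T2 where T2: "T2 > 0" "\<And>z. \<bar>Im z\<bar> \<ge> T2 \<Longrightarrow> Re (Digamma z) \<ge> 0"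
    using Re_Digamma_at_top[of 0] by auto
  let ?w = "\<lambda>s. - complex_of_real \<theta> * (s + 1) + complex_of_real a + 1"
  define L where "L = (\<lambda>s. - of_real \<theta> * Digamma (?w s) - Digamma (s + 1) + of_real (ln x))"
  have main: "norm (G_integrand \<theta> a x (Complex \<sigma>2 T)) \<le> norm (G_integrand \<theta> a x (Complex \<sigma>1 T)) * exp (- \<beta> * (\<sigma>2 - \<sigma>1))"
    if T: "\<bar>T\<bar> \<ge> max (T1 / \<theta>) T2" and le: "\<sigma>1 \<le> \<sigma>2" for T \<sigma>1 \<sigma>2
    using _ _ le
  proof (rule norm_exp_antimono_horizontal[where L = L])
    fix \<sigma>
    let ?s = "Complex \<sigma> T"
    have T0: "T \<noteq> 0" using T T1(1) T2(1) by auto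
    have wn: "?w ?s \<notin> \<int>\<^sub>\<le>\<^sub>0"
      using T0 unfolding G_argument_nonpos_Int_iff[OF assms(1)] by (auto simp: complex_eq_iff)
    have sn: "?s + 1 \<notin> \<int>\<^sub>\<le>\<^sub>0" using T0 by (auto elim!: nonpos_Ints_cases simp: complex_eq_iff)
    have "((\<lambda>s. Gamma (?w s) * rGamma (s + 1) * exp (s * of_real (ln x))) has_field_derivative
        (Gamma (?w ?s) * rGamma (?s + 1) * exp (?s * of_real (ln x))) * L ?s) (at ?s)"
      by (rule derivative_eq_intros wn sn refl | simp)+ (simp add: L_def algebra_simps)
    then show "(G_integrand \<theta> a x has_field_derivative G_integrand \<theta> a x ?s * L ?s) (at ?s)"
      by (simp only: G_integrand_eq[OF assms(2), abs_def])
    have "\<bar>Im (?w ?s)\<bar> \<ge> T1" using T assms(1) by (simp add: abs_mult field_simps)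
    then have "\<theta> * Re (Digamma (?w ?s)) \<ge> \<theta> * K1" using T1(2) assms(1) by (intro mult_left_mono) auto
    moreover have "Re (Digamma (?s + 1)) \<ge> 0" using T by (intro T2(2)) auto
    ultimately show "Re (L ?s) \<le> - \<beta>" using assms(1) by (simp add: L_def K1_def K_def)
  qed
  show ?thesis
    using main T1(1) T2(1) assms(1) by (intro exI[of _ "max (T1 / \<theta>) T2"]) auto
qed

text \<open>The integral of the exponential majorant is B / \<beta> times 1 - exp (- \<beta> l). The
  resulting bound does not depend on \<sigma>2, so the right end of the segment may go to
  infinity.\<close>

lemma contour_integral_horizontal_le:
  fixes f :: "complex \<Rightarrow> complex"
  assumes cont: "continuous_on (closed_segment (Complex \<sigma>1 T) (Complex \<sigma>2 T)) f"
    and le: "\<sigma>1 \<le> \<sigma>2" and \<beta>: "\<beta> > 0"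
    and dec: "\<And>\<sigma>. \<sigma>1 \<le> \<sigma> \<Longrightarrow> norm (f (Complex \<sigma> T)) \<le> B * exp (- \<beta> * (\<sigma> - \<sigma>1))"
  shows "norm (contour_integral (linepath (Complex \<sigma>1 T) (Complex \<sigma>2 T)) f) \<le> B / \<beta>"
proof -
  define l where "l = \<sigma>2 - \<sigma>1"
  have l: "l \<ge> 0" using le by (simp add: l_def)
  have B: "B \<ge> 0" using dec[of \<sigma>1] norm_ge_zero[of "f (Complex \<sigma>1 T)"] by (simp del: norm_ge_zero)
  have lp: "linepath (Complex \<sigma>1 T) (Complex \<sigma>2 T) t = Complex (\<sigma>1 + t * l) T" for t
    by (simp add: linepath_def complex_eq_iff l_def algebra_simps)
  have diff: "Complex \<sigma>2 T - Complex \<sigma>1 T = of_real l" by (simp add: l_def complex_eq_iff)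
  have "f contour_integrable_on linepath (Complex \<sigma>1 T) (Complex \<sigma>2 T)"
    using cont by (rule contour_integrable_continuous_linepath)
  then have "(f has_contour_integral contour_integral (linepath (Complex \<sigma>1 T) (Complex \<sigma>2 T)) f) (linepath (Complex \<sigma>1 T) (Complex \<sigma>2 T))"
    by (rule has_contour_integral_integral)
  then have hi: "((\<lambda>t. f (Complex (\<sigma>1 + t * l) T) * of_real l) has_integral
      contour_integral (linepath (Complex \<sigma>1 T) (Complex \<sigma>2 T)) f) {0..1}"
    by (simp add: has_contour_integral_linepath lp diff)
  have "((\<lambda>t. B * l * exp (- \<beta> * l * t)) has_integral
      (- (B / \<beta>) * exp (- \<beta> * l * 1) - (- (B / \<beta>) * exp (- \<beta> * l * 0)))) {0..1}"
    by (rule fundamental_theorem_of_calculus)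
       (use \<beta> in \<open>auto intro!: derivative_eq_intros simp: has_real_derivative_iff_has_vector_derivative[symmetric]\<close>)
  then have gi: "((\<lambda>t. B * l * exp (- \<beta> * l * t)) has_integral (B / \<beta> * (1 - exp (- \<beta> * l)))) {0..1}"
    by (simp add: algebra_simps)
  have "norm (integral {0..1} (\<lambda>t. f (Complex (\<sigma>1 + t * l) T) * of_real l)) \<le> integral {0..1} (\<lambda>t. B * l * exp (- \<beta> * l * t))"
  proof (rule integral_norm_bound_integral)
    fix t :: real assume t: "t \<in> {0..1}"
    have "norm (f (Complex (\<sigma>1 + t * l) T)) \<le> B * exp (- \<beta> * (\<sigma>1 + t * l - \<sigma>1))"
      using t l by (intro dec) auto
    then have "norm (f (Complex (\<sigma>1 + t * l) T)) * l \<le> B * exp (- \<beta> * (\<sigma>1 + t * l - \<sigma>1)) * l"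
      using l by (rule mult_right_mono)
    then show "norm (f (Complex (\<sigma>1 + t * l) T) * of_real l) \<le> B * l * exp (- \<beta> * l * t)"
      using l by (simp add: norm_mult mult_ac)
  qed (use hi gi in \<open>auto simp: has_integral_integrable\<close>)
  also have "\<dots> = B / \<beta> * (1 - exp (- \<beta> * l))" using gi by (rule integral_unique)
  also have "\<dots> \<le> B / \<beta> * 1" using B \<beta> by (intro mult_left_mono) auto
  finally show ?thesis by (simp only: integral_unique[OF hi] mult_1_right)
qed

text \<open>Gamma has residue (-1)^k / k! at -k, and the inner affine map satisfies w + k = -
  \<theta> (s - p), which contributes the factor -1 / \<theta>.\<close>

lemma residue_G_integrand:
  assumes "\<theta> > 0" "x > 0"
  shows "residue (G_integrand \<theta> a x) (of_real (G_pole \<theta> a k)) =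
    of_real (- ((-1) ^ k / (\<theta> * fact k) * rGamma (G_pole \<theta> a k + 1) * x powr G_pole \<theta> a k))"
proof -
  define p where "p = complex_of_real (G_pole \<theta> a k)"
  \<comment> \<open>\<open>S\<close> leaves out every pole except p. It is open although infinitely
    many points are removed, being the preimage of the complement of a set of integers, which is
    closed.\<close>
  define S where "S = - (range (\<lambda>k. complex_of_real (G_pole \<theta> a k)) - {p})"
  let ?w = "\<lambda>s. - complex_of_real \<theta> * (s + 1) + complex_of_real a + 1"
  have th: "complex_of_real \<theta> \<noteq> 0" using assms by simp
  have wp: "?w s + of_nat k = - of_real \<theta> * (s - p)" for s
    using th by (simp add: p_def G_pole_def field_simps)
  have wpp: "?w p = - of_nat k" using wp[of p] by (simp add: add_eq_0_iff)
  have "residue (G_integrand \<theta> a x) p = (-1) ^ k / fact k * (- 1 / of_real \<theta>) * (rGamma (p + 1) * exp (p * of_real (ln x)))"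
  proof (rule residue_simple')
    show "open S"
    proof -
      have "S = ?w -` (- (\<int>\<^sub>\<le>\<^sub>0 - {- of_nat k}))"
      proof (intro set_eqI)
        fix s
        have "?w s = - of_nat k \<longleftrightarrow> s = p" using wp[of s] th by (auto simp: add_eq_0_iff)
        then show "s \<in> S \<longleftrightarrow> s \<in> ?w -` (- (\<int>\<^sub>\<le>\<^sub>0 - {- of_nat k}))"
          using G_argument_nonpos_Int_iff[OF assms(1), of s a] by (auto simp: S_def)
      qed
      also have "open \<dots>"
        by (intro open_vimage open_Compl closed_subset_Ints continuous_intros) auto
      finally show ?thesis .
    qed
    show "p \<in> S" by (auto simp: S_def)
    show "G_integrand \<theta> a x holomorphic_on S - {p}"
      using assms by (intro G_integrand_holomorphic_on) (auto simp: S_def)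
    have fl: "filterlim ?w (at (- of_nat k)) (at p)"
    proof -
      have "(?w \<longlongrightarrow> ?w p) (at p)" by (intro tendsto_intros)
      moreover have "eventually (\<lambda>s. ?w s \<noteq> - of_nat k) (at p)"
        using eventually_neq_at_within[of p p UNIV]
      proof eventually_elim
        case (elim s)
        then show ?case using wp[of s] th by (auto simp: add_eq_0_iff)
      qed
      ultimately show ?thesis unfolding wpp by (auto simp: filterlim_at)
    qed
    have "((\<lambda>s. Gamma (?w s) * (?w s + of_nat k)) \<longlongrightarrow> (-1) ^ k / fact k) (at p)"
      using filterlim_compose[OF Gamma_residues fl] .
    moreover have "((\<lambda>s. rGamma (s + 1)) \<longlongrightarrow> rGamma (p + 1)) (at p)"
    proof -
      have "isCont (\<lambda>s. rGamma (s + 1)) p" by (intro continuous_intros)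
      then show ?thesis by (simp add: isCont_def)
    qed
    ultimately have "((\<lambda>s. Gamma (?w s) * (?w s + of_nat k) * (- 1 / of_real \<theta>) * (rGamma (s + 1) * exp (s * of_real (ln x))))
      \<longlongrightarrow> (-1) ^ k / fact k * (- 1 / of_real \<theta>) * (rGamma (p + 1) * exp (p * of_real (ln x)))) (at p)"
      by (intro tendsto_intros)
    then show "((\<lambda>s. G_integrand \<theta> a x s * (s - p)) \<longlongrightarrow> (-1) ^ k / fact k * (- 1 / of_real \<theta>) * (rGamma (p + 1) * exp (p * of_real (ln x)))) (at p)"
    proof (rule Lim_transform_eventually)
      show "\<forall>\<^sub>F s in at p. Gamma (?w s) * (?w s + of_nat k) * (- 1 / of_real \<theta>) * (rGamma (s + 1) * exp (s * of_real (ln x))) =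
          G_integrand \<theta> a x s * (s - p)"
        by (rule always_eventually) (simp only: wp G_integrand_eq[OF assms(2)], use th in simp)
    qed
  qed
  also have "rGamma (p + 1) = of_real (rGamma (G_pole \<theta> a k + 1))"
    unfolding p_def by (metis of_real_1 of_real_add rGamma_complex_of_real)
  also have "exp (p * of_real (ln x)) = of_real (x powr G_pole \<theta> a k)"
    using assms by (simp add: p_def powr_def exp_of_real[symmetric])
  finally show ?thesis by (simp add: p_def mult_ac)
qed

section \<open>Decay of the integrand on far vertical segments between the poles\<close>

lemma norm_pochhammer_ge_1:
  fixes z :: complex
  assumes "Re z \<ge> 1"
  shows "norm (pochhammer z n) \<ge> 1"
proof -
  have "1 \<le> (\<Prod>i<n. norm (z + of_nat i))"
  proof (rule prod_ge_1)
    fix i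
    have "1 \<le> Re (z + of_nat i)" using assms by simp
    also have "\<dots> \<le> norm (z + of_nat i)" by (rule complex_Re_le_cmod)
    finally show "1 \<le> norm (z + of_nat i)" .
  qed
  then show ?thesis by (simp add: pochhammer_prod prod_norm atLeast0LessThan)
qed

text \<open>Compactness covers 1 \<le> Re z \<le> 2. Any other z is moved there by subtracting an
  integer, and the Pochhammer factor in rGamma z' = pochhammer z' n * rGamma z has modulus at least
  1.\<close>

lemma rGamma_bounded_strip:
  "\<exists>C>0. \<forall>z. Re z \<ge> 1 \<and> \<bar>Im z\<bar> \<le> T \<longrightarrow> norm (rGamma z :: complex) \<le> C"
proof -
  have "compact (rGamma ` cbox (Complex 1 (-T)) (Complex 2 T))"
    by (intro compact_continuous_image continuous_on_rGamma compact_cbox)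
  then obtain C where C: "C > 0" "\<And>z. z \<in> cbox (Complex 1 (-T)) (Complex 2 T) \<Longrightarrow> norm (rGamma z) \<le> C"
    unfolding bounded_pos[THEN iffD1, OF compact_imp_bounded, simplified] 
    using bounded_pos compact_imp_bounded by (metis image_eqI)
  have "norm (rGamma z) \<le> C" if z: "Re z \<ge> 1" "\<bar>Im z\<bar> \<le> T" for z
  proof -
    define n where "n = nat \<lfloor>Re z - 1\<rfloor>"
    define z' where "z' = z - of_nat n"
    have n: "real n \<le> Re z - 1" "Re z - 1 < real n + 1" using z by (auto simp: n_def)
    have z': "z' \<in> cbox (Complex 1 (-T)) (Complex 2 T)"
      using n z by (auto simp: z'_def in_cbox_complex_iff)
    have "rGamma z' = pochhammer z' n * rGamma z" using pochhammer_rGamma[of z' n] by (simp add: z'_def)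
    then have "norm (rGamma z') = norm (pochhammer z' n) * norm (rGamma z)" by (simp add: norm_mult)
    also have "\<dots> \<ge> 1 * norm (rGamma z)"
      by (intro mult_right_mono norm_pochhammer_ge_1) (use n in \<open>auto simp: z'_def\<close>)
    finally show ?thesis using C(2)[OF z'] by simp
  qed
  with C(1) show ?thesis by blast
qed

text \<open>The line Re w = -m - 1/2 runs midway between two poles. Shifting it by m + 1 to Re w =
  1/2 produces a Pochhammer product whose factors, read backwards, have modulus at least i +
  1/2.\<close>

lemma norm_Gamma_minus_half_le:
  "norm (Gamma (Complex (- real m - 1/2) t)) \<le> 2 * norm (Gamma (Complex (1/2) t)) / fact m"
proof -
  let ?z = "Complex (- real m - 1/2) t"
  have half: "- real m - 1/2 \<noteq> - real k" for k
  proof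
    assume "- real m - 1/2 = - real k"
    then have "real (2 * m + 1) = real (2 * k)" by simp
    then have "2 * m + 1 = 2 * k" by (simp only: of_nat_eq_iff)
    then show False by presburger
  qed
  have z: "?z \<notin> \<int>\<^sub>\<le>\<^sub>0" using half by (auto elim!: nonpos_Ints_cases' simp: complex_eq_iff)
  have eq: "?z + of_nat (m + 1) = Complex (1/2) t" by (simp add: complex_eq_iff)
  have "pochhammer ?z (m + 1) = Gamma (Complex (1/2) t) / Gamma ?z"
    using pochhammer_Gamma[OF z, of "m + 1"] unfolding eq .
  then have G: "Gamma (Complex (1/2) t) = pochhammer ?z (m + 1) * Gamma ?z"
    using z by (simp add: Gamma_eq_zero_iff)
  have "norm (pochhammer ?z (m + 1)) = (\<Prod>i<m+1. norm (?z + of_nat i))"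
    by (simp add: pochhammer_prod prod_norm atLeast0LessThan del: of_nat_Suc)
  also have "\<dots> = (\<Prod>i<m+1. norm (?z + of_nat (m - i)))"
    by (rule prod.reindex_bij_witness[of _ "\<lambda>i. m - i" "\<lambda>i. m - i"]) auto
  \<comment> \<open>Weakening i + 1/2 to i for i > 0 and to 1/2 for i = 0 makes the product exactly
    m! / 2.\<close>
  also have "\<dots> \<ge> (\<Prod>i<m+1. if i = 0 then 1/2 else real i)"
  proof (intro prod_mono conjI)
    fix i assume i: "i \<in> {..<m+1}"
    have "real i + 1/2 = \<bar>Re (?z + of_nat (m - i))\<bar>" using i by (simp add: of_nat_diff)
    also have "\<dots> \<le> norm (?z + of_nat (m - i))" by (rule abs_Re_le_cmod)
    finally have "real i + 1/2 \<le> norm (?z + of_nat (m - i))" .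
    then show "(if i = 0 then 1/2 else real i) \<le> norm (?z + of_nat (m - i))" by (cases "i = 0") auto
  qed auto
  also have "(\<Prod>i<m+1. if i = 0 then 1/2 else real i) = fact m / 2"
    by (induction m) (auto simp: algebra_simps)
  finally have p: "fact m / 2 \<le> norm (pochhammer ?z (m + 1))" .
  have "fact m / 2 * norm (Gamma ?z) \<le> norm (Gamma (Complex (1/2) t))"
    unfolding G norm_mult by (intro mult_right_mono p) auto
  then show ?thesis by (simp add: field_simps)
qed

text \<open>These abscissae lie halfway between the poles of index m and m + 1, where the Gamma
  argument has real part -m - 1/2. The resulting 1 / m! beats the geometric growth of x^s in m,
  while 1 / Gamma (s + 1) stays bounded in the strip |Im s| \<le> T.\<close>

lemma G_integrand_vertical_tendsto_0:
  assumes \<theta>: "\<theta> > 0" and x: "x > 0"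
  shows "\<exists>B. B \<longlonglongrightarrow> 0 \<and> (\<forall>\<^sub>F m in sequentially. \<forall>t. \<bar>t\<bar> \<le> T \<longrightarrow>
     norm (G_integrand \<theta> a x (Complex ((a + 3/2 + real m) / \<theta> - 1) t)) \<le> B m)"
proof -
  obtain C1 where C1: "C1 > 0" "\<And>z. Re z \<ge> 1 \<Longrightarrow> \<bar>Im z\<bar> \<le> T \<Longrightarrow> norm (rGamma z :: complex) \<le> C1"
    using rGamma_bounded_strip by blast
  have "compact ((\<lambda>t. Gamma (Complex (1/2) t)) ` {-\<theta>*T..\<theta>*T})"
  proof (intro compact_continuous_image compact_Icc)
    have "continuous_on {z. Re z > 0} (Gamma :: complex \<Rightarrow> complex)"
      by (intro continuous_on_Gamma) (auto elim!: nonpos_Ints_cases')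
    moreover have "continuous_on {-\<theta>*T..\<theta>*T} (Complex (1/2))"
      unfolding Complex_eq by (intro continuous_intros)
    ultimately show "continuous_on {-\<theta>*T..\<theta>*T} (\<lambda>t. Gamma (Complex (1/2) t))"
      by (rule continuous_on_compose2) auto
  qed
  then have "bounded ((\<lambda>t. Gamma (Complex (1/2) t)) ` {-\<theta>*T..\<theta>*T})" by (rule compact_imp_bounded)
  then obtain C2 where C2: "C2 > 0" "\<And>t. t \<in> {-\<theta>*T..\<theta>*T} \<Longrightarrow> norm (Gamma (Complex (1/2) t)) \<le> C2"
    unfolding bounded_pos by auto
  define B where "B = (\<lambda>m. 2 * C2 * C1 * exp (((a + 3/2) / \<theta> - 1) * ln x) * (exp (ln x / \<theta>) ^ m / fact m))"
  have "(\<lambda>m. exp (ln x / \<theta>) ^ m / fact m) \<longlonglongrightarrow> 0"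
    using summable_LIMSEQ_zero[OF summable_exp[of "exp (ln x / \<theta>)"]] by (simp add: divide_inverse mult.commute)
  from tendsto_mult_right_zero[OF this] have "B \<longlonglongrightarrow> 0" unfolding B_def .
  moreover have "\<forall>\<^sub>F m in sequentially. \<forall>t. \<bar>t\<bar> \<le> T \<longrightarrow>
     norm (G_integrand \<theta> a x (Complex ((a + 3/2 + real m) / \<theta> - 1) t)) \<le> B m"
  proof -
    \<comment> \<open>From m0 on, Re (s + 1) \<ge> 1, the range of the bound on
      \<open>rGamma\<close>.\<close>
    obtain m0 :: nat where m0: "\<theta> + \<bar>a\<bar> \<le> real m0" using real_arch_simple by blast
    have "norm (G_integrand \<theta> a x (Complex ((a + 3/2 + real m) / \<theta> - 1) t)) \<le> B m"
      if m: "m \<ge> m0" and t: "\<bar>t\<bar> \<le> T" for m t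
    proof -
      let ?s = "Complex ((a + 3/2 + real m) / \<theta> - 1) t"
      have w: "- complex_of_real \<theta> * (?s + 1) + complex_of_real a + 1 = Complex (- real m - 1/2) (- \<theta> * t)"
        using \<theta> by (simp add: complex_eq_iff)
      have tt: "- \<theta> * t \<in> {-\<theta>*T..\<theta>*T}"
        using t \<theta> mult_left_mono[of t T \<theta>] mult_left_mono[of "-t" T \<theta>] by auto
      have "norm (Gamma (Complex (- real m - 1/2) (- \<theta> * t))) \<le> 2 * norm (Gamma (Complex (1/2) (- \<theta> * t))) / fact m"
        by (rule norm_Gamma_minus_half_le)
      also have "\<dots> \<le> 2 * C2 / fact m"
        using C2(2)[OF tt] by (intro divide_right_mono mult_left_mono) auto
      finally have 1: "norm (Gamma (Complex (- real m - 1/2) (- \<theta> * t))) \<le> 2 * C2 / fact m" .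
      have "real m0 \<le> real m" using m by simp
      with m0 have "\<theta> * 1 \<le> a + 3/2 + real m" by linarith
      then have "Re (?s + 1) \<ge> 1" using \<theta> by (simp add: field_simps)
      then have 2: "norm (rGamma (?s + 1)) \<le> C1" using C1(2)[of "?s + 1"] t by simp
      have e1: "norm (exp (?s * of_real (ln x))) = exp (((a + 3/2 + real m) / \<theta> - 1) * ln x)" by simp
      have e2: "((a + 3/2 + real m) / \<theta> - 1) * ln x = ((a + 3/2) / \<theta> - 1) * ln x + real m * (ln x / \<theta>)"
        using \<theta> by (simp add: field_simps)
      have 3: "norm (exp (?s * of_real (ln x))) = exp (((a + 3/2) / \<theta> - 1) * ln x) * exp (ln x / \<theta>) ^ m"
        unfolding e1 e2 exp_add exp_of_nat_mult ..
      have "norm (G_integrand \<theta> a x ?s) = norm (Gamma (Complex (- real m - 1/2) (- \<theta> * t))) * norm (rGamma (?s + 1)) * norm (exp (?s * of_real (ln x)))"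
        unfolding G_integrand_eq[OF x] w norm_mult ..
      also have "\<dots> \<le> (2 * C2 / fact m) * C1 * (exp (((a + 3/2) / \<theta> - 1) * ln x) * exp (ln x / \<theta>) ^ m)"
        unfolding 3 by (intro mult_mono 1 2) (use C1(1) C2(1) in auto)
      finally show ?thesis by (simp add: B_def mult_ac)
    qed
    then show ?thesis unfolding eventually_sequentially by blast
  qed
  ultimately show ?thesis by blast
qed

text \<open>The residue at the k-th pole with its sign reversed and the power of x removed: closing
  an upward contour on the right encircles the poles clockwise.\<close>

definition G_coeff :: "real \<Rightarrow> real \<Rightarrow> nat \<Rightarrow> real" where
  "G_coeff \<theta> a k = (-1) ^ k / (\<theta> * fact k) * rGamma (G_pole \<theta> a k + 1)"

section \<open>Cauchy's theorem and the residue theorem for the contour\<close>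

lemma contour_integral_triangle:
  assumes "f holomorphic_on S" "convex S" "a \<in> S" "b \<in> S" "c \<in> S"
  shows "contour_integral (linepath a c) f = contour_integral (linepath a b) f + contour_integral (linepath b c) f"
proof -
  have "convex hull {a, b, c} \<subseteq> S" using assms by (intro hull_minimal) auto
  then have "f holomorphic_on convex hull {a, b, c}" using assms(1) holomorphic_on_subset by blast
  from has_chain_integral_chain_integral3[OF Cauchy_theorem_triangle[OF this]]
  have "contour_integral (linepath a b) f + contour_integral (linepath b c) f + contour_integral (linepath c a) f = 0" .
  moreover have "closed_segment c a \<subseteq> S" using assms by (intro closed_segment_subset) auto
  then have "contour_integral (linepath c a) f = - contour_integral (linepath a c) f"
    using assms(1) by (intro contour_integral_reverse_linepath) (meson continuous_on_subset holomorphic_on_imp_continuous_on)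
  ultimately show ?thesis by (simp add: eq_neg_iff_add_eq_0)
qed

lemma contour_integral_rectpath:
  assumes "continuous_on (path_image (rectpath (Complex l b) (Complex r t))) f" "l \<le> r" "b \<le> t"
  shows "contour_integral (rectpath (Complex l b) (Complex r t)) f =
    contour_integral (linepath (Complex l b) (Complex r b)) f + contour_integral (linepath (Complex r b) (Complex r t)) f
    - contour_integral (linepath (Complex l t) (Complex r t)) f - contour_integral (linepath (Complex l b) (Complex l t)) f"
proof -
  let ?ci = "\<lambda>p q. contour_integral (linepath p q) f"
  have pim: "path_image (rectpath (Complex l b) (Complex r t)) =
     closed_segment (Complex l b) (Complex r b) \<union> closed_segment (Complex r b) (Complex r t)
     \<union> closed_segment (Complex r t) (Complex l t) \<union> closed_segment (Complex l t) (Complex l b)"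
    by (simp add: rectpath_def Let_def path_image_join Un_assoc)
  have c1: "continuous_on (closed_segment (Complex l b) (Complex r b)) f"
    and c2: "continuous_on (closed_segment (Complex r b) (Complex r t)) f"
    and c3: "continuous_on (closed_segment (Complex r t) (Complex l t)) f"
    and c4: "continuous_on (closed_segment (Complex l t) (Complex l b)) f"
    using assms(1) unfolding pim by (auto intro: continuous_on_subset)
  note ci = c1[THEN contour_integrable_continuous_linepath] c2[THEN contour_integrable_continuous_linepath]
    c3[THEN contour_integrable_continuous_linepath] c4[THEN contour_integrable_continuous_linepath]
  have "contour_integral (rectpath (Complex l b) (Complex r t)) f =
     ?ci (Complex l b) (Complex r b) + (?ci (Complex r b) (Complex r t) + (?ci (Complex r t) (Complex l t) + ?ci (Complex l t) (Complex l b)))"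
    using ci by (simp add: rectpath_def Let_def)
  moreover have "?ci (Complex r t) (Complex l t) = - ?ci (Complex l t) (Complex r t)"
    using c3 by (rule contour_integral_reverse_linepath)
  moreover have "?ci (Complex l t) (Complex l b) = - ?ci (Complex l b) (Complex l t)"
    using c4 by (rule contour_integral_reverse_linepath)
  ultimately show ?thesis by simp
qed

text \<open>The right side X lies between the poles of index m and m + 1, so exactly the poles 0,
  ..., m are enclosed, each with winding number 1. The half-plane \<open>S\<close> ends at the next
  pole, which leaves a finite set of singularities for the residue theorem.\<close>

lemma contour_integral_rectpath_G_integrand:
  fixes m :: nat and T \<theta> a :: real
  defines "X \<equiv> (a + 3/2 + real m) / \<theta> - 1"
  assumes \<theta>: "\<theta> > 0" and x: "x > 0" and c: "c < G_pole \<theta> a 0" and T: "T > 0"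
  shows "continuous_on (path_image (rectpath (Complex c (-T)) (Complex X T))) (G_integrand \<theta> a x)"
    and "contour_integral (rectpath (Complex c (-T)) (Complex X T)) (G_integrand \<theta> a x) =
      - (2 * of_real pi * \<i> * of_real (\<Sum>k\<le>m. G_coeff \<theta> a k * x powr G_pole \<theta> a k))"
proof -
  let ?f = "G_integrand \<theta> a x"
  define S where "S = {s. Re s < G_pole \<theta> a (m + 1)}"
  define P where "P = (\<lambda>k. complex_of_real (G_pole \<theta> a k))"
  have pole_X: "G_pole \<theta> a k < X \<longleftrightarrow> k \<le> m" for k
  proof -
    have "G_pole \<theta> a k < X \<longleftrightarrow> a + 1 + real k < a + 3/2 + real m"
      using \<theta> unfolding X_def G_pole_def by (simp add: divide_less_cancel)
    also have "\<dots> \<longleftrightarrow> k \<le> m" by (cases "k \<le> m") auto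
    finally show ?thesis .
  qed
  have ne_X: "G_pole \<theta> a k \<noteq> X" for k
  proof
    assume "G_pole \<theta> a k = X"
    then have "a + 1 + real k = a + 3/2 + real m" using \<theta> by (simp add: X_def G_pole_def)
    then have "real (2 * k) = real (2 * m + 1)" by simp
    then have "2 * k = 2 * m + 1" by (simp only: of_nat_eq_iff)
    then show False by presburger
  qed
  have c_lt: "c < G_pole \<theta> a k" for k
    using c \<theta> by (intro less_le_trans[OF c]) (simp add: G_pole_def divide_right_mono)
  have cX: "c < X" using c_lt[of 0] pole_X[of 0] by simp
  have X_less: "X < G_pole \<theta> a (m + 1)" using pole_X[of "m+1"] ne_X[of "m+1"] by auto
  have pi: "path_image (rectpath (Complex c (-T)) (Complex X T)) \<subseteq> S - P ` {..m}"
    using T cX X_less c_lt ne_X by (auto simp: path_image_rectpath S_def P_def complex_eq_iff; metis less_irrefl)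
  have holo: "?f holomorphic_on S - P ` {..m}"
  proof (rule G_integrand_holomorphic_on[OF \<theta> x])
    fix k
    show "complex_of_real (G_pole \<theta> a k) \<notin> S - P ` {..m}"
      using G_pole_less_iff[OF \<theta>, of a k "m + 1"] by (auto simp: S_def P_def)
  qed
  show "continuous_on (path_image (rectpath (Complex c (-T)) (Complex X T))) ?f"
    using holomorphic_on_imp_continuous_on[OF holo] pi continuous_on_subset by blast
  have Sconv: "convex S" "open S" unfolding S_def by (auto intro: convex_halfspace_Re_lt open_halfspace_Re_lt)
  have inj: "inj_on P {..m}" using \<theta> by (auto simp: P_def inj_on_def G_pole_def)
  have "contour_integral (rectpath (Complex c (-T)) (Complex X T)) ?f =
      2 * pi * \<i> * (\<Sum>p\<in>P ` {..m}. winding_number (rectpath (Complex c (-T)) (Complex X T)) p * residue ?f p)"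
  proof (rule Residue_theorem[OF _ _ _ holo _ _ pi])
    show "\<forall>z. z \<notin> S \<longrightarrow> winding_number (rectpath (Complex c (-T)) (Complex X T)) z = 0"
    proof safe
      fix z assume "z \<notin> S"
      then show "winding_number (rectpath (Complex c (-T)) (Complex X T)) z = 0"
        using pi Sconv by (intro winding_number_zero_outside[of _ S]) auto
    qed
  qed (use Sconv in \<open>auto intro: convex_connected\<close>)
  also have "(\<Sum>p\<in>P ` {..m}. winding_number (rectpath (Complex c (-T)) (Complex X T)) p * residue ?f p) =
      (\<Sum>k\<le>m. winding_number (rectpath (Complex c (-T)) (Complex X T)) (P k) * residue ?f (P k))"
    by (subst sum.reindex[OF inj]) simp
  also have "\<dots> = (\<Sum>k\<le>m. - of_real (G_coeff \<theta> a k * x powr G_pole \<theta> a k))"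
  proof (rule sum.cong)
    fix k assume k: "k \<in> {..m}"
    have "winding_number (rectpath (Complex c (-T)) (Complex X T)) (P k) = 1"
      using k T c_lt pole_X by (intro winding_number_rectpath) (auto simp: in_box_complex_iff P_def)
    then show "winding_number (rectpath (Complex c (-T)) (Complex X T)) (P k) * residue ?f (P k) =
        - of_real (G_coeff \<theta> a k * x powr G_pole \<theta> a k)"
      by (simp only: P_def residue_G_integrand[OF \<theta> x] G_coeff_def of_real_minus mult_1)
  qed simp
  finally show "contour_integral (rectpath (Complex c (-T)) (Complex X T)) ?f =
      - (2 * of_real pi * \<i> * of_real (\<Sum>k\<le>m. G_coeff \<theta> a k * x powr G_pole \<theta> a k))"
    by (simp add: sum_negf)
qed

text \<open>These half-planes meet the real axis in Re s \<le> c, hence contain no pole when all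
  poles exceed c. Slope \<kappa> serves the upper arm of the contour, - \<kappa> the lower arm and 0
  the vertical line.\<close>

lemma Re_halfplane_convex: "convex {s. Re s \<le> c + \<kappa> * Im s}"
proof -
  have "{s. Re s \<le> c + \<kappa> * Im s} = {s. inner (Complex 1 (- \<kappa>)) s \<le> c}"
    by (auto simp: inner_complex_def algebra_simps)
  then show ?thesis by (simp only: convex_halfspace_le)
qed

text \<open>Cauchy's theorem on two triangles replaces the tilted arms by the vertical segment on Re
  s = c and horizontal pieces from c to c + \<kappa> T. These pieces cancel against the left
  portions of the horizontal sides of the rectangle. What remains is the portion of each side beyond
  the end of the contour and the far vertical side, which vanishes as m grows with T fixed.\<close>

lemma contour_integral_G_contour_le:
  assumes \<theta>: "\<theta> > 0" and x: "x > 0" and c: "c < G_pole \<theta> a 0" and \<kappa>: "\<kappa> \<ge> 0" and T: "T > 0" and \<beta>: "\<beta> > 0"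
    and dec: "\<And>T' \<sigma>1 \<sigma>2. \<bar>T'\<bar> = T \<Longrightarrow> \<sigma>1 \<le> \<sigma>2 \<Longrightarrow>
      norm (G_integrand \<theta> a x (Complex \<sigma>2 T')) \<le> norm (G_integrand \<theta> a x (Complex \<sigma>1 T')) * exp (- \<beta> * (\<sigma>2 - \<sigma>1))"
    and S: "(\<lambda>k. G_coeff \<theta> a k * x powr G_pole \<theta> a k) sums S"
  shows "norm (contour_integral (G_contour c \<kappa> T) (G_integrand \<theta> a x) - 2 * of_real pi * \<i> * of_real S)
     \<le> norm (G_integrand \<theta> a x (Complex (c + \<kappa> * T) T)) / \<beta> + norm (G_integrand \<theta> a x (Complex (c + \<kappa> * T) (-T))) / \<beta>"
    (is "_ \<le> ?R")
proof -
  let ?f = "G_integrand \<theta> a x"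
  let ?ci = "\<lambda>p q. contour_integral (linepath p q) ?f"
  define Pp where "Pp = Complex (c + \<kappa> * T) T"
  define Pm where "Pm = Complex (c + \<kappa> * T) (-T)"
  have c_lt: "c < G_pole \<theta> a k" for k
    using c \<theta> by (intro less_le_trans[OF c]) (simp add: G_pole_def divide_right_mono)
  have holH: "?f holomorphic_on {s. Re s \<le> c + k * Im s}" for k
    using c_lt by (intro G_integrand_holomorphic_on[OF \<theta> x]) (auto simp: not_le)
  have holI: "?f holomorphic_on {s. Im s \<noteq> 0}"
    by (intro G_integrand_holomorphic_on[OF \<theta> x]) auto
  have contI: "continuous_on (closed_segment (Complex u T') (Complex v T')) ?f" if "T' \<noteq> 0" for u v T'
  proof -
    have "closed_segment (Complex u T') (Complex v T') \<subseteq> {s. Im s = T'}"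
      by (auto simp: closed_segment_same_Im)
    also have "\<dots> \<subseteq> {s. Im s \<noteq> 0}" using that by auto
    finally show ?thesis using holomorphic_on_imp_continuous_on[OF holI] continuous_on_subset by blast
  qed
  have contH: "continuous_on (closed_segment u v) ?f" if "Re u \<le> c + k * Im u" "Re v \<le> c + k * Im v" for u v k
  proof -
    have "closed_segment u v \<subseteq> {s. Re s \<le> c + k * Im s}"
      using that by (intro closed_segment_subset Re_halfplane_convex) auto
    then show ?thesis using holomorphic_on_imp_continuous_on[OF holH] continuous_on_subset by blast
  qed
  have up: "?ci (Complex c 0) Pp = ?ci (Complex c 0) (Complex c T) + ?ci (Complex c T) Pp"
    by (rule contour_integral_triangle[OF holH[of \<kappa>] Re_halfplane_convex]) (use \<kappa> T in \<open>auto simp: Pp_def\<close>)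
  have down: "?ci (Complex c 0) Pm = ?ci (Complex c 0) (Complex c (-T)) + ?ci (Complex c (-T)) Pm"
    by (rule contour_integral_triangle[OF holH[of "-\<kappa>"] Re_halfplane_convex]) (use \<kappa> T in \<open>auto simp: Pm_def\<close>)
  have mid: "?ci (Complex c (-T)) (Complex c T) = ?ci (Complex c (-T)) (Complex c 0) + ?ci (Complex c 0) (Complex c T)"
    by (rule contour_integral_triangle[OF holH[of 0] Re_halfplane_convex]) auto
  have rev1: "?ci (Complex c (-T)) (Complex c 0) = - ?ci (Complex c 0) (Complex c (-T))"
    by (intro contour_integral_reverse_linepath contH[of _ 0]) auto
  have rev2: "?ci Pm (Complex c 0) = - ?ci (Complex c 0) Pm"
    by (intro contour_integral_reverse_linepath contH[of _ "-\<kappa>"]) (auto simp: Pm_def)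
  have J: "contour_integral (G_contour c \<kappa> T) ?f = ?ci Pm (Complex c 0) + ?ci (Complex c 0) Pp"
  proof -
    have "?f contour_integrable_on linepath Pm (Complex c 0)" "?f contour_integrable_on linepath (Complex c 0) Pp"
      by (intro contour_integrable_continuous_linepath contH[of _ "-\<kappa>"]; simp add: Pm_def)
         (intro contour_integrable_continuous_linepath contH[of _ "\<kappa>"]; simp add: Pp_def)
    then show ?thesis by (simp add: G_contour_def Pp_def Pm_def complex_of_real_def)
  qed
  obtain B where B: "B \<longlonglongrightarrow> 0" and evB: "\<forall>\<^sub>F m in sequentially. \<forall>t. \<bar>t\<bar> \<le> T \<longrightarrow>
     norm (?f (Complex ((a + 3/2 + real m) / \<theta> - 1) t)) \<le> B m"
    using G_integrand_vertical_tendsto_0[OF \<theta> x] by blast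
  have "\<forall>\<^sub>F m in sequentially. norm (contour_integral (G_contour c \<kappa> T) ?f - 2 * of_real pi * \<i> * of_real (\<Sum>k\<le>m. G_coeff \<theta> a k * x powr G_pole \<theta> a k))
     \<le> B m * (2 * T) + ?R"
  proof -
    \<comment> \<open>From m0 on, the right side of the rectangle lies beyond both ends of the
      contour.\<close>
    obtain m0 :: nat where m0: "\<theta> * (c + \<kappa> * T + 1) - a \<le> real m0" using real_arch_simple by blast
    show ?thesis using evB eventually_ge_at_top[of m0]
    proof eventually_elim
      case (elim m)
      define X where "X = (a + 3/2 + real m) / \<theta> - 1"
      define R where "R = (\<Sum>k\<le>m. G_coeff \<theta> a k * x powr G_pole \<theta> a k)"
      have XX: "c + \<kappa> * T \<le> X"
      proof -
        have "\<theta> * (c + \<kappa> * T + 1) \<le> a + 3/2 + real m" using m0 elim(2) by linarith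
        then show ?thesis using \<theta> by (simp add: X_def field_simps)
      qed
      have kT: "\<kappa> * T \<ge> 0" using \<kappa> T by simp
      have split: "?ci (Complex c T') (Complex X T') = ?ci (Complex c T') (Complex (c + \<kappa> * T) T') + ?ci (Complex (c + \<kappa> * T) T') (Complex X T')"
        if "T' \<noteq> 0" for T'
        using that XX kT by (intro contour_integral_split_linepath contI) (auto simp: closed_segment_same_Im closed_segment_eq_real_ivl)
      have "contour_integral (rectpath (Complex c (-T)) (Complex X T)) ?f = - (2 * of_real pi * \<i> * of_real R)"
        unfolding R_def X_def by (rule contour_integral_rectpath_G_integrand(2)[OF \<theta> x c T])
      moreover have "contour_integral (rectpath (Complex c (-T)) (Complex X T)) ?f =
          ?ci (Complex c (-T)) (Complex X (-T)) + ?ci (Complex X (-T)) (Complex X T)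
        - ?ci (Complex c T) (Complex X T) - ?ci (Complex c (-T)) (Complex c T)"
        using XX kT T contour_integral_rectpath_G_integrand(1)[OF \<theta> x c T, of m]
        by (intro contour_integral_rectpath) (auto simp: X_def)
      ultimately have eq: "contour_integral (G_contour c \<kappa> T) ?f - 2 * of_real pi * \<i> * of_real R =
          ?ci Pm (Complex X (-T)) + ?ci (Complex X (-T)) (Complex X T) - ?ci Pp (Complex X T)"
      proof -
        assume "contour_integral (rectpath (Complex c (-T)) (Complex X T)) ?f = - (2 * of_real pi * \<i> * of_real R)"
          and "contour_integral (rectpath (Complex c (-T)) (Complex X T)) ?f =
          ?ci (Complex c (-T)) (Complex X (-T)) + ?ci (Complex X (-T)) (Complex X T)
        - ?ci (Complex c T) (Complex X T) - ?ci (Complex c (-T)) (Complex c T)"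
        then have r: "- (2 * of_real pi * \<i> * of_real R) =
          ?ci (Complex c (-T)) (Complex X (-T)) + ?ci (Complex X (-T)) (Complex X T)
          - ?ci (Complex c T) (Complex X T) - ?ci (Complex c (-T)) (Complex c T)" by simp
        have j: "contour_integral (G_contour c \<kappa> T) ?f =
          ?ci (Complex c (-T)) (Complex c T) + ?ci (Complex c T) Pp - ?ci (Complex c (-T)) Pm"
          unfolding J rev2 up down mid rev1 by simp
        have sp: "?ci (Complex c T) (Complex X T) = ?ci (Complex c T) Pp + ?ci Pp (Complex X T)"
          "?ci (Complex c (-T)) (Complex X (-T)) = ?ci (Complex c (-T)) Pm + ?ci Pm (Complex X (-T))"
          using split[of T] split[of "-T"] T by (auto simp: Pp_def Pm_def)
        show ?thesis
          unfolding equation_minus_iff[THEN iffD1, OF r[symmetric]] j sp by simp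
      qed
      have right: "norm (?ci (Complex X (-T)) (Complex X T)) \<le> B m * norm (Complex X T - Complex X (-T))"
      proof (rule contour_integral_bound_linepath)
        have "closed_segment (Complex X (-T)) (Complex X T) \<subseteq> path_image (rectpath (Complex c (-T)) (Complex X T))"
          by (auto simp: rectpath_def Let_def path_image_join)
        then show "?f contour_integrable_on linepath (Complex X (-T)) (Complex X T)"
          using contour_integral_rectpath_G_integrand(1)[OF \<theta> x c T, of m] unfolding X_def
          by (intro contour_integrable_continuous_linepath) (auto intro: continuous_on_subset)
        have *: "norm (?f (Complex X t)) \<le> B m" if "\<bar>t\<bar> \<le> T" for t
          using elim(1) that unfolding X_def by blast
        show "0 \<le> B m" using *[of 0] T norm_ge_zero order.trans by (metis abs_zero less_imp_le)
        show "norm (?f s) \<le> B m" if "s \<in> closed_segment (Complex X (-T)) (Complex X T)" for s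
        proof -
          have "s = Complex X (Im s)" "\<bar>Im s\<bar> \<le> T"
            using that T by (auto simp: closed_segment_same_Re closed_segment_eq_real_ivl complex_eq_iff)
          then show ?thesis using *[of "Im s"] by metis
        qed
      qed
      have "norm (Complex X T - Complex X (-T)) = 2 * T" using T by (simp add: cmod_def real_sqrt_mult)
      with right have right': "norm (?ci (Complex X (-T)) (Complex X T)) \<le> B m * (2 * T)" by simp
      have h1: "norm (?ci Pp (Complex X T)) \<le> norm (?f Pp) / \<beta>" unfolding Pp_def
        using dec[of T "c + \<kappa> * T"] T XX by (intro contour_integral_horizontal_le contI \<beta>) auto
      have h2: "norm (?ci Pm (Complex X (-T))) \<le> norm (?f Pm) / \<beta>" unfolding Pm_def
        using dec[of "-T" "c + \<kappa> * T"] T XX by (intro contour_integral_horizontal_le contI \<beta>) auto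
      have "norm (contour_integral (G_contour c \<kappa> T) ?f - 2 * of_real pi * \<i> * of_real R) \<le>
         norm (?ci Pm (Complex X (-T))) + norm (?ci (Complex X (-T)) (Complex X T)) + norm (?ci Pp (Complex X T))"
        unfolding eq by (rule order.trans[OF norm_triangle_ineq4]) (simp add: norm_triangle_ineq)
      also have "\<dots> \<le> B m * (2 * T) + ?R" using right' h1 h2 by (simp add: Pp_def Pm_def)
      finally show ?case unfolding R_def .
    qed
  qed
  moreover have "(\<lambda>m. norm (contour_integral (G_contour c \<kappa> T) ?f - 2 * of_real pi * \<i> * of_real (\<Sum>k\<le>m. G_coeff \<theta> a k * x powr G_pole \<theta> a k)))
     \<longlonglongrightarrow> norm (contour_integral (G_contour c \<kappa> T) ?f - 2 * of_real pi * \<i> * of_real S)"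
    using S unfolding sums_def_le by (intro tendsto_intros)
  moreover have "(\<lambda>m. B m * (2 * T) + ?R) \<longlonglongrightarrow> 0 * (2 * T) + ?R"
    by (intro tendsto_intros B)
  ultimately show ?thesis
    using tendsto_le[OF sequentially_bot] by force
qed

section \<open>Boundedness at the ends of the contour and the limit of the truncated
  integrals\<close>

lemma norm_Gamma_Complex_minus_Im: "norm (Gamma (Complex u (- T))) = norm (Gamma (Complex u T))"
proof -
  have "Complex u (- T) = cnj (Complex u T)" by (simp add: complex_eq_iff)
  then show ?thesis by (metis cnj_Gamma complex_mod_cnj)
qed

lemma norm_G_integrand_eq:
  assumes "x > 0"
  shows "norm (G_integrand \<theta> a x (Complex c T)) =
    norm (Gamma (Complex (a + 1 - \<theta> * (c + 1)) (\<theta> * \<bar>T\<bar>))) / norm (Gamma (Complex (c + 1) \<bar>T\<bar>)) * x powr c"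
proof -
  have w: "- complex_of_real \<theta> * (Complex c T + 1) + complex_of_real a + 1 = Complex (a + 1 - \<theta> * (c + 1)) (- (\<theta> * T))"
    by (simp add: complex_eq_iff algebra_simps)
  have s: "Complex c T + 1 = Complex (c + 1) T" by (simp add: complex_eq_iff)
  have "norm (G_integrand \<theta> a x (Complex c T)) =
    norm (Gamma (Complex (a + 1 - \<theta> * (c + 1)) (\<theta> * T))) / norm (Gamma (Complex (c + 1) T)) * x powr c"
    unfolding G_integrand_eq[OF assms] w unfolding s norm_mult norm_Gamma_Complex_minus_Im
    using assms by (simp add: Gamma_def norm_inverse norm_exp_eq_Re powr_def divide_inverse)
  then show ?thesis by (cases "T \<ge> 0") (auto simp: norm_Gamma_Complex_minus_Im)
qed

text \<open>On Re s = c every exponential rate D > pi (1 - \<theta>) / 2 is available. For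
  \<open>\<theta> > 1\<close> this includes D = 0. For \<open>\<kappa> > 0\<close> the growth is
  offset by the horizontal decay on the way to the tilted arm. In the borderline case the rate has
  no slack and the two Gamma moduli are compared directly.\<close>

lemma G_integrand_bounded_on_contour:
  assumes \<theta>: "\<theta> > 0" and x: "x > 0" and conv: "convergent_contour \<theta> a c \<kappa>"
  shows "\<exists>C. \<forall>\<^sub>F T in at_top. \<forall>T'. \<bar>T'\<bar> = T \<longrightarrow> norm (G_integrand \<theta> a x (Complex (c + \<kappa> * T) T')) \<le> C"
proof -
  let ?f = "G_integrand \<theta> a x"
  have growth: "\<exists>C>0. \<forall>\<^sub>F T in at_top. \<forall>T'. \<bar>T'\<bar> = T \<longrightarrow> norm (?f (Complex c T')) \<le> C * exp (D * T)"
    if D: "D > pi * (1 - \<theta>) / 2" for D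
  proof -
    obtain C where C: "C > 0" "\<forall>\<^sub>F T in at_top. norm (Gamma (Complex (a + 1 - \<theta> * (c + 1)) (\<theta> * T))) \<le> C * exp (D * T) * norm (Gamma (Complex (c + 1) T))"
      using norm_Gamma_Complex_growth[OF \<theta> D] by blast
    have "\<forall>\<^sub>F T in at_top. \<forall>T'. \<bar>T'\<bar> = T \<longrightarrow> norm (?f (Complex c T')) \<le> (C * x powr c) * exp (D * T)"
      using C(2) eventually_gt_at_top[of 0]
    proof eventually_elim
      case (elim T)
      have "Complex (c + 1) T \<notin> \<int>\<^sub>\<le>\<^sub>0" using elim(2) by (auto elim!: nonpos_Ints_cases simp: complex_eq_iff)
      then have "norm (Gamma (Complex (c + 1) T)) > 0" by (simp add: Gamma_eq_zero_iff)
      with elim(1) have "norm (Gamma (Complex (a + 1 - \<theta> * (c + 1)) (\<theta> * T))) / norm (Gamma (Complex (c + 1) T)) \<le> C * exp (D * T)"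
        by (simp add: pos_divide_le_eq)
      from mult_right_mono[OF this, of "x powr c"] show ?case
        by (auto simp: norm_G_integrand_eq[OF x] mult_ac)
    qed
    then show ?thesis using C(1) x by (intro exI[of _ "C * x powr c"]) auto
  qed
  consider "\<kappa> > 0" | "\<kappa> = 0" "\<theta> > 1" | "\<kappa> = 0" "\<theta> = 1" "(a - 1) / 2 \<le> c"
    using conv unfolding convergent_contour_def by blast
  then show ?thesis
  proof cases
    case 1
    \<comment> \<open>The rate pi is admissible for every positive \<theta>; decay at rate pi /
      \<kappa> over the horizontal distance \<kappa> T offsets it exactly.\<close>
    have "pi * (1 - \<theta>) / 2 < pi" using \<theta> by (simp add: field_simps add_pos_pos)
    then obtain C where C: "C > 0" "\<forall>\<^sub>F T in at_top. \<forall>T'. \<bar>T'\<bar> = T \<longrightarrow> norm (?f (Complex c T')) \<le> C * exp (pi * T)"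
      using growth by blast
    obtain T0 where T0: "T0 > 0" "\<And>T \<sigma>1 \<sigma>2. \<bar>T\<bar> \<ge> T0 \<Longrightarrow> \<sigma>1 \<le> \<sigma>2 \<Longrightarrow>
        norm (?f (Complex \<sigma>2 T)) \<le> norm (?f (Complex \<sigma>1 T)) * exp (- (pi / \<kappa>) * (\<sigma>2 - \<sigma>1))"
      using G_integrand_horizontal_decay[OF \<theta> x, where \<beta> = "pi / \<kappa>" and a = a] by blast
    have "\<forall>\<^sub>F T in at_top. \<forall>T'. \<bar>T'\<bar> = T \<longrightarrow> norm (?f (Complex (c + \<kappa> * T) T')) \<le> C"
      using C(2) eventually_ge_at_top[of T0]
    proof eventually_elim
      case (elim T)
      show ?case
      proof safe
        fix T' assume T': "T = \<bar>T'\<bar>"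
        have "norm (?f (Complex (c + \<kappa> * T) T')) \<le> norm (?f (Complex c T')) * exp (- (pi / \<kappa>) * (c + \<kappa> * T - c))"
          using T' elim 1 T0(1) by (intro T0(2)) auto
        also have "\<dots> \<le> C * exp (pi * T) * exp (- (pi / \<kappa>) * (c + \<kappa> * T - c))"
          using elim(1) T' by (intro mult_right_mono) auto
        also have "\<dots> = C" using 1 by (simp add: mult.assoc exp_minus_inverse flip: exp_add)
        finally show "norm (?f (Complex (c + \<kappa> * \<bar>T'\<bar>) T')) \<le> C" unfolding T' .
      qed
    qed
    then show ?thesis by blast
  next
    case 2
    then have "pi * (1 - \<theta>) / 2 < 0" by (simp add: mult_pos_neg)
    from growth[OF this] show ?thesis using 2 by auto
  next
    case 3
    \<comment> \<open>Both Gamma factors have imaginary part \<open>\<plusminus>T\<close> here, and \<open>c \<ge> (a - 1) / 2\<close> says that \<open>a - c \<le> c + 1\<close>.\<close>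
    obtain T0 where T0: "T0 > 0"
      "\<And>u v T. \<bar>T\<bar> \<ge> T0 \<Longrightarrow> u \<le> v \<Longrightarrow> norm (Gamma (Complex u T)) \<le> norm (Gamma (Complex v T))"
      using norm_Gamma_mono_Re by blast
    have "\<forall>\<^sub>F T in at_top. \<forall>T'. \<bar>T'\<bar> = T \<longrightarrow> norm (?f (Complex c T')) \<le> x powr c"
      using eventually_ge_at_top[of T0]
    proof eventually_elim
      case (elim T)
      then have "Complex (c + 1) T \<notin> \<int>\<^sub>\<le>\<^sub>0"
        using T0(1) by (auto elim!: nonpos_Ints_cases simp: complex_eq_iff)
      then have nz: "norm (Gamma (Complex (c + 1) T)) \<noteq> 0" by (simp add: Gamma_eq_zero_iff)
      have "norm (Gamma (Complex (a - c) T)) \<le> norm (Gamma (Complex (c + 1) T))"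
        using 3 elim T0(1) by (intro T0(2)) (auto simp: field_simps)
      then have "norm (Gamma (Complex (a - c) T)) / norm (Gamma (Complex (c + 1) T)) \<le> 1"
        using nz by (simp add: divide_le_eq_1)
      from mult_right_mono[OF this, of "x powr c"] show ?case
        using 3 by (auto simp: norm_G_integrand_eq[OF x])
    qed
    then show ?thesis using 3 by auto
  qed
qed

lemma G_LMB_eq_series:
  assumes \<theta>: "\<theta> > 0" and x: "x > 0" and "poles_to_right \<theta> a c" and conv: "convergent_contour \<theta> a c \<kappa>"
    and S: "(\<lambda>k. G_coeff \<theta> a k * x powr G_pole \<theta> a k) sums S"
  shows "G_LMB \<theta> a c \<kappa> x = of_real S"
proof -
  let ?f = "G_integrand \<theta> a x"
  let ?J = "\<lambda>T. contour_integral (G_contour c \<kappa> T) ?f"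
  have c: "c < G_pole \<theta> a 0" using assms poles_to_right_iff by simp
  have \<kappa>: "\<kappa> \<ge> 0" using conv by (auto simp: convergent_contour_def)
  obtain C where C: "\<forall>\<^sub>F T in at_top. \<forall>T'. \<bar>T'\<bar> = T \<longrightarrow> norm (?f (Complex (c + \<kappa> * T) T')) \<le> C"
    using G_integrand_bounded_on_contour[OF \<theta> x conv] by blast
  have "(?J \<longlongrightarrow> 2 * of_real pi * \<i> * of_real S) at_top"
  proof (rule tendstoI)
    fix e :: real assume e: "e > 0"
    \<comment> \<open>The two ends contribute at most 2 |C| / \<beta>, which this choice brings
      below e. Boundedness at the ends suffices because C is fixed before \<beta>.\<close>
    define \<beta> where "\<beta> = 2 * \<bar>C\<bar> / e + 1"
    have \<beta>: "\<beta> > 0" using e by (simp add: \<beta>_def add_nonneg_pos)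
    obtain T0 where T0: "T0 > 0" "\<And>T \<sigma>1 \<sigma>2. \<bar>T\<bar> \<ge> T0 \<Longrightarrow> \<sigma>1 \<le> \<sigma>2 \<Longrightarrow>
        norm (?f (Complex \<sigma>2 T)) \<le> norm (?f (Complex \<sigma>1 T)) * exp (- \<beta> * (\<sigma>2 - \<sigma>1))"
      using G_integrand_horizontal_decay[OF \<theta> x, where \<beta> = \<beta> and a = a] by blast
    show "\<forall>\<^sub>F T in at_top. dist (?J T) (2 * of_real pi * \<i> * of_real S) < e"
      using C eventually_ge_at_top[of T0]
    proof eventually_elim
      case (elim T)
      have T: "T > 0" using elim T0(1) by simp
      have "norm (?J T - 2 * of_real pi * \<i> * of_real S) \<le>
          norm (?f (Complex (c + \<kappa> * T) T)) / \<beta> + norm (?f (Complex (c + \<kappa> * T) (-T))) / \<beta>"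
        using T0(2) elim(2) by (intro contour_integral_G_contour_le[OF \<theta> x c \<kappa> T \<beta> _ S]) auto
      also have "\<dots> \<le> \<bar>C\<bar> / \<beta> + \<bar>C\<bar> / \<beta>"
        using elim(1) T \<beta> by (intro add_mono divide_right_mono) (auto intro: order.trans[OF _ abs_ge_self])
      also have "\<dots> < e"
      proof -
        have "2 * \<bar>C\<bar> < e * \<beta>" using e by (simp add: \<beta>_def algebra_simps)
        then have "2 * \<bar>C\<bar> / \<beta> < e" using \<beta> by (simp add: pos_divide_less_eq)
        then show ?thesis by simp
      qed
      finally show ?case by (simp add: dist_norm)
    qed
  qed
  then have "Lim at_top ?J = 2 * of_real pi * \<i> * of_real S"
    by (intro tendsto_Lim) auto
  then show ?thesis by (simp add: G_LMB_def)
qed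

subsection \<open>Ratios of Gamma functions\<close>

text \<open>The difference vanishes at 0 and has derivative t^2 / (1 + t), at most 2 u^2 for |t|
  \<le> |u| \<le> 1/2; the mean value inequality supplies the third factor |u|.\<close>

lemma abs_ln_one_plus_minus_quadratic_le:
  fixes u :: real
  assumes "\<bar>u\<bar> \<le> 1/2"
  shows "\<bar>ln (1 + u) - (u - u\<^sup>2 / 2)\<bar> \<le> 2 * \<bar>u\<bar> ^ 3"
proof -
  let ?g = "\<lambda>u::real. ln (1 + u) - (u - u\<^sup>2 / 2)"
  have d: "(?g has_field_derivative (t\<^sup>2 / (1 + t))) (at t within cball 0 \<bar>u\<bar>)" if "t \<in> cball 0 \<bar>u\<bar>" for t :: real
  proof -
    have "1 + t > 0" using that assms by (auto simp: dist_real_def)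
    then show ?thesis
      by (auto intro!: derivative_eq_intros simp: field_simps power2_eq_square)
  qed
  have b: "norm (t\<^sup>2 / (1 + t)) \<le> 2 * \<bar>u\<bar>\<^sup>2" if "t \<in> cball 0 \<bar>u\<bar>" for t :: real
  proof -
    have t: "1 + t \<ge> 1/2" "\<bar>t\<bar> \<le> \<bar>u\<bar>" using that assms by (auto simp: dist_real_def)
    have "t\<^sup>2 / (1 + t) \<le> t\<^sup>2 / (1/2)" using t by (intro divide_left_mono) auto
    also have "\<dots> \<le> 2 * \<bar>u\<bar>\<^sup>2" using abs_le_square_iff[of t u] t(2) by simp
    finally show ?thesis using t by simp
  qed
  have "norm (?g u - ?g 0) \<le> (2 * \<bar>u\<bar>\<^sup>2) * norm (u - 0)"
    by (rule field_differentiable_bound[OF convex_cball d b]) auto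
  then show ?thesis by (simp add: power2_eq_square power3_eq_cube mult_ac)
qed

lemma exp_minus_one_minus_le:
  fixes v :: real
  shows "\<bar>exp v - 1 - v\<bar> \<le> v\<^sup>2 * exp \<bar>v\<bar>"
proof -
  have lo: "exp v - 1 - v \<ge> 0" using exp_ge_add_one_self[of v] by linarith
  have "1 - v \<le> exp (- v)" using exp_ge_add_one_self[of "- v"] by simp
  then have "(1 - v) * exp v \<le> exp (- v) * exp v" by (intro mult_right_mono) auto
  then have up: "exp v - 1 \<le> v * exp v" by (simp add: algebra_simps flip: exp_add)
  have "exp v - 1 - v \<le> v\<^sup>2 * exp \<bar>v\<bar>"
  proof (cases "v \<ge> 0")
    case True
    have "exp v - 1 - v \<le> v * (exp v - 1)" using up by (simp add: algebra_simps)
    also have "\<dots> \<le> v * (v * exp v)" using True up by (intro mult_left_mono) auto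
    finally show ?thesis using True by (simp add: power2_eq_square mult_ac)
  next
    case False
    have "1 - exp v \<le> - v" using exp_ge_add_one_self[of v] by linarith
    have "exp v - 1 - v \<le> (- v) * (1 - exp v)" using up by (simp add: algebra_simps)
    also have "\<dots> \<le> (- v) * (- v)" using False \<open>1 - exp v \<le> - v\<close> by (intro mult_left_mono) auto
    also have "\<dots> \<le> v\<^sup>2 * exp \<bar>v\<bar>" by (simp add: power2_eq_square mult_le_cancel_left1 mult_le_cancel_right1)
    finally show ?thesis .
  qed
  with lo show ?thesis by simp
qed

lemma rGamma_real_bounded: "\<exists>C>0. \<forall>s\<ge>0. \<bar>rGamma s\<bar> \<le> (C::real)"
proof -
  obtain C where C: "C > 0" "\<And>z. Re z \<ge> 1 \<Longrightarrow> \<bar>Im z\<bar> \<le> 0 \<Longrightarrow> norm (rGamma z :: complex) \<le> C"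
    using rGamma_bounded_strip[of 0] by blast
  have 1: "\<bar>rGamma s\<bar> \<le> C" if "s \<ge> 1" for s :: real
    using C(2)[of "of_real s"] that by (simp add: rGamma_complex_of_real)
  have "\<bar>rGamma s\<bar> \<le> C" if "s \<ge> 0" for s :: real
  proof (cases "s \<ge> 1")
    case False
    have "\<bar>rGamma s\<bar> = s * \<bar>rGamma (s + 1)\<bar>"
      using that by (metis abs_mult abs_of_nonneg rGamma_plus1)
    also have "\<dots> \<le> 1 * C" using that False by (intro mult_mono 1) auto
    finally show ?thesis by simp
  qed (use 1 in auto)
  with C(1) show ?thesis by blast
qed

text \<open>
  In terms of the Gamma function, \<open>poch_ratio N s = \<Gamma>(N + 1 + s) / (\<Gamma>(N + 1) \<Gamma>(s + 1) N^s)\<close>. Its asymptotic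
  expansion is obtained for \<open>\<bar>s\<bar> \<le> 1\<close> by telescoping its logarithm in \<open>N\<close>, and carried to larger \<open>s\<close> by the
  recurrence \<open>s \<mapsto> s + 1\<close>.
\<close>

definition poch_ratio :: "nat \<Rightarrow> real \<Rightarrow> real" where
  "poch_ratio N s = pochhammer (s + 1) N / (fact N * real N powr s)"

lemma poch_ratio_pos: "s > -1 \<Longrightarrow> N > 0 \<Longrightarrow> poch_ratio N s > 0"
  unfolding poch_ratio_def by (intro divide_pos_pos pochhammer_pos mult_pos_pos) auto

text \<open>\<open>rGamma_series\<close> has one more Pochhammer factor and one more power of N; the
  quotient N / (s + 1 + N) removes both and tends to 1.\<close>

lemma poch_ratio_tendsto: 
  assumes "s > -1"
  shows "(\<lambda>N. poch_ratio N s) \<longlonglongrightarrow> rGamma (s + 1)"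
proof -
  have "(\<lambda>N. rGamma_series (s + 1) N * (real N / (s + 1 + real N))) \<longlonglongrightarrow> rGamma (s + 1) * 1"
  proof (intro tendsto_mult)
    show "rGamma_series (s + 1) \<longlonglongrightarrow> rGamma (s + 1)" by (rule rGamma_series_LIMSEQ)
    show "(\<lambda>N. real N / (s + 1 + real N)) \<longlonglongrightarrow> 1" by real_asymp
  qed
  moreover have "\<forall>\<^sub>F N in sequentially. rGamma_series (s + 1) N * (real N / (s + 1 + real N)) = poch_ratio N s"
    using eventually_gt_at_top[of 0]
  proof eventually_elim
    case (elim N)
    have "exp ((s + 1) * ln (real N)) = real N powr s * real N"
      using elim by (simp add: powr_def algebra_simps exp_add)
    have "p * D / (f * (w * n)) * (n / D) = p / (f * w)" if "D \<noteq> 0" "n \<noteq> 0" for p D f w n :: real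
      using that by simp
    from this[of "s + 1 + real N" "real N" "pochhammer (s + 1) N" "fact N" "real N powr s"]
    show ?case using elim assms \<open>exp _ = _\<close>
      unfolding rGamma_series_def poch_ratio_def by (simp add: pochhammer_Suc)
  qed
  ultimately have "(\<lambda>N. poch_ratio N s) \<longlonglongrightarrow> rGamma (s + 1) * 1"
    by (rule Lim_transform_eventually)
  then show ?thesis by simp
qed

text \<open>Let \<psi> be the logarithm minus its 1/N term. Its increments are at most 6 (1/n^2 -
  1/(n + 1)^2) in modulus, so \<psi> - 6/N^2 increases and \<psi> + 6/N^2 decreases. Both tend to
  the limit of \<psi>, which is therefore enclosed between them at every N.\<close>

lemma poch_ratio_log_asymp:
  assumes s: "s > -1" "s \<le> 1" and N: "N \<ge> 1"
  shows "\<bar>ln (poch_ratio N s) - s * (s + 1) / (2 * real N) - ln (rGamma (s + 1))\<bar> \<le> 6 / real N ^ 2"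
proof -
  define \<psi> where "\<psi> = (\<lambda>N. ln (poch_ratio N s) - s * (s + 1) / (2 * real N))"
  have step: "\<bar>\<psi> (Suc n) - \<psi> n\<bar> \<le> 6 * (1 / real n ^ 2 - 1 / real (Suc n) ^ 2)" if n: "n \<ge> 1" for n
  proof -
    define h where "h = 1 / (real n + 1)"
    have h: "h > 0" "h \<le> 1/2" using n by (auto simp: h_def field_simps)
    have "poch_ratio (Suc n) s = poch_ratio n s * ((s + 1 + real n) / (real n + 1) * (real n / (real n + 1)) powr s)"
    proof -
      have "p * D / ((m * f) * w') = p / (f * w) * (D / m * (w / w'))" if "w \<noteq> 0" for p D m f w w' :: real
        using that by simp
      from this[of "real n powr s"] show ?thesis
        using n by (simp add: poch_ratio_def pochhammer_Suc powr_divide add_ac)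
    qed
    moreover have "(s + 1 + real n) / (real n + 1) = 1 + s * h" "real n / (real n + 1) = 1 - h"
      by (simp_all add: h_def field_simps)
    ultimately have A: "poch_ratio (Suc n) s = poch_ratio n s * ((1 + s * h) * (1 - h) powr s)" by simp
    have sh: "\<bar>s * h\<bar> \<le> h" using s h by (simp add: abs_mult mult_le_cancel_right1)
    then have p: "1 + s * h > 0" using h by linarith
    have "ln (poch_ratio (Suc n) s) = ln (poch_ratio n s) + (ln (1 + s * h) + s * ln (1 - h))"
      unfolding A using poch_ratio_pos[of s n] s n p h by (simp add: ln_mult ln_powr)
    then have \<psi>d: "\<psi> (Suc n) - \<psi> n = ln (1 + s * h) + s * ln (1 - h) + s * (s + 1) / 2 * (1 / real n - 1 / (real n + 1))"
      by (simp add: \<psi>_def right_diff_distrib add_ac)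
    have nh: "1 / real n - 1 / (real n + 1) = h\<^sup>2 / (1 - h)"
    proof -
      have "1 / x - 1 / m = (1 / m)\<^sup>2 / (1 - 1 / m)" if "x > 0" "m = x + 1" for x m :: real
        using that by (simp add: divide_simps) (simp add: algebra_simps power2_eq_square)
      from this[of "real n" "real n + 1"] show ?thesis using n by (simp add: h_def)
    qed
    have e1: "\<bar>ln (1 + s * h) - (s * h - (s * h)\<^sup>2 / 2)\<bar> \<le> 2 * h ^ 3"
    proof -
      have "2 * \<bar>s * h\<bar> ^ 3 \<le> 2 * h ^ 3" by (intro mult_left_mono power_mono sh) auto
      moreover have "\<bar>s * h\<bar> \<le> 1/2" using sh h by linarith
      ultimately show ?thesis using abs_ln_one_plus_minus_quadratic_le[of "s * h"] by linarith
    qed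
    have "\<bar>ln (1 - h) - (- h - h\<^sup>2 / 2)\<bar> \<le> 2 * h ^ 3"
      using abs_ln_one_plus_minus_quadratic_le[of "- h"] h by simp
    then have "\<bar>s\<bar> * \<bar>ln (1 - h) - (- h - h\<^sup>2 / 2)\<bar> \<le> 1 * (2 * h ^ 3)" using s by (intro mult_mono) auto
    then have e2: "\<bar>s * ln (1 - h) - s * (- h - h\<^sup>2 / 2)\<bar> \<le> 2 * h ^ 3"
      by (simp flip: abs_mult right_diff_distrib)
    have e3: "\<bar>s * (s + 1) / 2 * (h ^ 3 / (1 - h))\<bar> \<le> 2 * h ^ 3"
    proof -
      have "\<bar>s * (s + 1)\<bar> \<le> 1 * 2" unfolding abs_mult using s by (intro mult_mono) auto
      then have 1: "\<bar>s * (s + 1) / 2\<bar> \<le> 1" by simp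
      have "h ^ 3 / (1 - h) \<le> h ^ 3 / (1/2)" using h by (intro divide_left_mono) auto
      then have "h ^ 3 / (1 - h) \<le> 2 * h ^ 3" by simp
      moreover have "h ^ 3 / (1 - h) \<ge> 0" using h by simp
      ultimately have 2: "\<bar>h ^ 3 / (1 - h)\<bar> \<le> 2 * h ^ 3" by (simp only: abs_of_nonneg)
      have "\<bar>s * (s + 1) / 2\<bar> * \<bar>h ^ 3 / (1 - h)\<bar> \<le> 1 * (2 * h ^ 3)" using h by (intro mult_mono 1 2) auto
      then show ?thesis by (simp only: abs_mult mult_1)
    qed
    \<comment> \<open>The powers h and h^2 cancel, the latter because -s^2/2 - s/2 + s (s + 1)/2 =
      0. Three cubic remainders of size at most 2 h^3 are left, whence the constant 6.\<close>
    have "\<psi> (Suc n) - \<psi> n = (ln (1 + s * h) - (s * h - (s * h)\<^sup>2 / 2)) + (s * ln (1 - h) - s * (- h - h\<^sup>2 / 2))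
       + s * (s + 1) / 2 * (h ^ 3 / (1 - h))"
    proof -
      have "h\<^sup>2 / (1 - h) = h\<^sup>2 + h ^ 3 / (1 - h)"
        using h by (simp add: divide_simps) (simp add: algebra_simps power2_eq_square power3_eq_cube)
      then show ?thesis unfolding \<psi>d nh by (simp add: algebra_simps power2_eq_square add_divide_distrib)
    qed
    then have "\<bar>\<psi> (Suc n) - \<psi> n\<bar> \<le> 6 * h ^ 3" using e1 e2 e3 by linarith
    also have "h ^ 3 \<le> 1 / real n ^ 2 - 1 / real (Suc n) ^ 2"
    proof -
      have "1 / real n ^ 2 - 1 / real (Suc n) ^ 2 = h ^ 3 * ((2 * real n + 1) * (real n + 1) / real n ^ 2)"
      proof -
        have "1 / x ^ 2 - 1 / m ^ 2 = (1 / m) ^ 3 * ((2 * x + 1) * m / x ^ 2)" if "x > 0" "m = x + 1" for x m :: real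
          using that by (simp add: divide_simps) (simp add: algebra_simps power2_eq_square power3_eq_cube)
        from this[of "real n" "real n + 1"] show ?thesis using n by (simp add: h_def add_ac)
      qed
      moreover have "(2 * real n + 1) * (real n + 1) / real n ^ 2 \<ge> 1"
        using n by (simp add: pos_le_divide_eq algebra_simps power2_eq_square)
      ultimately show ?thesis using mult_left_mono[of 1 "(2 * real n + 1) * (real n + 1) / real n ^ 2" "h ^ 3"] h
        by (simp only: mult_1_right) simp
    qed
    finally show ?thesis by simp
  qed
  have lim: "\<psi> \<longlonglongrightarrow> ln (rGamma (s + 1))"
  proof -
    have "rGamma (s + 1) > 0" using s by (simp add: rGamma_inverse_Gamma Gamma_real_pos)
    then have "(\<lambda>N. ln (poch_ratio N s)) \<longlonglongrightarrow> ln (rGamma (s + 1))"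
      using poch_ratio_tendsto[of s] s by (intro tendsto_intros) auto
    moreover have "(\<lambda>N. s * (s + 1) / (2 * real N)) \<longlonglongrightarrow> 0" by real_asymp
    ultimately have "(\<lambda>N. ln (poch_ratio N s) - s * (s + 1) / (2 * real N)) \<longlonglongrightarrow> ln (rGamma (s + 1)) - 0"
      by (rule tendsto_diff)
    then show ?thesis by (simp add: \<psi>_def)
  qed
  have lim2: "(\<lambda>n. 6 / real n ^ 2) \<longlonglongrightarrow> 0" by real_asymp
  have up: "\<psi> N - 6 / real N ^ 2 \<le> ln (rGamma (s + 1))"
  proof -
    have "(\<lambda>n. \<psi> (n + N) - 6 / real (n + N) ^ 2) \<longlonglongrightarrow> ln (rGamma (s + 1)) - 0"
      using tendsto_diff[OF lim lim2] by (rule LIMSEQ_ignore_initial_segment)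
    moreover have "incseq (\<lambda>n. \<psi> (n + N) - 6 / real (n + N) ^ 2)"
    proof (rule incseq_SucI)
      fix n show "\<psi> (n + N) - 6 / real (n + N) ^ 2 \<le> \<psi> (Suc n + N) - 6 / real (Suc n + N) ^ 2"
        using step[of "n + N"] N by simp
    qed
    ultimately show ?thesis using incseq_le[of _ _ 0] by fastforce
  qed
  have down: "\<psi> N + 6 / real N ^ 2 \<ge> ln (rGamma (s + 1))"
  proof -
    have "(\<lambda>n. \<psi> (n + N) + 6 / real (n + N) ^ 2) \<longlonglongrightarrow> ln (rGamma (s + 1)) + 0"
      using tendsto_add[OF lim lim2] by (rule LIMSEQ_ignore_initial_segment)
    moreover have "decseq (\<lambda>n. \<psi> (n + N) + 6 / real (n + N) ^ 2)"
    proof (rule decseq_SucI)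
      fix n show "\<psi> (Suc n + N) + 6 / real (Suc n + N) ^ 2 \<le> \<psi> (n + N) + 6 / real (n + N) ^ 2"
        using step[of "n + N"] N by simp
    qed
    ultimately show ?thesis using decseq_ge[of _ _ 0] by fastforce
  qed
  show ?thesis using up down unfolding \<psi>_def by linarith
qed

text \<open>Passing from s to s + 1 multiplies the error by at most 2 and adds a term of comparable
  size, so a unit step costs at most a factor 3 < exp 3. This is the origin of exp (3 (s +
  1)).\<close>

lemma poch_ratio_asymp:
  "\<exists>C>0. \<forall>s>-1. \<forall>N\<ge>1. \<bar>poch_ratio N s - rGamma (s + 1) * (1 + s * (s + 1) / (2 * real N))\<bar>
     \<le> C * exp (3 * (s + 1)) / real N ^ 2"
proof -
  obtain K :: real where K: "K > 0" "\<And>s. s \<ge> 0 \<Longrightarrow> \<bar>rGamma s\<bar> \<le> K" using rGamma_real_bounded by blast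
  \<comment> \<open>On -1 < s \<le> 1 the ratio is r exp v with |v| \<le> 7/N. The remainder of the
    exponential gives 49 exp 7 / N^2, the logarithmic expansion gives 6 / N^2, and K bounds
    r.\<close>
  define C where "C = K * (49 * exp 7 + 6)"
  have CK: "C \<ge> K" using K(1) by (simp add: C_def mult_le_cancel_left1 add_nonneg_pos add_increasing)
  let ?e = "\<lambda>N s. poch_ratio N s - rGamma (s + 1) * (1 + s * (s + 1) / (2 * real N))"
  have base: "\<bar>?e N s\<bar> \<le> C * exp (3 * (s + 1)) / real N ^ 2" if s: "s > -1" "s \<le> 1" and N: "N \<ge> 1" for s N
  proof -
    define r where "r = rGamma (s + 1)"
    have r: "r > 0" "r \<le> K" using s K(2)[of "s+1"] by (auto simp: r_def rGamma_inverse_Gamma Gamma_real_pos)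
    define \<eta> where "\<eta> = ln (poch_ratio N s) - s * (s + 1) / (2 * real N) - ln r"
    have \<eta>: "\<bar>\<eta>\<bar> \<le> 6 / real N ^ 2" using poch_ratio_log_asymp[OF s N] by (simp add: \<eta>_def r_def)
    define v where "v = s * (s + 1) / (2 * real N) + \<eta>"
    have "ln (poch_ratio N s) = ln r + v" by (simp add: v_def \<eta>_def)
    then have A: "poch_ratio N s = r * exp v"
    proof -
      assume l: "ln (poch_ratio N s) = ln r + v"
      have "poch_ratio N s = exp (ln (poch_ratio N s))" using poch_ratio_pos[of s N] s N by simp
      also have "\<dots> = r * exp v" unfolding l exp_add using r by simp
      finally show ?thesis .
    qed
    have v1: "\<bar>v\<bar> \<le> 7 / real N"
    proof -
      have "\<bar>s * (s + 1)\<bar> \<le> 1 * 2" unfolding abs_mult using s by (intro mult_mono) auto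
      then have "\<bar>s * (s + 1) / (2 * real N)\<bar> \<le> 1 / real N" using N by (simp add: field_simps)
      moreover have "6 / real N ^ 2 \<le> 6 / real N" using N by (intro divide_left_mono) (auto simp: power2_eq_square)
      moreover have "7 / real N = 1 / real N + 6 / real N" by (simp flip: add_divide_distrib)
      ultimately show ?thesis using \<eta> abs_triangle_ineq[of "s * (s + 1) / (2 * real N)" \<eta>] unfolding v_def by linarith
    qed
    have "7 / real N \<le> 7" using N by (simp add: field_simps)
    then have v7: "\<bar>v\<bar> \<le> 7" using v1 by linarith
    have "v\<^sup>2 \<le> (7 / real N)\<^sup>2" using v1 by (intro iffD1[OF abs_le_square_iff]) simp
    then have v2: "v\<^sup>2 \<le> 49 / real N ^ 2" by (simp add: power_divide)
    have "\<bar>exp v - 1 - v\<bar> \<le> 49 / real N ^ 2 * exp 7"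
      by (rule order.trans[OF exp_minus_one_minus_le mult_mono]) (use v2 v7 in auto)
    moreover have "exp v - (1 + s * (s + 1) / (2 * real N)) = (exp v - 1 - v) + \<eta>" by (simp add: v_def)
    ultimately have "\<bar>exp v - (1 + s * (s + 1) / (2 * real N))\<bar> \<le> (49 * exp 7 + 6) / real N ^ 2"
      using \<eta> by (simp add: add_divide_distrib)
    then have "r * \<bar>exp v - (1 + s * (s + 1) / (2 * real N))\<bar> \<le> K * ((49 * exp 7 + 6) / real N ^ 2)"
      using r K by (intro mult_mono) auto
    also have "r * \<bar>exp v - (1 + s * (s + 1) / (2 * real N))\<bar> = \<bar>?e N s\<bar>"
    proof -
      have "?e N s = r * (exp v - (1 + s * (s + 1) / (2 * real N)))" unfolding A r_def[symmetric] by (simp add: right_diff_distrib)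
      then show ?thesis using r by (simp only: abs_mult)
    qed
    also have "K * ((49 * exp 7 + 6) / real N ^ 2) = C * 1 / real N ^ 2" by (simp add: C_def)
    also have "\<dots> \<le> C * exp (3 * (s + 1)) / real N ^ 2"
      using s CK K by (intro divide_right_mono mult_left_mono) auto
    finally show ?thesis .
  qed
  have step: "\<bar>?e N (s + 1)\<bar> \<le> C * exp (3 * (s + 1 + 1)) / real N ^ 2"
    if s: "s \<ge> 0" and N: "N \<ge> 1" and IH: "\<bar>?e N s\<bar> \<le> C * exp (3 * (s + 1)) / real N ^ 2" for s N
  proof -
    define r where "r = rGamma (s + 1)"
    have r: "\<bar>r\<bar> \<le> K" using s K(2)[of "s+1"] by (simp add: r_def)
    define E where "E = exp (3 * (s + 1))"
    have "pochhammer (s + 1 + 1) N * (s + 1) = pochhammer (s + 1) N * (s + 1 + real N)"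
      using pochhammer_rec[of "s + 1" N] pochhammer_Suc[of "s + 1" N] by (simp add: mult_ac)
    then have "pochhammer (s + 1 + 1) N = pochhammer (s + 1) N * (s + 1 + real N) / (s + 1)"
      using s by (simp add: eq_divide_eq)
    then have A: "poch_ratio N (s + 1) = poch_ratio N s * ((1 + (s + 1) / real N) / (s + 1))"
    proof -
      have "p * (s1 + n) / s1 / (f * (w * n)) = p / (f * w) * ((1 + s1 / n) / s1)" if "n \<noteq> 0" for p s1 n f w :: real
      proof -
        have "(s1 + n) / n = 1 + s1 / n" using that by (simp add: field_simps)
        then have "p / (f * w) * ((1 + s1 / n) / s1) = p / (f * w) * ((s1 + n) / n / s1)" by simp
        then show ?thesis by (simp add: mult_ac)
      qed
      from this[of "real N" "pochhammer (s + 1) N" "s + 1" "fact N" "real N powr s"] show ?thesis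
        using N unfolding poch_ratio_def \<open>pochhammer (s + 1 + 1) N = _\<close> by (simp add: powr_add)
    qed
    have r2: "rGamma (s + 1 + 1) = r / (s + 1)"
      using rGamma_plus1[of "s + 1"] s by (simp add: r_def field_simps)
    \<comment> \<open>The truncated expansion almost satisfies the recurrence in s: besides the
      propagated error only an explicit term of order N^-2 is left over.\<close>
    have "?e N (s + 1) = ?e N s * ((1 + (s + 1) / real N) / (s + 1)) + r * (s * (s + 1) / (2 * real N ^ 2))"
    proof -
      have "A * (v * (1 + s1 * u)) - r * v * (1 + s1 * (s1 + 1) * (h * u)) =
          (A - r * (1 + s * s1 * (h * u))) * (v * (1 + s1 * u)) + r * (s * s1 * (h * (u * u)))"
        if "v * s1 = 1" "s1 = s + 1" "2 * h = 1" for A v s1 u h :: real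
        using that by algebra
      from this[of "1 / (s + 1)" "s + 1" "1/2" "poch_ratio N s" "1 / real N"]
      show ?thesis unfolding A r2 r_def[symmetric] using s N by (simp add: power2_eq_square mult_ac)
    qed
    also have "\<bar>\<dots>\<bar> \<le> \<bar>?e N s\<bar> * \<bar>(1 + (s + 1) / real N) / (s + 1)\<bar> + \<bar>r\<bar> * \<bar>s * (s + 1) / (2 * real N ^ 2)\<bar>"
      unfolding abs_mult[symmetric] by (rule abs_triangle_ineq)
    also have "\<dots> \<le> (C * E / real N ^ 2) * 2 + K * (E / real N ^ 2)"
    proof (intro add_mono mult_mono IH[folded E_def] r)
      have "(1 + (s + 1) / real N) / (s + 1) = 1 / (s + 1) + 1 / real N" using s N by (simp add: field_simps)
      moreover have "1 / (s + 1) \<le> 1" "1 / real N \<le> 1" using s N by auto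
      moreover have "(1 + (s + 1) / real N) / (s + 1) \<ge> 0" using s by simp
      ultimately show "\<bar>(1 + (s + 1) / real N) / (s + 1)\<bar> \<le> 2" by linarith
      have "s * (s + 1) / 2 \<le> (s + 1) * (s + 1) / 2" using s by (intro divide_right_mono mult_right_mono) auto
      also have "\<dots> \<le> exp (s + 1)" using exp_lower_Taylor_quadratic[of "s + 1"] s by (simp add: power2_eq_square)
      also have "\<dots> \<le> E" using s by (simp add: E_def)
      finally have "s * (s + 1) / 2 / real N ^ 2 \<le> E / real N ^ 2" by (intro divide_right_mono) auto
      then show "\<bar>s * (s + 1) / (2 * real N ^ 2)\<bar> \<le> E / real N ^ 2" using s by simp
    qed (use CK K in \<open>auto simp: E_def\<close>)
    also have "\<dots> \<le> (C * E / real N ^ 2) * 2 + C * (E / real N ^ 2)"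
      using CK by (intro add_left_mono mult_right_mono) (auto simp: E_def)
    also have "\<dots> = 3 * (C * E / real N ^ 2)" by simp
    also have "\<dots> \<le> exp 3 * (C * E / real N ^ 2)"
      using exp_ge_add_one_self[of 3] CK K by (intro mult_right_mono) (auto simp: E_def)
    also have "\<dots> = C * exp (3 * (s + 1 + 1)) / real N ^ 2"
    proof -
      have "exp 3 * E = exp (3 * (s + 1 + 1))" unfolding E_def exp_add[symmetric] by (simp add: algebra_simps)
      then show ?thesis by (metis mult.left_commute times_divide_eq_right)
    qed
    finally show ?thesis .
  qed
  have "\<forall>s. s > -1 \<and> s \<le> real m + 1 \<longrightarrow> (\<forall>N\<ge>1. \<bar>?e N s\<bar> \<le> C * exp (3 * (s + 1)) / real N ^ 2)" for m
  proof (induction m)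
    case 0 then show ?case using base by simp
  next
    case (Suc m)
    show ?case
    proof (intro allI impI)
      fix s N assume s: "- 1 < s \<and> s \<le> real (Suc m) + 1" and N: "(N::nat) \<ge> 1"
      show "\<bar>?e N s\<bar> \<le> C * exp (3 * (s + 1)) / real N ^ 2"
      proof (cases "s \<le> 1")
        case True then show ?thesis using base s N by blast
      next
        case False
        then show ?thesis using step[of "s - 1" N] Suc.IH[rule_format, of "s - 1" N] s N by simp
      qed
    qed
  qed
  note bound = this
  have "\<bar>?e N s\<bar> \<le> C * exp (3 * (s + 1)) / real N ^ 2" if "s > -1" "N \<ge> 1" for s N
  proof -
    obtain m where "s \<le> real m" using real_arch_simple by blast
    then show ?thesis using bound[of m] that by simp
  qed
  moreover have "C > 0" using CK K by simp
  ultimately show ?thesis by blast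
qed

text \<open>The falling factorial (N - 1) (N - 2) ... (N - j) divided by N^j, as produced by degree
  N - 1. For N \<ge> 1 it vanishes from j = N on, which lets the finite sums be read as infinite
  series.\<close>

definition ff_ratio :: "nat \<Rightarrow> nat \<Rightarrow> real" where
  "ff_ratio N j = (\<Prod>i=1..j. 1 - real i / real N)"

lemma ff_ratio_Suc: "ff_ratio N (Suc j) = ff_ratio N j * (1 - real (Suc j) / real N)"
  by (simp add: ff_ratio_def)

lemma ff_ratio_eq_0: "N \<ge> 1 \<Longrightarrow> j \<ge> N \<Longrightarrow> ff_ratio N j = 0"
  by (auto simp: ff_ratio_def prod_zero_iff intro!: bexI[of _ N])

lemma ff_ratio_bounds: "N \<ge> 1 \<Longrightarrow> 0 \<le> ff_ratio N j \<and> ff_ratio N j \<le> 1"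
proof (cases "j \<ge> N")
  case False
  assume "N \<ge> 1"
  with False show ?thesis unfolding ff_ratio_def
    by (intro conjI prod_nonneg prod_le_1) (auto simp: field_simps)
qed (auto simp: ff_ratio_eq_0)

text \<open>Induction on j. While j + 1 \<le> N, the error is multiplied by a number in [0, 1] and
  gains j (j + 1)^2 / (2 N^2). Past that point the ratio is 0 and N \<le> j + 1, so N^2 times the
  approximating term is itself below the fourth power.\<close>

lemma ff_ratio_asymp:
  assumes N: "N \<ge> 1"
  shows "\<bar>ff_ratio N j - (1 - real j * (real j + 1) / (2 * real N))\<bar> \<le> (real j + 1) ^ 4 / real N ^ 2"
proof -
  let ?e = "\<lambda>j. ff_ratio N j - (1 - real j * (real j + 1) / (2 * real N))"
  have "real N ^ 2 * \<bar>?e j\<bar> \<le> (real j + 1) ^ 4"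
  proof (induction j)
    case 0 then show ?case by (simp add: ff_ratio_def)
  next
    case (Suc j)
    define J where "J = real j"
    have J: "J \<ge> 0" by (simp add: J_def)
    have SJ: "real (Suc j) = J + 1" by (simp add: J_def)
    show ?case
    proof (cases "Suc j \<le> N")
      case True
      have JN: "J + 1 \<le> real N" using True unfolding J_def by linarith
      have "?e (Suc j) = ?e j * (1 - (J + 1) / real N) + J * (J + 1)\<^sup>2 / (2 * real N ^ 2)"
        unfolding ff_ratio_Suc SJ J_def[symmetric] using N by (simp add: field_simps power2_eq_square)
      then have "\<bar>?e (Suc j)\<bar> \<le> \<bar>?e j * (1 - (J + 1) / real N)\<bar> + \<bar>J * (J + 1)\<^sup>2 / (2 * real N ^ 2)\<bar>"
        by (simp only: abs_triangle_ineq)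
      also have "\<dots> = \<bar>?e j\<bar> * \<bar>1 - (J + 1) / real N\<bar> + \<bar>J * (J + 1)\<^sup>2 / (2 * real N ^ 2)\<bar>"
        by (simp only: abs_mult)
      also have "\<dots> \<le> \<bar>?e j\<bar> * 1 + J * (J + 1)\<^sup>2 / (2 * real N ^ 2)"
        using JN J N by (intro add_mono mult_left_mono) (auto simp: field_simps)
      finally have "real N ^ 2 * \<bar>?e (Suc j)\<bar> \<le> real N ^ 2 * (\<bar>?e j\<bar> * 1 + J * (J + 1)\<^sup>2 / (2 * real N ^ 2))"
        by (intro mult_left_mono) auto
      also have "\<dots> = real N ^ 2 * \<bar>?e j\<bar> + J * (J + 1)\<^sup>2 / 2" using N by (simp add: field_simps)
      also have "\<dots> \<le> (J + 1) ^ 4 + J * (J + 1)\<^sup>2 / 2" using Suc.IH by (simp add: J_def)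
      also have "\<dots> \<le> (J + 1 + 1) ^ 4"
      proof -
        \<comment> \<open>The slack in the step is a polynomial in J with positive coefficients; the
          same happens in the other case.\<close>
        have "(J + 1 + 1) ^ 4 = ((J + 1) ^ 4 + J * (J + 1)\<^sup>2 / 2) + (7/2 * J ^ 3 + 17 * J ^ 2 + 55/2 * J + 15)"
          by (simp add: power4_eq_xxxx power3_eq_cube power2_eq_square add_divide_distrib algebra_simps)
        then show ?thesis using J by simp
      qed
      finally show ?thesis unfolding SJ .
    next
      case False
      then have NJ: "real N \<le> J + 1" unfolding J_def by linarith
      have "?e (Suc j) = (J + 1) * (J + 2) / (2 * real N) - 1"
        using False N by (simp add: ff_ratio_eq_0 SJ J_def add_ac)
      moreover have "\<bar>(J + 1) * (J + 2) / (2 * real N) - 1\<bar> \<le> (J + 1) * (J + 2) / (2 * real N) + 1"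
        using J by (simp add: abs_le_iff)
      ultimately have "real N ^ 2 * \<bar>?e (Suc j)\<bar> \<le> real N ^ 2 * ((J + 1) * (J + 2) / (2 * real N) + 1)"
        by (intro mult_left_mono) auto
      also have "\<dots> = real N * ((J + 1) * (J + 2) / 2 + real N)" using N by (simp add: field_simps power2_eq_square)
      also have "\<dots> \<le> (J + 1) * ((J + 1) * (J + 2) / 2 + (J + 1))" using NJ J by (intro mult_mono add_mono) auto
      also have "\<dots> \<le> (J + 1 + 1) ^ 4"
      proof -
        have "(J + 1 + 1) ^ 4 = (J + 1) * ((J + 1) * (J + 2) / 2 + (J + 1)) + (J ^ 4 + 15/2 * J ^ 3 + 21 * J ^ 2 + 55/2 * J + 14)"
          by (simp add: power4_eq_xxxx power3_eq_cube power2_eq_square add_divide_distrib algebra_simps)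
        then show ?thesis using J by simp
      qed
      finally show ?thesis unfolding SJ .
    qed
  qed
  then show ?thesis using N by (simp add: field_simps)
qed

subsection \<open>Power series with real exponents\<close>

text \<open>The substitution y = u^\<theta> leads to Euler's integral for Gamma b. It is carried out
  for the gauge integral together with absolute integrability, which allows the transfer to the
  integral over \<open>lborel\<close>.\<close>

lemma integral_powr_exp_powr:
  fixes \<theta> b :: real
  assumes \<theta>: "\<theta> > 0" and b: "b > 0"
  shows "(LINT y:{0<..}|lborel. y powr (b / \<theta> - 1) * exp (- (y powr (1 / \<theta>)))) = \<theta> * Gamma b"
proof -
  define f where "f = (\<lambda>y::real. y powr (b / \<theta> - 1) * exp (- (y powr (1 / \<theta>))))"
  have img: "(\<lambda>u::real. u powr \<theta>) ` {0<..} = {0<..}"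
  proof safe
    fix x :: real assume "x > 0"
    then have "x = (x powr (1 / \<theta>)) powr \<theta>" "x powr (1 / \<theta>) \<in> {0<..}" using \<theta> by (auto simp: powr_powr)
    then show "x \<in> (\<lambda>u. u powr \<theta>) ` {0<..}" by blast
  qed auto
  have eq: "\<bar>\<theta> * u powr (\<theta> - 1)\<bar> * f (u powr \<theta>) = \<theta> * (u powr (b - 1) / exp u)" if "u > 0" for u
  proof -
    have "\<theta> * (b / \<theta> - 1) = b - \<theta>" using \<theta> by (simp add: field_simps)
    then have "f (u powr \<theta>) = u powr (b - \<theta>) * exp (- u)" using \<theta> that by (simp add: f_def powr_powr)
    moreover have "u powr (\<theta> - 1) * u powr (b - \<theta>) = u powr (b - 1)" by (simp flip: powr_add)
    moreover have "\<bar>\<theta> * u powr (\<theta> - 1)\<bar> * (u powr (b - \<theta>) * exp (- u)) = \<theta> * (u powr (\<theta> - 1) * u powr (b - \<theta>)) * exp (- u)"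
      using \<theta> by (simp add: abs_mult)
    ultimately show ?thesis by (simp add: exp_minus divide_inverse)
  qed
  have hi: "((\<lambda>t. t powr (b - 1) / exp t) has_integral Gamma b) {0<..}"
    using Gamma_integral_real[OF b]
  proof (subst has_integral_spike_set_eq)
    show "negligible {x \<in> {0<..} - {0..}. x powr (b - 1) / exp x \<noteq> 0}" by (rule negligible_subset[of "{}"]) auto
    show "negligible {x \<in> {0..} - {0<..}. x powr (b - 1) / exp x \<noteq> 0}" by (rule negligible_subset[of "{0}"]) auto
  qed
  have hi2: "((\<lambda>u. \<bar>\<theta> * u powr (\<theta> - 1)\<bar> * f (u powr \<theta>)) has_integral (\<theta> * Gamma b)) {0<..}"
    by (rule has_integral_eq[OF _ has_integral_mult_right[OF hi, of \<theta>]]) (simp add: eq)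
  have "(\<lambda>u. \<bar>\<theta> * u powr (\<theta> - 1)\<bar> * f (u powr \<theta>)) absolutely_integrable_on {0<..}"
    using hi2 by (intro nonnegative_absolutely_integrable_1) (auto simp: has_integral_integrable f_def)
  moreover have "integral {0<..} (\<lambda>u. \<bar>\<theta> * u powr (\<theta> - 1)\<bar> * f (u powr \<theta>)) = \<theta> * Gamma b"
    using hi2 by (rule integral_unique)
  moreover have "((\<lambda>u. \<bar>\<theta> * u powr (\<theta> - 1)\<bar> * f (u powr \<theta>)) absolutely_integrable_on {0<..} \<and>
           integral {0<..} (\<lambda>u. \<bar>\<theta> * u powr (\<theta> - 1)\<bar> * f (u powr \<theta>)) = \<theta> * Gamma b)
     \<longleftrightarrow> (f absolutely_integrable_on ((\<lambda>u. u powr \<theta>) ` {0<..}) \<and> integral ((\<lambda>u. u powr \<theta>) ` {0<..}) f = \<theta> * Gamma b)"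
  proof (rule has_absolute_integral_change_of_variables_1')
    fix x :: real assume "x \<in> {0<..}"
    then show "((\<lambda>u. u powr \<theta>) has_field_derivative \<theta> * x powr (\<theta> - 1)) (at x within {0<..})"
      by (auto intro!: derivative_eq_intros)
  next
    show "inj_on (\<lambda>u::real. u powr \<theta>) {0<..}"
    proof (rule inj_on_inverseI)
      fix x :: real assume "x \<in> {0<..}"
      then show "(x powr \<theta>) powr (1 / \<theta>) = x" using \<theta> by (simp add: powr_powr)
    qed
  qed auto
  ultimately have ai: "f absolutely_integrable_on {0<..}" and int: "integral {0<..} f = \<theta> * Gamma b"
    unfolding img by auto
  have "set_integrable lborel {0<..} f"
    using ai unfolding set_integrable_def by (subst (asm) integrable_completion) (auto simp: f_def)
  from set_borel_integral_eq_integral(2)[OF this] int show ?thesis by (simp add: f_def)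
qed

lemma mellin_w_LMB:
  assumes \<theta>: "\<theta> > 0" and a: "a > -1"
  shows "mellin (w_LMB \<theta> a) (real n + 1) = Gamma (\<theta> * real n + a + 1) / Gamma (a + 1)"
proof -
  define b where "b = \<theta> * real n + a + 1"
  have "\<theta> * real n \<ge> 0" using \<theta> by simp
  then have b: "b > 0" using a unfolding b_def by linarith
  have "mellin (w_LMB \<theta> a) (real n + 1) =
    (LINT y:{0<..}|lborel. 1 / (\<theta> * Gamma (a + 1)) * (y powr (b / \<theta> - 1) * exp (- (y powr (1 / \<theta>)))))"
    unfolding mellin_def
  proof (rule set_lebesgue_integral_cong)
    show "\<forall>y. y \<in> {0<..} \<longrightarrow> y powr (real n + 1 - 1) * w_LMB \<theta> a y =
       1 / (\<theta> * Gamma (a + 1)) * (y powr (b / \<theta> - 1) * exp (- (y powr (1 / \<theta>))))"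
    proof (intro allI impI)
      fix y :: real
      have "b / \<theta> - 1 = real n + (- 1 + (a + 1) / \<theta>)" using \<theta> by (simp add: b_def field_simps)
      then show "y powr (real n + 1 - 1) * w_LMB \<theta> a y =
       1 / (\<theta> * Gamma (a + 1)) * (y powr (b / \<theta> - 1) * exp (- (y powr (1 / \<theta>))))"
        by (simp only: w_LMB_def powr_add add_diff_cancel_right') simp
    qed
  qed auto
  also have "\<dots> = 1 / (\<theta> * Gamma (a + 1)) * (\<theta> * Gamma b)"
    by (simp only: set_integral_mult_right integral_powr_exp_powr[OF \<theta> b])
  finally show ?thesis using \<theta> by (simp add: b_def)
qed

section \<open>Series x^\<alpha> H(x^\<beta>) with an entire function H\<close>

definition rapid :: "(nat \<Rightarrow> real) \<Rightarrow> bool" where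
  "rapid c \<longleftrightarrow> (\<forall>r\<ge>0. summable (\<lambda>k. \<bar>c k\<bar> * r ^ k))"

text \<open>For \<open>rapid\<close> coefficients and x > 0 this is x^\<alpha> H(x^\<beta>), where H
  is entire with these coefficients. F is the case \<alpha> = 0, \<beta> = 1, while the weight and G
  have \<beta> = 1 / \<theta>. With explicit exponents, x d/dx acts on the coefficients
  alone.\<close>

definition gen_series :: "(nat \<Rightarrow> real) \<Rightarrow> real \<Rightarrow> real \<Rightarrow> real \<Rightarrow> real" where
  "gen_series c \<alpha> \<beta> x = (\<Sum>k. c k * x powr (\<alpha> + \<beta> * real k))"

lemma rapidI_fact:
  assumes "\<And>k. \<bar>c k\<bar> \<le> A * B ^ k / fact k"
  shows "rapid c"
  unfolding rapid_def
proof (intro allI impI)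
  fix r :: real assume r: "r \<ge> 0"
  have "summable (\<lambda>k. A * (inverse (fact k) * (B * r) ^ k))" by (intro summable_mult summable_exp)
  then show "summable (\<lambda>k. \<bar>c k\<bar> * r ^ k)"
  proof (rule summable_comparison_test')
    fix k :: nat
    have "\<bar>c k\<bar> * r ^ k \<le> A * B ^ k / fact k * r ^ k" using r by (intro mult_right_mono assms) auto
    then show "norm (\<bar>c k\<bar> * r ^ k) \<le> A * (inverse (fact k) * (B * r) ^ k)"
      using r by (simp add: power_mult_distrib field_simps)
  qed
qed

lemma rapid_geometric_mono:
  assumes c: "rapid c" and B: "B \<ge> 0" and le: "\<And>k. \<bar>d k\<bar> \<le> \<bar>c k\<bar> * (A * B ^ k)"
  shows "rapid d"
  unfolding rapid_def
proof (intro allI impI)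
  fix r :: real assume r: "r \<ge> 0"
  have "summable (\<lambda>k. A * (\<bar>c k\<bar> * (B * r) ^ k))"
    using c r B by (intro summable_mult) (auto simp: rapid_def)
  then show "summable (\<lambda>k. \<bar>d k\<bar> * r ^ k)"
  proof (rule summable_comparison_test')
    fix k :: nat
    have "\<bar>d k\<bar> * r ^ k \<le> \<bar>c k\<bar> * (A * B ^ k) * r ^ k" using r by (intro mult_right_mono le) auto
    then show "norm (\<bar>d k\<bar> * r ^ k) \<le> A * (\<bar>c k\<bar> * (B * r) ^ k)"
      using r by (simp add: power_mult_distrib mult_ac)
  qed
qed

lemma rapid_linear:
  assumes "rapid c"
  shows "rapid (\<lambda>k. c k * (p + q * real k))"
proof (rule rapid_geometric_mono[OF assms, of 2 _ "\<bar>p\<bar> + \<bar>q\<bar>"])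
  fix k
  have k: "real k \<le> 2 ^ k" using of_nat_less_two_power[of k] by (simp add: less_imp_le)
  have "\<bar>p + q * real k\<bar> \<le> \<bar>p\<bar> + \<bar>q\<bar> * real k" 
    using abs_triangle_ineq[of p "q * real k"] by (simp add: abs_mult)
  also have "\<dots> \<le> \<bar>p\<bar> * 2 ^ k + \<bar>q\<bar> * 2 ^ k" using k
    by (intro add_mono mult_left_mono) (auto simp: mult_le_cancel_left1)
  finally have "\<bar>p + q * real k\<bar> \<le> (\<bar>p\<bar> + \<bar>q\<bar>) * 2 ^ k" by (simp add: algebra_simps)
  then show "\<bar>c k * (p + q * real k)\<bar> \<le> \<bar>c k\<bar> * ((\<bar>p\<bar> + \<bar>q\<bar>) * 2 ^ k)"
    by (simp add: abs_mult mult_left_mono)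
qed simp

lemma powr_affine_eq: "x > 0 \<Longrightarrow> x powr (\<alpha> + \<beta> * real k) = x powr \<alpha> * (x powr \<beta>) ^ k"
  using powr_realpow[of "x powr \<beta>" k] by (simp add: powr_add powr_powr)

lemma rapid_summable_abs:
  assumes "rapid c" "x > 0"
  shows "summable (\<lambda>k. \<bar>c k\<bar> * x powr (\<alpha> + \<beta> * real k))"
proof -
  have "summable (\<lambda>k. x powr \<alpha> * (\<bar>c k\<bar> * (x powr \<beta>) ^ k))"
    using assms by (intro summable_mult) (auto simp: rapid_def)
  then show ?thesis using assms(2) by (simp add: powr_affine_eq mult_ac)
qed

lemma rapid_summable:
  assumes "rapid c" "x > 0"
  shows "summable (\<lambda>k. c k * x powr (\<alpha> + \<beta> * real k))"
  by (rule summable_rabs_cancel) (use rapid_summable_abs[OF assms] in \<open>simp add: abs_mult\<close>)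

lemma gen_series_sums:
  assumes "rapid c" "x > 0"
  shows "(\<lambda>k. c k * x powr (\<alpha> + \<beta> * real k)) sums gen_series c \<alpha> \<beta> x"
  unfolding gen_series_def using rapid_summable[OF assms] by (rule summable_sums)

text \<open>The factorization u^\<alpha> H(u^\<beta>) reduces termwise differentiation with real
  exponents to that of the power series H.\<close>

lemma gen_series_has_derivative:
  assumes c: "rapid c" and x: "x > 0"
  shows "(gen_series c \<alpha> \<beta> has_real_derivative gen_series (\<lambda>k. c k * (\<alpha> + \<beta> * real k)) (\<alpha> - 1) \<beta> x) (at x)"
proof -
  define H where "H = (\<lambda>z. \<Sum>k. c k * z ^ k)"
  define H' where "H' = (\<lambda>z. \<Sum>k. diffs c k * z ^ k)"
  have sm: "summable (\<lambda>k. c k * z ^ k)" for z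
    by (rule summable_rabs_cancel) (use c in \<open>simp add: rapid_def abs_mult power_abs\<close>)
  have dH: "(H has_real_derivative H' z) (at z)" for z
    unfolding H_def H'_def using sm by (rule termdiffs_strong_converges_everywhere)
  have eq: "gen_series c \<alpha> \<beta> u = u powr \<alpha> * H (u powr \<beta>)" if "u > 0" for u
    unfolding gen_series_def H_def suminf_mult[OF sm, symmetric] powr_affine_eq[OF that]
    by (simp add: mult_ac)
  define z where "z = x powr \<beta>"
  have z: "z > 0" using x by (simp add: z_def)
  have "((\<lambda>u. u powr \<alpha> * H (u powr \<beta>)) has_real_derivative
       (\<alpha> * x powr (\<alpha> - 1) * H z + x powr \<alpha> * (H' z * (\<beta> * x powr (\<beta> - 1))))) (at x)"
    using x by (auto intro!: derivative_eq_intros DERIV_chain2[OF dH] simp: z_def)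
  moreover have "\<alpha> * x powr (\<alpha> - 1) * H z + x powr \<alpha> * (H' z * (\<beta> * x powr (\<beta> - 1))) =
      gen_series (\<lambda>k. c k * (\<alpha> + \<beta> * real k)) (\<alpha> - 1) \<beta> x"
  proof -
    have "summable (\<lambda>k. diffs c k * z ^ k)"
      using termdiff_converges_all[of c z] sm by blast
    from sums_mult[OF diffs_equiv[OF this], of z]
    have "(\<lambda>n. z * (real n * c n * z ^ (n - Suc 0))) sums (z * H' z)" by (simp add: H'_def)
    moreover have "z * (real n * c n * z ^ (n - Suc 0)) = real n * c n * z ^ n" for n
      by (cases n) auto
    ultimately have s1: "(\<lambda>n. real n * c n * z ^ n) sums (z * H' z)" by simp
    have s2: "(\<lambda>n. c n * z ^ n) sums H z" using sm unfolding H_def by (rule summable_sums)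
    have s: "(\<lambda>n. x powr (\<alpha> - 1) * (\<alpha> * (c n * z ^ n) + \<beta> * (real n * c n * z ^ n))) sums
        (x powr (\<alpha> - 1) * (\<alpha> * H z + \<beta> * (z * H' z)))"
      by (intro sums_mult sums_add s1 s2)
    have "x powr (\<alpha> - 1) * (\<alpha> * H z + \<beta> * (z * H' z)) = (\<Sum>n. x powr (\<alpha> - 1) * (\<alpha> * (c n * z ^ n) + \<beta> * (real n * c n * z ^ n)))"
      using s by (rule sums_unique)
    also have "\<dots> = gen_series (\<lambda>k. c k * (\<alpha> + \<beta> * real k)) (\<alpha> - 1) \<beta> x"
      unfolding gen_series_def
      unfolding powr_affine_eq[OF x] z_def by (simp add: algebra_simps)
    finally have "x powr (\<alpha> - 1) * (\<alpha> * H z + \<beta> * (z * H' z)) = gen_series (\<lambda>k. c k * (\<alpha> + \<beta> * real k)) (\<alpha> - 1) \<beta> x" .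
    moreover have "x powr \<alpha> * x powr (\<beta> - 1) = x powr (\<alpha> - 1) * z"
      unfolding z_def powr_add[symmetric] by (simp add: algebra_simps)
    ultimately show ?thesis by (simp add: algebra_simps)
  qed
  ultimately have "((\<lambda>u. u powr \<alpha> * H (u powr \<beta>)) has_real_derivative gen_series (\<lambda>k. c k * (\<alpha> + \<beta> * real k)) (\<alpha> - 1) \<beta> x) (at x)"
    by simp
  then show ?thesis
  proof (rule has_field_derivative_transform_within_open)
    show "open {0::real<..}" "x \<in> {0<..}" using x by auto
  qed (simp add: eq)
qed

lemma gen_series_shift:
  assumes "rapid c" "x > 0"
  shows "x powr \<gamma> * gen_series c \<alpha> \<beta> x = gen_series c (\<alpha> + \<gamma>) \<beta> x"
proof -
  have "x powr \<gamma> * gen_series c \<alpha> \<beta> x = (\<Sum>k. x powr \<gamma> * (c k * x powr (\<alpha> + \<beta> * real k)))"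
    unfolding gen_series_def using rapid_summable[OF assms] by (rule suminf_mult[symmetric])
  also have "\<dots> = gen_series c (\<alpha> + \<gamma>) \<beta> x"
    unfolding gen_series_def by (rule suminf_cong) (simp add: powr_add mult_ac)
  finally show ?thesis .
qed

text \<open>Every term is an eigenfunction of the Euler operator, with its exponent as eigenvalue.
  The constant factor \<open>C\<close> and the general target algebra let this serve F, G and the
  partial derivatives of F(x) G(y) with the other variable frozen. Agreement on the open set u > 0
  determines the derivative at x.\<close>

lemma euler_op_gen_series:
  fixes f :: "real \<Rightarrow> 'a::real_normed_algebra_1"
  assumes c: "rapid c" and x: "x > 0" and f: "\<And>u. u > 0 \<Longrightarrow> f u = of_real (gen_series c \<alpha> \<beta> u) * C"
  shows "euler_op f x = of_real (gen_series (\<lambda>k. c k * (\<alpha> + \<beta> * real k)) \<alpha> \<beta> x) * C"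
proof -
  let ?D = "gen_series (\<lambda>k. c k * (\<alpha> + \<beta> * real k)) (\<alpha> - 1) \<beta> x"
  have "((\<lambda>u. of_real (gen_series c \<alpha> \<beta> u) * C) has_vector_derivative of_real ?D * C) (at x)"
    using gen_series_has_derivative[OF c x, of \<alpha> \<beta>]
    by (intro has_vector_derivative_mult_left has_vector_derivative_of_real)
       (simp add: has_real_derivative_iff_has_vector_derivative)
  then have "(f has_vector_derivative of_real ?D * C) (at x)"
    by (rule has_vector_derivative_transform_within_open[of _ _ _ "{0<..}"]) (use x f in auto)
  then have "vector_derivative f (at x) = of_real ?D * C" by (rule vector_derivative_at)
  then have "euler_op f x = of_real (x powr 1 * ?D) * C"
    using x by (simp add: euler_op_def scaleR_conv_of_real mult.assoc)
  also have "x powr 1 * ?D = gen_series (\<lambda>k. c k * (\<alpha> + \<beta> * real k)) \<alpha> \<beta> x"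
    using gen_series_shift[OF rapid_linear[OF c] x, of 1 \<alpha> \<beta> "\<alpha> - 1" \<beta>] by simp
  finally show ?thesis .
qed

text \<open>Rapidity of the new coefficients is part of the induction because the next
  differentiation relies on it.\<close>

lemma higher_deriv_gen_series:
  assumes c: "rapid c" and f: "\<And>u. u > 0 \<Longrightarrow> f u = gen_series c \<alpha> \<beta> u"
  shows "rapid (\<lambda>k. c k * (\<Prod>i<m. \<alpha> - real i + \<beta> * real k)) \<and> (\<forall>x>0. (deriv ^^ m) f x =
    gen_series (\<lambda>k. c k * (\<Prod>i<m. \<alpha> - real i + \<beta> * real k)) (\<alpha> - real m) \<beta> x)"
proof (induction m)
  case 0 then show ?case using c f by simp
next
  case (Suc m)
  let ?d = "\<lambda>k. c k * (\<Prod>i<m. \<alpha> - real i + \<beta> * real k)"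
  have eqd: "(\<lambda>k. c k * (\<Prod>i<Suc m. \<alpha> - real i + \<beta> * real k)) = (\<lambda>k. ?d k * ((\<alpha> - real m) + \<beta> * real k))"
    by (auto simp: mult_ac)
  have "rapid ?d" using Suc by blast
  have "(deriv ^^ Suc m) f x = gen_series (\<lambda>k. ?d k * ((\<alpha> - real m) + \<beta> * real k)) (\<alpha> - real m - 1) \<beta> x"
    if x: "x > 0" for x
  proof -
    have "((deriv ^^ m) f has_real_derivative gen_series (\<lambda>k. ?d k * ((\<alpha> - real m) + \<beta> * real k)) (\<alpha> - real m - 1) \<beta> x) (at x)"
      by (rule has_field_derivative_transform_within_open[OF gen_series_has_derivative[OF \<open>rapid ?d\<close> x], of "{0<..}"])
         (use Suc x in auto)
    then show ?thesis by (simp add: DERIV_imp_deriv)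
  qed
  moreover have "\<alpha> - real m - 1 = \<alpha> - real (Suc m)" by simp
  ultimately show ?case unfolding eqd using rapid_linear[OF \<open>rapid ?d\<close>] by simp
qed

subsection \<open>Expansions of the biorthogonal functions and the kernel\<close>

definition F_coeff :: "real \<Rightarrow> real \<Rightarrow> nat \<Rightarrow> real" where
  "F_coeff \<theta> a j = (-1) ^ j / fact j * rGamma (\<theta> * real j + a + 1)"

lemma rapid_F_coeff:
  assumes "\<theta> > 0" "a > -1"
  shows "rapid (F_coeff \<theta> a)"
proof -
  obtain K :: real where K: "K > 0" "\<And>s. s \<ge> 0 \<Longrightarrow> \<bar>rGamma s\<bar> \<le> K" using rGamma_real_bounded by blast
  show ?thesis
  proof (rule rapidI_fact)
    fix j
    have "0 \<le> \<theta> * real j" using assms by simp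
    then have "\<bar>rGamma (\<theta> * real j + a + 1)\<bar> \<le> K" using assms by (intro K) linarith
    then show "\<bar>F_coeff \<theta> a j\<bar> \<le> K * 1 ^ j / fact j"
      by (simp add: F_coeff_def abs_mult divide_right_mono)
  qed
qed

lemma G_pole_affine: "\<theta> > 0 \<Longrightarrow> G_pole \<theta> a k = ((a + 1) / \<theta> - 1) + 1 / \<theta> * real k"
  by (simp add: G_pole_def add_divide_distrib)

lemma rapid_G_coeff:
  assumes "\<theta> > 0" "a > -1"
  shows "rapid (G_coeff \<theta> a)"
proof -
  obtain K :: real where K: "K > 0" "\<And>s. s \<ge> 0 \<Longrightarrow> \<bar>rGamma s\<bar> \<le> K" using rGamma_real_bounded by blast
  show ?thesis
  proof (rule rapidI_fact)
    fix k
    have "\<bar>rGamma (G_pole \<theta> a k + 1)\<bar> \<le> K" using G_pole_gt[OF assms, of k] by (intro K) linarith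
    then have "\<bar>rGamma (G_pole \<theta> a k + 1)\<bar> / (\<theta> * fact k) \<le> K / (\<theta> * fact k)"
      using assms by (intro divide_right_mono) auto
    then show "\<bar>G_coeff \<theta> a k\<bar> \<le> K / \<theta> * 1 ^ k / fact k"
      using assms by (simp add: G_coeff_def abs_mult)
  qed
qed

lemma gen_series_0_1:
  assumes "x > 0"
  shows "gen_series c 0 1 x = (\<Sum>j. c j * x ^ j)"
  using assms by (simp add: gen_series_def powr_realpow)

lemma F_LMB_eq:
  assumes "x > 0"
  shows "F_LMB \<theta> a x = gen_series (F_coeff \<theta> a) 0 1 x"
proof -
  have "(- x) ^ j / (fact j * Gamma (\<theta> * real j + a + 1)) = F_coeff \<theta> a j * x ^ j" for j
    by (simp add: F_coeff_def power_minus[of x] rGamma_inverse_Gamma divide_inverse mult_ac)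
  then show ?thesis unfolding gen_series_0_1[OF assms] F_LMB_def by presburger
qed

lemma G_LMB_eq:
  assumes "\<theta> > 0" "a > -1" "x > 0" "poles_to_right \<theta> a c" "convergent_contour \<theta> a c \<kappa>"
  shows "G_LMB \<theta> a c \<kappa> x = of_real (gen_series (G_coeff \<theta> a) ((a + 1) / \<theta> - 1) (1 / \<theta>) x)"
proof (rule G_LMB_eq_series)
  show "(\<lambda>k. G_coeff \<theta> a k * x powr G_pole \<theta> a k) sums gen_series (G_coeff \<theta> a) ((a + 1) / \<theta> - 1) (1 / \<theta>) x"
    unfolding G_pole_affine[OF assms(1)] by (rule gen_series_sums[OF rapid_G_coeff[OF assms(1,2)] assms(3)])
qed fact+

lemma Gamma_arg_pos:
  fixes \<theta> a :: real
  assumes "\<theta> > 0" "a > -1"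
  shows "\<theta> * real j + a + 1 > 0"
proof -
  have "\<theta> * real j \<ge> 0" using assms by simp
  with assms show ?thesis by linarith
qed

section \<open>Exact series for the biorthogonal functions and the kernel at finite N\<close>

lemma p_tilde_eq:
  assumes "\<theta> > 0" "a > -1"
  shows "p_tilde \<theta> a n x = (\<Sum>j\<le>n. F_coeff \<theta> a j * x ^ j * (fact n / fact (n - j)))"
proof -
  have G: "Gamma (\<theta> * real j + a + 1) > 0" for j using Gamma_arg_pos[OF assms] by (rule Gamma_real_pos)
  have G1: "Gamma (a + 1) > 0" using assms by (intro Gamma_real_pos) auto
  have "p_tilde \<theta> a n x = fact n / Gamma (a + 1) * (\<Sum>j=0..n. (- x) ^ j / (fact j * fact (n - j) * (Gamma (\<theta> * real j + a + 1) / Gamma (a + 1))))"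
    unfolding p_tilde_def p_LMB_def mellin_w_LMB[OF assms] using less_imp_neq[OF G[of n]]
    by (simp add: power_mult_distrib[symmetric])
  also have "\<dots> = (\<Sum>j\<le>n. fact n / Gamma (a + 1) * ((- x) ^ j / (fact j * fact (n - j) * (Gamma (\<theta> * real j + a + 1) / Gamma (a + 1)))))"
    by (simp add: sum_distrib_left atLeast0AtMost)
  also have "\<dots> = (\<Sum>j\<le>n. F_coeff \<theta> a j * x ^ j * (fact n / fact (n - j)))"
  proof (rule sum.cong)
    fix j
    show "fact n / Gamma (a + 1) * ((- x) ^ j / (fact j * fact (n - j) * (Gamma (\<theta> * real j + a + 1) / Gamma (a + 1)))) =
       F_coeff \<theta> a j * x ^ j * (fact n / fact (n - j))"
      using G1 G[of j] by (simp add: F_coeff_def power_minus[of x] rGamma_inverse_Gamma divide_inverse mult_ac)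
  qed simp
  finally show ?thesis .
qed

lemma ff_ratio_eq_fact:
  assumes "j < N"
  shows "fact (N - 1) / fact (N - 1 - j) / real N ^ j = ff_ratio N j"
  using assms
proof (induction j)
  case 0 then show ?case by (simp add: ff_ratio_def)
next
  case (Suc j)
  have f: "fact (N - 1 - j) = (real (N - 1 - j)) * fact (N - 1 - Suc j)"
    using Suc.prems by (subst fact_reduce) auto
  have e1: "real (N - 1 - j) / real N = 1 - real (Suc j) / real N"
    using Suc.prems by (simp add: of_nat_diff field_simps)
  have e2: "fact (N - 1) / fact (N - 1 - Suc j) / real N ^ Suc j = (fact (N - 1) / fact (N - 1 - j) / real N ^ j) * (real (N - 1 - j) / real N)"
    using Suc.prems unfolding f by simp
  show ?case unfolding e2 e1 ff_ratio_Suc using Suc by simp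
qed

lemma p_tilde_scaled_eq:
  assumes "\<theta> > 0" "a > -1" "N \<ge> 1"
  shows "p_tilde \<theta> a (N - 1) (x / real N) = (\<Sum>j<N. F_coeff \<theta> a j * x ^ j * ff_ratio N j)"
  unfolding p_tilde_eq[OF assms(1,2)]
proof (rule sum.cong)
  show "{..N - 1} = {..<N}" using assms by auto
  fix j assume "j \<in> {..<N}"
  then show "F_coeff \<theta> a j * (x / real N) ^ j * (fact (N - 1) / fact (N - 1 - j)) = F_coeff \<theta> a j * x ^ j * ff_ratio N j"
    by (simp add: ff_ratio_eq_fact[symmetric] power_divide mult_ac)
qed

text \<open>The coefficients of exp (-z) / \<theta> in powers of z = x^(1/\<theta>). Multiplied by
  \<open>rGamma\<close> at G_pole + 1 they give \<open>G_coeff\<close>; at finite N the place of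
  that factor is taken by \<open>poch_ratio\<close>.\<close>

definition G_weight :: "real \<Rightarrow> nat \<Rightarrow> real" where
  "G_weight \<theta> k = (-1) ^ k / (\<theta> * fact k)"

lemma G_coeff_eq: "G_coeff \<theta> a k = G_weight \<theta> k * rGamma (G_pole \<theta> a k + 1)"
  by (simp add: G_coeff_def G_weight_def)

lemma rapid_G_weight: "\<theta> > 0 \<Longrightarrow> rapid (G_weight \<theta>)"
  by (rule rapidI_fact[of _ "1 / \<theta>" 1]) (simp add: G_weight_def abs_mult)

lemma w_LMB_eq_gen_series:
  assumes "\<theta> > 0" "a > -1" "u > 0"
  shows "w_LMB \<theta> a u = gen_series (\<lambda>k. G_weight \<theta> k / Gamma (a + 1)) ((a + 1) / \<theta> - 1) (1 / \<theta>) u"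
proof -
  define z where "z = u powr (1 / \<theta>)"
  have "(\<lambda>k. 1 / (\<theta> * Gamma (a + 1)) * u powr ((a + 1) / \<theta> - 1) * ((- z) ^ k /\<^sub>R fact k)) sums
      (1 / (\<theta> * Gamma (a + 1)) * u powr ((a + 1) / \<theta> - 1) * exp (- z))"
    by (intro sums_mult exp_converges)
  then have "1 / (\<theta> * Gamma (a + 1)) * u powr ((a + 1) / \<theta> - 1) * exp (- z) =
     (\<Sum>k. 1 / (\<theta> * Gamma (a + 1)) * u powr ((a + 1) / \<theta> - 1) * ((- z) ^ k /\<^sub>R fact k))"
    by (rule sums_unique)
  also have "\<dots> = gen_series (\<lambda>k. G_weight \<theta> k / Gamma (a + 1)) ((a + 1) / \<theta> - 1) (1 / \<theta>) u"
    unfolding gen_series_def powr_affine_eq[OF assms(3)] z_def[symmetric]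
    by (simp add: G_weight_def power_minus[of z] divide_inverse mult_ac)
  finally show ?thesis by (simp add: w_LMB_def z_def)
qed

text \<open>Termwise Rodrigues formula: the n-th derivative of x^(s + n) is (s + 1) (s + 2) ... (s +
  n) x^s. The sign in (-x)^n cancels against the one in \<open>q_tilde\<close>, and the Mellin
  normalization against its Gamma factor up to Gamma (a + 1).\<close>

lemma q_tilde_sums:
  assumes "\<theta> > 0" "a > -1" "x > 0"
  shows "(\<lambda>k. G_weight \<theta> k * (pochhammer (G_pole \<theta> a k + 1) n / fact n) * x powr G_pole \<theta> a k) sums q_tilde \<theta> a n x"
proof -
  define \<alpha> where "\<alpha> = (a + 1) / \<theta> - 1"
  define \<beta> where "\<beta> = 1 / \<theta>"
  define c where "c = (\<lambda>k. (-1) ^ n * (G_weight \<theta> k / Gamma (a + 1)))"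
  have G: "Gamma (\<theta> * real n + a + 1) > 0" using Gamma_arg_pos[OF assms(1,2)] by (rule Gamma_real_pos)
  have G1: "Gamma (a + 1) > 0" using assms by (intro Gamma_real_pos) auto
  have rw: "rapid (\<lambda>k. G_weight \<theta> k / Gamma (a + 1))"
    by (rule rapid_geometric_mono[OF rapid_G_weight[OF assms(1)], of 1 _ "1 / Gamma (a + 1)"]) (use G1 in auto)
  have rc: "rapid c"
    by (rule rapid_geometric_mono[OF rw, of 1 _ 1]) (auto simp: c_def abs_mult)
  have f: "(- u) ^ n * w_LMB \<theta> a u = gen_series c (\<alpha> + real n) \<beta> u" if "u > 0" for u
  proof -
    have "(- u) ^ n * w_LMB \<theta> a u = (-1) ^ n * (u powr real n * gen_series (\<lambda>k. G_weight \<theta> k / Gamma (a + 1)) \<alpha> \<beta> u)"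
      using that by (simp add: power_minus[of u] powr_realpow w_LMB_eq_gen_series[OF assms(1,2) that] \<alpha>_def \<beta>_def)
    also have "\<dots> = (-1) ^ n * gen_series (\<lambda>k. G_weight \<theta> k / Gamma (a + 1)) (\<alpha> + real n) \<beta> u"
      by (simp only: gen_series_shift[OF rw that])
    also have "\<dots> = gen_series c (\<alpha> + real n) \<beta> u"
      unfolding gen_series_def c_def suminf_mult[OF rapid_summable[OF rw that], symmetric] by (simp add: mult_ac)
    finally show ?thesis .
  qed
  have prod: "(\<Prod>i<n. \<alpha> + real n - real i + \<beta> * real k) = pochhammer (G_pole \<theta> a k + 1) n" for k
  proof -
    have "(\<Prod>i<n. \<alpha> + real n - real i + \<beta> * real k) = (\<Prod>i<n. G_pole \<theta> a k + 1 + real i)"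
      by (rule prod.reindex_bij_witness[of _ "\<lambda>i. n - 1 - i" "\<lambda>i. n - 1 - i"])
         (auto simp: G_pole_affine[OF assms(1)] \<alpha>_def \<beta>_def of_nat_diff)
    then show ?thesis by (simp add: pochhammer_prod atLeast0LessThan)
  qed
  from higher_deriv_gen_series[OF rc f, of n]
  have rcp: "rapid (\<lambda>k. c k * pochhammer (G_pole \<theta> a k + 1) n)"
    and d: "(deriv ^^ n) (\<lambda>u. (- u) ^ n * w_LMB \<theta> a u) x = gen_series (\<lambda>k. c k * pochhammer (G_pole \<theta> a k + 1) n) \<alpha> \<beta> x"
    using assms(3) by (auto simp: prod)
  have "(\<lambda>k. c k * pochhammer (G_pole \<theta> a k + 1) n * x powr G_pole \<theta> a k) sums ((deriv ^^ n) (\<lambda>u. (- u) ^ n * w_LMB \<theta> a u) x)"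
    unfolding d G_pole_affine[OF assms(1)] \<alpha>_def[symmetric] \<beta>_def[symmetric]
    using gen_series_sums[OF rcp assms(3)] unfolding G_pole_affine[OF assms(1)] \<alpha>_def[symmetric] \<beta>_def[symmetric] .
  from sums_mult[OF this, of "(-1) ^ n * Gamma (a + 1) / fact n"]
  have "(\<lambda>k. G_weight \<theta> k * (pochhammer (G_pole \<theta> a k + 1) n / fact n) * x powr G_pole \<theta> a k) sums
     ((-1) ^ n * Gamma (a + 1) / fact n * (deriv ^^ n) (\<lambda>u. (- u) ^ n * w_LMB \<theta> a u) x)"
    using G1 by (simp add: c_def field_simps power_mult_distrib[symmetric])
  also have "(-1) ^ n * Gamma (a + 1) / fact n * (deriv ^^ n) (\<lambda>u. (- u) ^ n * w_LMB \<theta> a u) x = q_tilde \<theta> a n x"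
    unfolding q_tilde_def q_LMB_def mellin_w_LMB[OF assms(1,2)] using G G1 by simp
  finally show ?thesis .
qed

lemma q_tilde_scaled_sums:
  assumes "\<theta> > 0" "a > -1" "x > 0" "N \<ge> 1"
  shows "(\<lambda>k. G_weight \<theta> k * poch_ratio N (G_pole \<theta> a k) * x powr G_pole \<theta> a k) sums q_tilde \<theta> a N (x / real N)"
proof -
  have "(\<lambda>k. G_weight \<theta> k * (pochhammer (G_pole \<theta> a k + 1) N / fact N) * (x / real N) powr G_pole \<theta> a k) sums q_tilde \<theta> a N (x / real N)"
    using assms by (intro q_tilde_sums) auto
  then show ?thesis using assms by (simp add: poch_ratio_def powr_divide)
qed

text \<open>The step from N to N + 1 is 1/(s + j + 1) + 1/(N - j) = (s + N + 1) / ((s + j + 1) (N -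
  j)). This is where the denominator of the kernel coefficients arises.\<close>

lemma sum_pochhammer_fact:
  assumes "j < N" "s > -1"
  shows "(\<Sum>n=j..<N. pochhammer (s + 1) n / fact (n - j)) = pochhammer (s + 1) N / (fact (N - 1 - j) * (s + real j + 1))"
  using assms(1)
proof (induction N)
  case (Suc N)
  have s: "s + real j + 1 \<noteq> 0" using assms(2) by linarith
  show ?case
  proof (cases "j = N")
    case True
    then show ?thesis using s by (simp add: pochhammer_Suc add_ac)
  next
    case False
    with Suc have jN: "j < N" by simp
    define P where "P = pochhammer (s + 1) N"
    define q where "q = (fact (N - 1 - j) :: real)"
    have q: "q > 0" by (simp add: q_def)
    have "fact (N - j) = real (N - j) * q" using jN unfolding q_def by (subst fact_reduce) (auto simp: diff_right_commute)
    moreover have "real (N - j) = real N - real j" "real N - real j > 0" using jN by (auto simp: of_nat_diff)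
    ultimately have f: "fact (N - j) = (real N - real j) * q" "real N - real j > 0" by auto
    have "(\<Sum>n=j..<Suc N. pochhammer (s + 1) n / fact (n - j)) = P / (q * (s + real j + 1)) + P / ((real N - real j) * q)"
      using Suc.IH[OF jN] jN f by (simp add: P_def q_def)
    also have "\<dots> = P * (s + 1 + real N) / (((real N - real j) * q) * (s + real j + 1))"
      using s q f(2) by (simp add: divide_simps) (simp add: algebra_simps)
    finally show ?thesis using f by (simp add: pochhammer_Suc P_def)
  qed
qed simp

lemma sum_lessThan_triangle_swap:
  fixes h :: "nat \<Rightarrow> nat \<Rightarrow> 'a::comm_monoid_add"
  shows "(\<Sum>n<N. \<Sum>j\<le>n. h n j) = (\<Sum>j<N. \<Sum>n=j..<N. h n j)"
proof (induction N)
  case (Suc N)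
  have "(\<Sum>j<Suc N. \<Sum>n=j..<Suc N. h n j) = (\<Sum>j<N. (\<Sum>n=j..<N. h n j) + h N j) + h N N"
    by (simp add: sum.atLeastLessThan_Suc)
  also have "\<dots> = (\<Sum>j<N. \<Sum>n=j..<N. h n j) + (\<Sum>j\<le>N. h N j)"
    by (simp add: sum.distrib add.assoc lessThan_Suc_atMost[symmetric])
  finally show ?case using Suc by simp
qed simp

lemma kernel_coefficient:
  assumes "j < N" "s > -1" "x > 0" "y > 0"
  shows "1 / real N * (\<Sum>n=j..<N. (x / real N) ^ j * (fact n / fact (n - j)) * (pochhammer (s + 1) n / fact n * (y / real N) powr s))
     = x ^ j * y powr s * (ff_ratio N j * poch_ratio N s / (s + real j + 1))"
proof -
  have N: "N > 0" using assms by simp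
  have "(\<Sum>n=j..<N. (x / real N) ^ j * (fact n / fact (n - j)) * (pochhammer (s + 1) n / fact n * (y / real N) powr s))
    = (x / real N) ^ j * (y / real N) powr s * (\<Sum>n=j..<N. pochhammer (s + 1) n / fact (n - j))"
    unfolding sum_distrib_left by (rule sum.cong) (simp_all add: mult_ac)
  also have "\<dots> = (x / real N) ^ j * (y / real N) powr s * (pochhammer (s + 1) N / (fact (N - 1 - j) * (s + real j + 1)))"
    by (simp only: sum_pochhammer_fact[OF assms(1,2)])
  finally have "1 / real N * (\<Sum>n=j..<N. (x / real N) ^ j * (fact n / fact (n - j)) * (pochhammer (s + 1) n / fact n * (y / real N) powr s))
    = 1 / real N * ((x / real N) ^ j * (y / real N) powr s * (pochhammer (s + 1) N / (fact (N - 1 - j) * (s + real j + 1))))" by simp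
  \<comment> \<open>\<open>ff_ratio\<close> carries (N - 1)! and \<open>poch_ratio\<close> carries 1
    / N!; their product accounts for the prefactor 1 / N of the kernel.\<close>
  moreover have "fact N = real N * fact (N - 1)" using N by (simp add: fact_reduce)
  ultimately show ?thesis
    using N assms unfolding ff_ratio_eq_fact[OF assms(1), symmetric] poch_ratio_def
    by (simp add: power_divide powr_divide mult_ac)
qed

text \<open>The normalizations of \<open>p_tilde\<close> and \<open>q_tilde\<close> cancel in each
  product. Only the series of q is infinite, so the sum over the degree n moves inside it; there the
  sums over n and over j \<le> n are exchanged and the former is evaluated in closed form.\<close>

lemma K_LMB_scaled_sums:
  assumes "\<theta> > 0" "a > -1" "x > 0" "y > 0" "N \<ge> 1"
  shows "(\<lambda>k. G_weight \<theta> k * y powr G_pole \<theta> a k *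
     (\<Sum>j<N. F_coeff \<theta> a j * x ^ j * (ff_ratio N j * poch_ratio N (G_pole \<theta> a k) / (G_pole \<theta> a k + real j + 1))))
     sums (1 / real N * K_LMB \<theta> a N (x / real N) (y / real N))"
proof -
  have pq: "p_LMB \<theta> a n u * q_LMB \<theta> a n v = p_tilde \<theta> a n u * q_tilde \<theta> a n v" for n u v
  proof -
    have "Gamma (\<theta> * real n + a + 1) > 0" using Gamma_arg_pos[OF assms(1,2)] by (rule Gamma_real_pos)
    moreover have "((-1) ^ n * (-1) ^ n :: real) = 1" by (simp flip: power_mult_distrib)
    ultimately show ?thesis by (simp add: p_tilde_def q_tilde_def)
  qed
  let ?s = "G_pole \<theta> a"
  have "(\<lambda>k. 1 / real N * (\<Sum>n<N. p_tilde \<theta> a n (x / real N) *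
      (G_weight \<theta> k * (pochhammer (?s k + 1) n / fact n) * (y / real N) powr ?s k)))
     sums (1 / real N * (\<Sum>n<N. p_tilde \<theta> a n (x / real N) * q_tilde \<theta> a n (y / real N)))"
    using assms by (intro sums_mult sums_sum q_tilde_sums) auto
  moreover have "1 / real N * (\<Sum>n<N. p_tilde \<theta> a n (x / real N) *
      (G_weight \<theta> k * (pochhammer (?s k + 1) n / fact n) * (y / real N) powr ?s k)) =
      G_weight \<theta> k * y powr ?s k * (\<Sum>j<N. F_coeff \<theta> a j * x ^ j * (ff_ratio N j * poch_ratio N (?s k) / (?s k + real j + 1)))" for k
  proof -
    define g where "g = (\<lambda>n j. (x / real N) ^ j * (fact n / fact (n - j)) * (pochhammer (?s k + 1) n / fact n * (y / real N) powr ?s k))"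
    have "(\<Sum>n<N. p_tilde \<theta> a n (x / real N) * (G_weight \<theta> k * (pochhammer (?s k + 1) n / fact n) * (y / real N) powr ?s k)) =
       (\<Sum>n<N. \<Sum>j\<le>n. G_weight \<theta> k * F_coeff \<theta> a j * g n j)"
      unfolding p_tilde_eq[OF assms(1,2)] sum_distrib_right g_def
      by (intro sum.cong refl) (simp only: mult_ac)
    also have "\<dots> = (\<Sum>j<N. \<Sum>n=j..<N. G_weight \<theta> k * F_coeff \<theta> a j * g n j)"
      by (rule sum_lessThan_triangle_swap)
    also have "\<dots> = G_weight \<theta> k * (\<Sum>j<N. F_coeff \<theta> a j * (\<Sum>n=j..<N. g n j))"
      by (simp add: sum_distrib_left mult_ac)
    finally have "1 / real N * (\<Sum>n<N. p_tilde \<theta> a n (x / real N) * (G_weight \<theta> k * (pochhammer (?s k + 1) n / fact n) * (y / real N) powr ?s k)) =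
      G_weight \<theta> k * (\<Sum>j<N. F_coeff \<theta> a j * (1 / real N * (\<Sum>n=j..<N. g n j)))"
      by (simp add: sum_distrib_left mult_ac)
    also have "\<dots> = G_weight \<theta> k * (\<Sum>j<N. F_coeff \<theta> a j * (x ^ j * y powr ?s k * (ff_ratio N j * poch_ratio N (?s k) / (?s k + real j + 1))))"
    proof -
      have "1 / real N * (\<Sum>n=j..<N. g n j) = x ^ j * y powr ?s k * (ff_ratio N j * poch_ratio N (?s k) / (?s k + real j + 1))" if "j < N" for j
        unfolding g_def using that assms by (intro kernel_coefficient G_pole_gt) auto
      then show ?thesis by (intro arg_cong[of _ _ "\<lambda>t. G_weight \<theta> k * t"] sum.cong refl) (simp only: lessThan_iff)
    qed
    also have "\<dots> = G_weight \<theta> k * y powr ?s k * (\<Sum>j<N. F_coeff \<theta> a j * x ^ j * (ff_ratio N j * poch_ratio N (?s k) / (?s k + real j + 1)))"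
      unfolding sum_distrib_left by (intro sum.cong refl) (simp only: mult_ac)
    finally show ?thesis .
  qed
  ultimately show ?thesis by (simp only: K_LMB_def pq)
qed

subsection \<open>The asymptotic expansions\<close>

text \<open>Multiplying 1 - p by r (1 + q) leaves the cross term p q, which is of order N^-2 and
  joins the error. The bound is kept as a function of s times a function of j, so that the double
  series of errors splits into two convergent ones.\<close>

lemma product_ratio_asymp:
  "\<exists>C>0. \<forall>s>-1. \<forall>N\<ge>1. \<forall>j. \<bar>ff_ratio N j * poch_ratio N s -
      rGamma (s + 1) * (1 + (s * (s + 1) - real j * (real j + 1)) / (2 * real N))\<bar>
     \<le> C * exp (3 * (s + 1)) * (real j + 1) ^ 4 / real N ^ 2"
proof -
  obtain C where C: "C > 0" "\<And>s N. s > -1 \<Longrightarrow> N \<ge> 1 \<Longrightarrow>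
     \<bar>poch_ratio N s - rGamma (s + 1) * (1 + s * (s + 1) / (2 * real N))\<bar> \<le> C * exp (3 * (s + 1)) / real N ^ 2"
    using poch_ratio_asymp by blast
  obtain K :: real where K: "K > 0" "\<And>s. s \<ge> 0 \<Longrightarrow> \<bar>rGamma s\<bar> \<le> K" using rGamma_real_bounded by blast
  have "\<bar>ff_ratio N j * poch_ratio N s - rGamma (s + 1) * (1 + (s * (s + 1) - real j * (real j + 1)) / (2 * real N))\<bar>
     \<le> (C + 3 * K) * exp (3 * (s + 1)) * (real j + 1) ^ 4 / real N ^ 2" if s: "s > -1" and N: "N \<ge> 1" for s N j
  proof -
    define P where "P = ff_ratio N j"
    define r where "r = rGamma (s + 1)"
    define p where "p = real j * (real j + 1) / (2 * real N)"
    define q where "q = s * (s + 1) / (2 * real N)"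
    define E where "E = exp (3 * (s + 1))"
    define J where "J = (real j + 1) ^ 4"
    define M where "M = 1 / real N ^ 2"
    have M: "M > 0" using N by (simp add: M_def)
    have E1: "E \<ge> 1" using s by (simp add: E_def)
    have J1: "J \<ge> 1" by (simp add: J_def)
    have P: "\<bar>P\<bar> \<le> 1" using ff_ratio_bounds[OF N, of j] by (simp add: P_def)
    have r: "\<bar>r\<bar> \<le> K" using K(2)[of "s + 1"] s by (simp add: r_def)
    have ea: "\<bar>poch_ratio N s - r * (1 + q)\<bar> \<le> C * E * M"
      using C(2)[OF s N] by (simp add: r_def q_def E_def M_def)
    have ep: "\<bar>P - (1 - p)\<bar> \<le> J * M"
      using ff_ratio_asymp[OF N, of j] by (simp add: P_def p_def J_def M_def)
    have sE: "\<bar>s * (s + 1) / 2\<bar> \<le> E"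
    proof -
      have "\<bar>s\<bar> * (s + 1) \<le> (s + 2) * (s + 1)" using s by (intro mult_right_mono) auto
      then have "\<bar>s * (s + 1) / 2\<bar> \<le> (s + 2) * (s + 1) / 2" using s by (simp add: abs_mult)
      also have "\<dots> \<le> exp (s + 1)" using exp_lower_Taylor_quadratic[of "s + 1"] s
        by (simp add: power2_eq_square field_simps)
      also have "\<dots> \<le> E" using s by (simp add: E_def)
      finally show ?thesis .
    qed
    have q1: "\<bar>q\<bar> \<le> E / real N"
      using divide_right_mono[OF sE, of "real N"] N by (simp add: q_def abs_mult)
    moreover have "E / real N \<le> E / 1" using N E1 by (intro divide_left_mono) auto
    ultimately have q2: "\<bar>1 + q\<bar> \<le> 2 * E" using E1 by linarith
    have pJ: "\<bar>p\<bar> \<le> J / real N"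
    proof -
      have "real j * (real j + 1) / 2 \<le> (real j + 1) ^ 2 * 1" by (simp add: power2_eq_square algebra_simps)
      also have "\<dots> \<le> (real j + 1) ^ 2 * (real j + 1) ^ 2" by (intro mult_left_mono) auto
      also have "\<dots> = J" by (simp add: J_def flip: power_add)
      finally have "real j * (real j + 1) / 2 / real N \<le> J / real N" by (intro divide_right_mono) auto
      then show ?thesis by (simp add: p_def)
    qed
    have pq: "\<bar>p\<bar> * \<bar>q\<bar> \<le> (J / real N) * (E / real N)" using pJ q1 J1 by (intro mult_mono) auto
    have "P * poch_ratio N s - r * (1 + (q - p)) = P * (poch_ratio N s - r * (1 + q)) + r * ((P - (1 - p)) * (1 + q) - p * q)"
      by (simp add: algebra_simps)
    also have "\<bar>\<dots>\<bar> \<le> \<bar>P\<bar> * \<bar>poch_ratio N s - r * (1 + q)\<bar> + \<bar>r\<bar> * (\<bar>P - (1 - p)\<bar> * \<bar>1 + q\<bar> + \<bar>p\<bar> * \<bar>q\<bar>)"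
    proof -
      have "\<bar>(P - (1 - p)) * (1 + q) - p * q\<bar> \<le> \<bar>P - (1 - p)\<bar> * \<bar>1 + q\<bar> + \<bar>p\<bar> * \<bar>q\<bar>"
        using abs_triangle_ineq4[of "(P - (1 - p)) * (1 + q)" "p * q"] by (simp only: abs_mult)
      then have "\<bar>r\<bar> * \<bar>(P - (1 - p)) * (1 + q) - p * q\<bar> \<le> \<bar>r\<bar> * (\<bar>P - (1 - p)\<bar> * \<bar>1 + q\<bar> + \<bar>p\<bar> * \<bar>q\<bar>)"
        by (rule mult_left_mono) simp
      then show ?thesis
        using abs_triangle_ineq[of "P * (poch_ratio N s - r * (1 + q))" "r * ((P - (1 - p)) * (1 + q) - p * q)"]
        unfolding abs_mult[of P] abs_mult[of r] by linarith
    qed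
    \<comment> \<open>Of the constant 3 K, two parts come from |1 + q| \<le> 2 E and one from the
      cross term.\<close>
    also have "\<dots> \<le> 1 * (C * E * M) + K * ((J * M) * (2 * E) + (J / real N) * (E / real N))"
      using K E1 J1 M C(1) by (intro add_mono mult_mono P ea r ep q2 pq) auto
    also have "\<dots> = C * E * M * 1 + 3 * K * E * M * J" by (simp add: M_def power2_eq_square field_simps)
    also have "\<dots> \<le> C * E * M * J + 3 * K * E * M * J" using C(1) E1 M J1 by (intro add_right_mono mult_left_mono) auto
    also have "\<dots> = (C + 3 * K) * E * J / real N ^ 2" by (simp add: M_def algebra_simps add_divide_distrib)
    finally show ?thesis by (simp add: P_def r_def p_def q_def E_def J_def diff_divide_distrib)
  qed
  then show ?thesis using C(1) K(1) by (intro exI[of _ "C + 3 * K"]) auto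
qed

section \<open>Termwise integration over the unit interval\<close>

lemma set_integral_powr_01:
  fixes s :: real
  assumes "s > -1"
  shows "set_integrable lborel {0<..1} (\<lambda>t. t powr s)"
    and "(LINT t:{0<..1}|lborel. t powr s) = 1 / (s + 1)"
proof -
  have hi: "((\<lambda>t. t powr s) has_integral (1 / (s + 1))) {0..1}"
    using has_integral_powr_from_0[OF assms, of 1] by simp
  have "((\<lambda>t. t powr s) has_integral (1 / (s + 1))) {0<..1}"
  proof (subst has_integral_spike_set_eq)
    show "((\<lambda>t. t powr s) has_integral (1 / (s + 1))) {0..1}" by (rule hi)
    show "negligible {x \<in> {0<..1} - {0..1}. x powr s \<noteq> 0}" by (rule negligible_subset[of "{}"]) auto
    show "negligible {x \<in> {0..1} - {0<..1}. x powr s \<noteq> 0}" by (rule negligible_subset[of "{0}"]) auto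
  qed
  note hi = this
  then have "(\<lambda>t. t powr s) absolutely_integrable_on {0<..1}"
    by (intro nonnegative_absolutely_integrable_1) (auto simp: has_integral_integrable)
  then show si: "set_integrable lborel {0<..1} (\<lambda>t. t powr s)"
    unfolding set_integrable_def by (subst (asm) integrable_completion) auto
  show "(LINT t:{0<..1}|lborel. t powr s) = 1 / (s + 1)"
    using set_borel_integral_eq_integral(2)[OF si] integral_unique[OF hi] by simp
qed

text \<open>A single integrable majorant B t^s for all u_k, combined with absolutely summable
  coefficients, gives the interchange. The range s > -1 admits the singularity that G may have at
  0.\<close>

lemma set_integral_series_01:
  fixes u :: "nat \<Rightarrow> real \<Rightarrow> real"
  assumes s: "s > -1" and c: "summable (\<lambda>k. \<bar>c k\<bar>)"
    and meas: "\<And>k. u k \<in> borel_measurable borel"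
    and bound: "\<And>k t. 0 < t \<Longrightarrow> t \<le> 1 \<Longrightarrow> \<bar>u k t\<bar> \<le> B * t powr s"
  shows "(\<lambda>k. c k * (LINT t:{0<..1}|lborel. u k t)) sums (LINT t:{0<..1}|lborel. (\<Sum>k. c k * u k t))"
proof -
  define f where "f = (\<lambda>k t. indicator {0<..1} t * (c k * u k t) :: real)"
  define g where "g = (\<lambda>t. indicator {0<..1} t * t powr s :: real)"
  have g: "integrable lborel g" "integral\<^sup>L lborel g = 1 / (s + 1)"
    using set_integral_powr_01[OF s] by (auto simp: set_integrable_def set_lebesgue_integral_def g_def)
  have le: "\<bar>f k t\<bar> \<le> \<bar>c k\<bar> * B * g t" for k t
    using mult_left_mono[OF bound[of t k], of "\<bar>c k\<bar>"] by (auto simp: f_def g_def indicator_def abs_mult mult.assoc)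
  have mf: "f k \<in> borel_measurable lborel" for k unfolding f_def using meas[of k] by measurable
  have int: "integrable lborel (f k)" for k
  proof (rule Bochner_Integration.integrable_bound[OF _ mf])
    show "integrable lborel (\<lambda>t. \<bar>c k\<bar> * B * g t)" using g by simp
    show "AE t in lborel. norm (f k t) \<le> norm (\<bar>c k\<bar> * B * g t)"
      using le by (intro always_eventually allI) (metis abs_ge_self order.trans real_norm_def)
  qed
  have "(\<lambda>k. integral\<^sup>L lborel (f k)) sums (integral\<^sup>L lborel (\<lambda>t. \<Sum>k. f k t))"
  proof (rule sums_integral[OF int])
    have "summable (\<lambda>k. norm (f k t))" for t
      by (rule summable_comparison_test'[OF summable_mult2[OF c, of "B * g t"]]) (use le in \<open>simp add: mult.assoc\<close>)
    then show "AE t in lborel. summable (\<lambda>k. norm (f k t))" by simp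
    show "summable (\<lambda>k. LINT t|lborel. norm (f k t))"
    proof (rule summable_comparison_test'[OF summable_mult2[OF c, of "B * (1 / (s + 1))"]])
      fix k :: nat
      have "(LINT t|lborel. norm (f k t)) \<le> (LINT t|lborel. \<bar>c k\<bar> * B * g t)"
        using int[of k] g le by (intro integral_mono) auto
      then show "norm (LINT t|lborel. norm (f k t)) \<le> \<bar>c k\<bar> * (B * (1 / (s + 1)))"
        using g by simp
    qed
  qed
  moreover have "integral\<^sup>L lborel (f k) = c k * (LINT t:{0<..1}|lborel. u k t)" for k
    by (simp add: f_def set_lebesgue_integral_def mult.left_commute)
  moreover have "integral\<^sup>L lborel (\<lambda>t. \<Sum>k. f k t) = (LINT t:{0<..1}|lborel. (\<Sum>k. c k * u k t))"
    unfolding set_lebesgue_integral_def f_def by (rule Bochner_Integration.integral_cong) (auto simp: indicator_def)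
  ultimately show ?thesis by simp
qed

text \<open>The interchange is used twice: at a fixed exponent for the series of f against t^s, and
  then for the series of g with the other factor bounded on (0, 1]. There t^(\<alpha> + \<beta> k)
  \<le> t^\<alpha>, so the lowest exponent supplies the majorant.\<close>

lemma integral_gen_series_product:
  assumes f: "rapid f" and g: "rapid g" and \<alpha>: "\<alpha> > -1" and \<beta>: "\<beta> \<ge> 0" and x: "x > 0" and y: "y > 0"
  shows "(\<lambda>k. g k * y powr (\<alpha> + \<beta> * real k) * (\<Sum>j. f j * x ^ j / (\<alpha> + \<beta> * real k + real j + 1)))
    sums (LINT t:{0<..1}|lborel. gen_series f 0 1 (x * t) * gen_series g \<alpha> \<beta> (y * t))"
    and "s > -1 \<Longrightarrow> summable (\<lambda>j. f j * x ^ j / (s + real j + 1))"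
proof -
  define X where "X = (\<lambda>j. f j * x ^ j)"
  have smX: "summable (\<lambda>j. \<bar>X j\<bar>)" using f x by (simp add: rapid_def X_def abs_mult)
  define \<Phi> where "\<Phi> = (\<lambda>t. \<Sum>j. X j * t ^ j)"
  have \<Phi>m: "\<Phi> \<in> borel_measurable borel" unfolding \<Phi>_def by measurable
  have smXt: "summable (\<lambda>j. \<bar>X j * t ^ j\<bar>)" if "0 < t" "t \<le> 1" for t
    by (rule summable_comparison_test'[OF smX]) (use that in \<open>simp add: abs_mult mult_left_le power_le_one\<close>)
  have \<Phi>b: "\<bar>\<Phi> t\<bar> \<le> (\<Sum>j. \<bar>X j\<bar>)" if "0 < t" "t \<le> 1" for t
  proof -
    have "\<bar>\<Phi> t\<bar> \<le> (\<Sum>j. \<bar>X j * t ^ j\<bar>)" unfolding \<Phi>_def by (rule summable_rabs[OF smXt[OF that]])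
    also have "\<dots> \<le> (\<Sum>j. \<bar>X j\<bar>)"
      by (rule suminf_le[OF _ smXt[OF that] smX]) (use that in \<open>simp add: abs_mult mult_left_le power_le_one\<close>)
    finally show ?thesis .
  qed
  have inner: "(\<lambda>j. X j * (1 / (s + real j + 1))) sums (LINT t:{0<..1}|lborel. t powr s * \<Phi> t)" if s: "s > -1" for s
  proof -
    have "(\<lambda>j. X j * (LINT t:{0<..1}|lborel. t powr (s + real j))) sums (LINT t:{0<..1}|lborel. (\<Sum>j. X j * t powr (s + real j)))"
      by (rule set_integral_series_01[OF s smX, where B = 1]) (auto intro: powr_mono')
    moreover have "(LINT t:{0<..1}|lborel. t powr (s + real j)) = 1 / (s + real j + 1)" for j
      using s by (intro set_integral_powr_01(2)) auto
    moreover have "(LINT t:{0<..1}|lborel. (\<Sum>j. X j * t powr (s + real j))) = (LINT t:{0<..1}|lborel. t powr s * \<Phi> t)"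
    proof (rule set_lebesgue_integral_cong)
      show "\<forall>t. t \<in> {0<..1} \<longrightarrow> (\<Sum>j. X j * t powr (s + real j)) = t powr s * \<Phi> t"
      proof (intro allI impI)
        fix t :: real assume t: "t \<in> {0<..1}"
        then have "summable (\<lambda>j. X j * t ^ j)" using smXt[of t] by (auto intro: summable_rabs_cancel)
        from suminf_mult[OF this, of "t powr s"] t
        show "(\<Sum>j. X j * t powr (s + real j)) = t powr s * \<Phi> t"
          by (simp add: \<Phi>_def powr_add powr_realpow mult_ac)
      qed
    qed auto
    ultimately show ?thesis by simp
  qed
  show "summable (\<lambda>j. f j * x ^ j / (s + real j + 1))" if "s > -1"
    using inner[OF that] by (auto simp: X_def sums_iff)
  define Y where "Y = (\<lambda>k. g k * y powr (\<alpha> + \<beta> * real k))"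
  have smY: "summable (\<lambda>k. \<bar>Y k\<bar>)" using rapid_summable_abs[OF g y] by (simp add: Y_def abs_mult)
  define M where "M = (\<Sum>j. \<bar>X j\<bar>)"
  have "(\<lambda>k. Y k * (LINT t:{0<..1}|lborel. t powr (\<alpha> + \<beta> * real k) * \<Phi> t))
     sums (LINT t:{0<..1}|lborel. (\<Sum>k. Y k * (t powr (\<alpha> + \<beta> * real k) * \<Phi> t)))"
  proof (rule set_integral_series_01[OF \<alpha> smY, where B = M])
    show "(\<lambda>t. t powr (\<alpha> + \<beta> * real k) * \<Phi> t) \<in> borel_measurable borel" for k
      using \<Phi>m by measurable
    fix k :: nat and t :: real assume t: "0 < t" "t \<le> 1"
    have "t powr (\<alpha> + \<beta> * real k) \<le> t powr \<alpha>" using t \<beta> by (intro powr_mono') auto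
    then have "t powr (\<alpha> + \<beta> * real k) * \<bar>\<Phi> t\<bar> \<le> t powr \<alpha> * M"
      using \<Phi>b[OF t] by (intro mult_mono) (auto simp: M_def)
    then show "\<bar>t powr (\<alpha> + \<beta> * real k) * \<Phi> t\<bar> \<le> M * t powr \<alpha>" by (simp add: abs_mult mult.commute)
  qed
  moreover have "(LINT t:{0<..1}|lborel. t powr (\<alpha> + \<beta> * real k) * \<Phi> t) = (\<Sum>j. f j * x ^ j / (\<alpha> + \<beta> * real k + real j + 1))" for k
  proof -
    have "\<beta> * real k \<ge> 0" using \<beta> by simp
    then have "\<alpha> + \<beta> * real k > -1" using \<alpha> by linarith
    from sums_unique[OF inner[OF this]] show ?thesis by (simp add: X_def)
  qed
  moreover have "(LINT t:{0<..1}|lborel. (\<Sum>k. Y k * (t powr (\<alpha> + \<beta> * real k) * \<Phi> t))) =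
     (LINT t:{0<..1}|lborel. gen_series f 0 1 (x * t) * gen_series g \<alpha> \<beta> (y * t))"
  proof (rule set_lebesgue_integral_cong)
    show "\<forall>t. t \<in> {0<..1} \<longrightarrow> (\<Sum>k. Y k * (t powr (\<alpha> + \<beta> * real k) * \<Phi> t)) = gen_series f 0 1 (x * t) * gen_series g \<alpha> \<beta> (y * t)"
    proof (intro allI impI)
      fix t :: real assume "t \<in> {0<..1}"
      then have t: "t > 0" by simp
      have "gen_series f 0 1 (x * t) = \<Phi> t"
        using x t by (simp add: gen_series_0_1 \<Phi>_def X_def power_mult_distrib mult_ac)
      moreover have "gen_series f 0 1 (x * t) * gen_series g \<alpha> \<beta> (y * t) =
          (\<Sum>k. gen_series f 0 1 (x * t) * (g k * (y * t) powr (\<alpha> + \<beta> * real k)))"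
        unfolding gen_series_def[of g] using rapid_summable[OF g, of "y * t"] y t by (intro suminf_mult[symmetric]) auto
      ultimately show "(\<Sum>k. Y k * (t powr (\<alpha> + \<beta> * real k) * \<Phi> t)) = gen_series f 0 1 (x * t) * gen_series g \<alpha> \<beta> (y * t)"
        using y t by (simp add: Y_def powr_mult mult_ac)
    qed
  qed auto
  ultimately show "(\<lambda>k. g k * y powr (\<alpha> + \<beta> * real k) * (\<Sum>j. f j * x ^ j / (\<alpha> + \<beta> * real k + real j + 1)))
    sums (LINT t:{0<..1}|lborel. gen_series f 0 1 (x * t) * gen_series g \<alpha> \<beta> (y * t))"
    by (simp add: Y_def)
qed

section \<open>From termwise error bounds to the three expansions\<close>

lemma bigo_inverse_squareI:
  fixes f :: "nat \<Rightarrow> 'a::{real_normed_field}"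
  assumes "\<exists>D. \<forall>N\<ge>1. norm (f N) \<le> D / real N ^ 2"
  shows "f \<in> O(\<lambda>N. 1 / of_nat N ^ 2)"
proof -
  obtain D where D: "\<And>N. N \<ge> 1 \<Longrightarrow> norm (f N) \<le> D / real N ^ 2" using assms by blast
  show ?thesis
  proof (rule bigoI[of _ D])
  show "\<forall>\<^sub>F N in sequentially. norm (f N) \<le> D * norm (1 / of_nat N ^ 2 :: 'a)"
    using eventually_ge_at_top[of 1] by eventually_elim (use D in \<open>simp add: norm_divide norm_power\<close>)
  qed
qed

lemma F_coeff_quartic_summable:
  assumes "\<theta> > 0" "a > -1" "x > 0"
  shows "summable (\<lambda>k. \<bar>F_coeff \<theta> a k\<bar> * x ^ k * (real k + 1) ^ 4)"
proof -
  let ?c = "F_coeff \<theta> a"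
  \<comment> \<open>Since k + 1 \<le> 2^k, the quartic factor is at most 16^k.\<close>
  have "rapid (\<lambda>k. ?c k * (real k + 1) ^ 4)"
  proof (rule rapid_geometric_mono[OF rapid_F_coeff[OF assms(1,2)], of 16 _ 1])
    fix k :: nat
    have "real (Suc k) \<le> real (2 ^ k)" using Suc_leI[OF less_exp[of k]] by (simp only: of_nat_le_iff)
    then have "real k + 1 \<le> 2 ^ k" by simp
    then have "(real k + 1) ^ 4 \<le> (2 ^ k) ^ 4" by (intro power_mono) auto
    also have "\<dots> = (2 ^ 4 :: real) ^ k" by (simp only: power_mult[symmetric] mult.commute)
    finally show "\<bar>?c k * (real k + 1) ^ 4\<bar> \<le> \<bar>?c k\<bar> * (1 * 16 ^ k)" by (simp add: abs_mult mult_left_mono)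
  qed simp
  then show ?thesis using assms(3) by (auto simp: rapid_def abs_mult mult_ac)
qed

text \<open>On x^j the Euler operator plus its square has eigenvalue j + j^2 = j (j + 1), the number
  in the expansion of \<open>ff_ratio\<close>. The quartic error in j is summable against the
  coefficients of F, which makes \<open>D\<close> independent of N.\<close>

lemma p_tilde_asymp:
  assumes "\<theta> > 0" "a > -1" "x > 0"
  shows "\<exists>D. \<forall>N\<ge>1. \<bar>p_tilde \<theta> a (N - 1) (x / real N)
        - (F_LMB \<theta> a x - 1 / (2 * real N) * (euler_op (F_LMB \<theta> a) x + euler_op (euler_op (F_LMB \<theta> a)) x))\<bar> \<le> D / real N ^ 2"
proof -
  let ?c = "F_coeff \<theta> a"
  have c: "rapid ?c" using assms by (intro rapid_F_coeff)
  have F: "F_LMB \<theta> a u = of_real (gen_series ?c 0 1 u) * 1" if "u > 0" for u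
    using that by (simp add: F_LMB_eq)
  have e1: "euler_op (F_LMB \<theta> a) u = of_real (gen_series (\<lambda>k. ?c k * (0 + 1 * real k)) 0 1 u) * 1" if "u > 0" for u
    by (rule euler_op_gen_series[OF c that F])
  have c1: "rapid (\<lambda>k. ?c k * (0 + 1 * real k))" by (rule rapid_linear[OF c])
  have e2: "euler_op (euler_op (F_LMB \<theta> a)) x = of_real (gen_series (\<lambda>k. ?c k * (0 + 1 * real k) * (0 + 1 * real k)) 0 1 x) * 1"
    by (rule euler_op_gen_series[OF c1 assms(3) e1])
  have c2: "rapid (\<lambda>k. ?c k * (0 + 1 * real k) * (0 + 1 * real k))" by (rule rapid_linear[OF c1])
  have sums01: "(\<lambda>k. d k * x ^ k) sums gen_series d 0 1 x" if "rapid d" for d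
    using gen_series_sums[OF that assms(3), of 0 1] assms(3) by (simp add: powr_realpow)
  have sm4: "summable (\<lambda>k. \<bar>?c k\<bar> * x ^ k * (real k + 1) ^ 4)"
    using assms by (rule F_coeff_quartic_summable)
  define D where "D = (\<Sum>k. \<bar>?c k\<bar> * x ^ k * (real k + 1) ^ 4)"
  have "\<bar>p_tilde \<theta> a (N - 1) (x / real N)
        - (F_LMB \<theta> a x - 1 / (2 * real N) * (euler_op (F_LMB \<theta> a) x + euler_op (euler_op (F_LMB \<theta> a)) x))\<bar> \<le> D / real N ^ 2"
    if N: "N \<ge> 1" for N
  proof -
    have "(\<lambda>j. ?c j * x ^ j * ff_ratio N j) sums p_tilde \<theta> a (N - 1) (x / real N)"
      unfolding p_tilde_scaled_eq[OF assms(1,2) N] using N by (intro sums_finite) (auto simp: ff_ratio_eq_0)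
    moreover have "(\<lambda>j. ?c j * x ^ j - 1 / (2 * real N) * (?c j * (0 + 1 * real j) * x ^ j + ?c j * (0 + 1 * real j) * (0 + 1 * real j) * x ^ j)) sums
       (F_LMB \<theta> a x - 1 / (2 * real N) * (euler_op (F_LMB \<theta> a) x + euler_op (euler_op (F_LMB \<theta> a)) x))"
      unfolding F[OF assms(3)] e1[OF assms(3)] e2 of_real_eq_id id_apply mult_1_right
      by (intro sums_diff sums_mult sums_add sums01 c c1 c2)
    ultimately have "(\<lambda>j. ?c j * x ^ j * ff_ratio N j - (?c j * x ^ j - 1 / (2 * real N) * (?c j * (0 + 1 * real j) * x ^ j + ?c j * (0 + 1 * real j) * (0 + 1 * real j) * x ^ j))) sums
       (p_tilde \<theta> a (N - 1) (x / real N) - (F_LMB \<theta> a x - 1 / (2 * real N) * (euler_op (F_LMB \<theta> a) x + euler_op (euler_op (F_LMB \<theta> a)) x)))"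
      by (rule sums_diff)
    moreover have "?c j * x ^ j * ff_ratio N j - (?c j * x ^ j - 1 / (2 * real N) * (?c j * (0 + 1 * real j) * x ^ j + ?c j * (0 + 1 * real j) * (0 + 1 * real j) * x ^ j))
       = ?c j * x ^ j * (ff_ratio N j - (1 - real j * (real j + 1) / (2 * real N)))" for j
      by (simp add: algebra_simps add_divide_distrib)
    ultimately have s: "(\<lambda>j. ?c j * x ^ j * (ff_ratio N j - (1 - real j * (real j + 1) / (2 * real N)))) sums
       (p_tilde \<theta> a (N - 1) (x / real N) - (F_LMB \<theta> a x - 1 / (2 * real N) * (euler_op (F_LMB \<theta> a) x + euler_op (euler_op (F_LMB \<theta> a)) x)))" (is "?t sums ?S")
      by simp
    have le: "\<bar>?t j\<bar> \<le> \<bar>?c j\<bar> * x ^ j * (real j + 1) ^ 4 * (1 / real N ^ 2)" for j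
      using mult_left_mono[OF ff_ratio_asymp[OF N, of j], of "\<bar>?c j\<bar> * x ^ j"] assms(3) by (simp add: abs_mult)
    have smD: "summable (\<lambda>j. \<bar>?c j\<bar> * x ^ j * (real j + 1) ^ 4 * (1 / real N ^ 2))" by (intro summable_mult2 sm4)
    have "norm (suminf ?t) \<le> (\<Sum>j. \<bar>?c j\<bar> * x ^ j * (real j + 1) ^ 4 * (1 / real N ^ 2))"
      by (rule norm_suminf_le[OF _ smD]) (use le in simp)
    also have "\<dots> = D * (1 / real N ^ 2)" unfolding D_def by (rule suminf_mult2[OF sm4, symmetric])
    finally show ?thesis using sums_unique[OF s] by simp
  qed
  then show ?thesis by blast
qed

text \<open>The exponents are affine in k, so the error factor is geometric in k and the factorial
  in the weight dominates it.\<close>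

lemma rapid_G_weight_exp:
  assumes "\<theta> > 0"
  shows "rapid (\<lambda>k. G_weight \<theta> k * exp (3 * (G_pole \<theta> a k + 1)))"
proof (rule rapid_geometric_mono[OF rapid_G_weight[OF assms], of "exp (3 / \<theta>)" _ "exp (3 * (a + 1) / \<theta>)"])
  fix k
  have "3 * (G_pole \<theta> a k + 1) = 3 * (a + 1) / \<theta> + real k * (3 / \<theta>)"
    using assms by (simp add: G_pole_def field_simps)
  then have "exp (3 * (G_pole \<theta> a k + 1)) = exp (3 * (a + 1) / \<theta>) * exp (3 / \<theta>) ^ k"
    by (simp only: exp_add exp_of_nat_mult)
  then show "\<bar>G_weight \<theta> k * exp (3 * (G_pole \<theta> a k + 1))\<bar> \<le> \<bar>G_weight \<theta> k\<bar> * (exp (3 * (a + 1) / \<theta>) * exp (3 / \<theta>) ^ k)"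
    by (simp add: abs_mult)
qed simp

lemma G_pole_powr_summable_exp:
  assumes "\<theta> > 0" "y > 0"
  shows "summable (\<lambda>k. \<bar>G_weight \<theta> k\<bar> * y powr G_pole \<theta> a k * exp (3 * (G_pole \<theta> a k + 1)))"
proof -
  have "summable (\<lambda>k. \<bar>G_weight \<theta> k * exp (3 * (G_pole \<theta> a k + 1))\<bar> * y powr (((a + 1) / \<theta> - 1) + 1 / \<theta> * real k))"
    by (rule rapid_summable_abs[OF rapid_G_weight_exp[OF assms(1)] assms(2)])
  then show ?thesis unfolding G_pole_affine[OF assms(1), symmetric] by (simp add: abs_mult mult_ac)
qed

text \<open>On x^s the operator has eigenvalue s (s + 1), as in the expansion of
  \<open>poch_ratio\<close>. The comparison is made between real series; complex numbers appear only
  because G is a contour integral.\<close>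

lemma q_tilde_asymp:
  assumes \<theta>: "\<theta> > 0" and a: "a > -1" and x: "x > 0" and pc: "poles_to_right \<theta> a c" and cc: "convergent_contour \<theta> a c \<kappa>"
  defines "G \<equiv> G_LMB \<theta> a c \<kappa>"
  shows "\<exists>D. \<forall>N\<ge>1. norm (complex_of_real (q_tilde \<theta> a N (x / real N))
        - (G x + 1 / (2 * of_nat N) * (euler_op G x + euler_op (euler_op G) x))) \<le> D / real N ^ 2"
proof -
  let ?c = "G_coeff \<theta> a"
  let ?s = "G_pole \<theta> a"
  define \<alpha> where "\<alpha> = (a + 1) / \<theta> - 1"
  define \<beta> where "\<beta> = 1 / \<theta>"
  have sk: "?s k = \<alpha> + \<beta> * real k" for k by (simp add: G_pole_affine[OF \<theta>] \<alpha>_def \<beta>_def)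
  have c: "rapid ?c" using \<theta> a by (intro rapid_G_coeff)
  have G: "G u = of_real (gen_series ?c \<alpha> \<beta> u) * 1" if "u > 0" for u
    using that by (simp add: G_def \<alpha>_def \<beta>_def G_LMB_eq[OF \<theta> a _ pc cc])
  have e1: "euler_op G u = of_real (gen_series (\<lambda>k. ?c k * (\<alpha> + \<beta> * real k)) \<alpha> \<beta> u) * 1" if "u > 0" for u
    by (rule euler_op_gen_series[OF c that G])
  have c1: "rapid (\<lambda>k. ?c k * (\<alpha> + \<beta> * real k))" by (rule rapid_linear[OF c])
  have e2: "euler_op (euler_op G) x = of_real (gen_series (\<lambda>k. ?c k * (\<alpha> + \<beta> * real k) * (\<alpha> + \<beta> * real k)) \<alpha> \<beta> x) * 1"
    by (rule euler_op_gen_series[OF c1 x e1])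
  have c2: "rapid (\<lambda>k. ?c k * (\<alpha> + \<beta> * real k) * (\<alpha> + \<beta> * real k))" by (rule rapid_linear[OF c1])
  obtain C where C: "C > 0" "\<And>s N. s > -1 \<Longrightarrow> N \<ge> 1 \<Longrightarrow>
     \<bar>poch_ratio N s - rGamma (s + 1) * (1 + s * (s + 1) / (2 * real N))\<bar> \<le> C * exp (3 * (s + 1)) / real N ^ 2"
    using poch_ratio_asymp by blast
  define b where "b = (\<lambda>k. \<bar>G_weight \<theta> k\<bar> * x powr ?s k * exp (3 * (?s k + 1)))"
  have b: "summable b" unfolding b_def using \<theta> x by (rule G_pole_powr_summable_exp)
  have "norm (complex_of_real (q_tilde \<theta> a N (x / real N))
        - (G x + 1 / (2 * of_nat N) * (euler_op G x + euler_op (euler_op G) x))) \<le> (suminf b * C) / real N ^ 2"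
    if N: "N \<ge> 1" for N
  proof -
    let ?g0 = "gen_series ?c \<alpha> \<beta> x" and ?g1 = "gen_series (\<lambda>k. ?c k * (\<alpha> + \<beta> * real k)) \<alpha> \<beta> x"
      and ?g2 = "gen_series (\<lambda>k. ?c k * (\<alpha> + \<beta> * real k) * (\<alpha> + \<beta> * real k)) \<alpha> \<beta> x"
    have "(\<lambda>k. G_weight \<theta> k * poch_ratio N (?s k) * x powr ?s k -
         (?c k * x powr (\<alpha> + \<beta> * real k) + 1 / (2 * real N) * (?c k * (\<alpha> + \<beta> * real k) * x powr (\<alpha> + \<beta> * real k)
           + ?c k * (\<alpha> + \<beta> * real k) * (\<alpha> + \<beta> * real k) * x powr (\<alpha> + \<beta> * real k))))
       sums (q_tilde \<theta> a N (x / real N) - (?g0 + 1 / (2 * real N) * (?g1 + ?g2)))"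
      by (intro sums_diff sums_add sums_mult gen_series_sums c c1 c2 x q_tilde_scaled_sums \<theta> a N)
    moreover have "G_weight \<theta> k * poch_ratio N (?s k) * x powr ?s k -
         (?c k * x powr (\<alpha> + \<beta> * real k) + 1 / (2 * real N) * (?c k * (\<alpha> + \<beta> * real k) * x powr (\<alpha> + \<beta> * real k)
           + ?c k * (\<alpha> + \<beta> * real k) * (\<alpha> + \<beta> * real k) * x powr (\<alpha> + \<beta> * real k))) =
        G_weight \<theta> k * x powr ?s k * (poch_ratio N (?s k) - rGamma (?s k + 1) * (1 + ?s k * (?s k + 1) / (2 * real N)))" for k
      unfolding sk[symmetric] G_coeff_eq by (simp add: algebra_simps add_divide_distrib)
    ultimately have s: "(\<lambda>k. G_weight \<theta> k * x powr ?s k * (poch_ratio N (?s k) - rGamma (?s k + 1) * (1 + ?s k * (?s k + 1) / (2 * real N))))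
       sums (q_tilde \<theta> a N (x / real N) - (?g0 + 1 / (2 * real N) * (?g1 + ?g2)))" (is "?t sums ?S") by simp
    have le: "norm (?t k) \<le> b k * (C / real N ^ 2)" for k
      using mult_left_mono[OF C(2)[OF G_pole_gt[OF \<theta> a, of k] N], of "\<bar>G_weight \<theta> k\<bar> * x powr ?s k"]
      by (simp add: abs_mult b_def mult_ac)
    have "norm (suminf ?t) \<le> (\<Sum>k. b k * (C / real N ^ 2))"
      by (rule norm_suminf_le[OF le summable_mult2[OF b]])
    also have "\<dots> = suminf b * (C / real N ^ 2)" by (rule suminf_mult2[OF b, symmetric])
    finally have "\<bar>?S\<bar> \<le> suminf b * C / real N ^ 2" using sums_unique[OF s] by simp
    moreover have "complex_of_real (q_tilde \<theta> a N (x / real N)) - (G x + 1 / (2 * of_nat N) * (euler_op G x + euler_op (euler_op G) x)) = of_real ?S"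
      unfolding G[OF x] e1[OF x] e2 by simp
    ultimately show ?thesis by (simp only: norm_of_real)
  qed
  then show ?thesis by blast
qed

text \<open>The series represent F and G at positive arguments, hence at every t of the interval but
  0, a null set. Measurability of the original integrand follows by splitting off the same
  point.\<close>

lemma integral_F_LMB_G_LMB:
  assumes \<theta>: "\<theta> > 0" and a: "a > -1" and x: "x > 0" and y: "y > 0" and pc: "poles_to_right \<theta> a c" and cc: "convergent_contour \<theta> a c \<kappa>"
  shows "(LINT t:{0..1}|lborel. complex_of_real (F_LMB \<theta> a (x * t)) * G_LMB \<theta> a c \<kappa> (y * t)) =
    of_real (LINT t:{0<..1}|lborel. gen_series (F_coeff \<theta> a) 0 1 (x * t) * gen_series (G_coeff \<theta> a) ((a + 1) / \<theta> - 1) (1 / \<theta>) (y * t))"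
proof -
  have "(LINT t:{0..1}|lborel. complex_of_real (F_LMB \<theta> a (x * t)) * G_LMB \<theta> a c \<kappa> (y * t)) =
     (LINT t|lborel. of_real (indicator {0<..1} t * (gen_series (F_coeff \<theta> a) 0 1 (x * t) * gen_series (G_coeff \<theta> a) ((a + 1) / \<theta> - 1) (1 / \<theta>) (y * t))))"
    unfolding set_lebesgue_integral_def
  proof (rule Bochner_Integration.integral_cong_AE)
    let ?h = "\<lambda>t. complex_of_real (indicator {0<..1} t * (gen_series (F_coeff \<theta> a) 0 1 (x * t) * gen_series (G_coeff \<theta> a) ((a + 1) / \<theta> - 1) (1 / \<theta>) (y * t)))"
    let ?k = "\<lambda>t. indicator {0..1} t *\<^sub>R (complex_of_real (F_LMB \<theta> a (x * t)) * G_LMB \<theta> a c \<kappa> (y * t))"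
    show m: "?h \<in> borel_measurable lborel" unfolding gen_series_def by measurable
    have eq: "?k t = ?h t" if "t \<noteq> 0" for t
      using that x y by (auto simp: indicator_def F_LMB_eq G_LMB_eq[OF \<theta> a _ pc cc])
    have "?k = (\<lambda>t. if t = 0 then ?k 0 else ?h t)" using eq by auto
    also have "\<dots> \<in> borel_measurable lborel" using m by measurable
    finally show "?k \<in> borel_measurable lborel" .
    show "AE t in lborel. ?k t = ?h t"
      using AE_lborel_singleton[of "0::real"] by eventually_elim (rule eq)
  qed
  also have "\<dots> = of_real (LINT t:{0<..1}|lborel. gen_series (F_coeff \<theta> a) 0 1 (x * t) * gen_series (G_coeff \<theta> a) ((a + 1) / \<theta> - 1) (1 / \<theta>) (y * t))"
    by (simp only: integral_complex_of_real set_lebesgue_integral_def real_scaleR_def)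
  finally show ?thesis .
qed

text \<open>For each k the inner sum over j is compared with its expansion, with an error uniform in
  k up to the factor exp (3 (s + 1)); the outer series then sums these errors against the
  weights.\<close>

lemma K_LMB_asymp:
  assumes \<theta>: "\<theta> > 0" and a: "a > -1" and x: "x > 0" and y: "y > 0" and pc: "poles_to_right \<theta> a c" and cc: "convergent_contour \<theta> a c \<kappa>"
  defines "F \<equiv> F_LMB \<theta> a" and "G \<equiv> G_LMB \<theta> a c \<kappa>"
  shows "\<exists>D. \<forall>N\<ge>1. norm (complex_of_real (1 / real N * K_LMB \<theta> a N (x / real N) (y / real N))
        - ((LINT t:{0..1}|lborel. complex_of_real (F (x * t)) * G (y * t))
           - 1 / (2 * of_nat N) *
             (euler_op (\<lambda>u. complex_of_real (F u) * G y) x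
              - euler_op (\<lambda>v. complex_of_real (F x) * G v) y))) \<le> D / real N ^ 2"
proof -
  let ?f = "F_coeff \<theta> a" and ?g = "G_coeff \<theta> a" and ?s = "G_pole \<theta> a"
  define \<alpha> where "\<alpha> = (a + 1) / \<theta> - 1"
  define \<beta> where "\<beta> = 1 / \<theta>"
  have sk: "?s k = \<alpha> + \<beta> * real k" for k by (simp add: G_pole_affine[OF \<theta>] \<alpha>_def \<beta>_def)
  have s1: "?s k > -1" for k by (rule G_pole_gt[OF \<theta> a])
  have s0: "?s 0 \<le> ?s k" for k using \<theta> by (simp add: G_pole_def divide_right_mono)
  have \<alpha>: "\<alpha> > -1" and \<beta>: "\<beta> \<ge> 0" using \<theta> a by (auto simp: \<alpha>_def \<beta>_def)
  have f: "rapid ?f" and g: "rapid ?g" using rapid_F_coeff rapid_G_coeff \<theta> a by auto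
  have f1: "rapid (\<lambda>j. ?f j * (0 + 1 * real j))" and g1: "rapid (\<lambda>k. ?g k * (\<alpha> + \<beta> * real k))"
    by (rule rapid_linear[OF f], rule rapid_linear[OF g])
  define F0 where "F0 = gen_series ?f 0 1 x"
  define F1 where "F1 = gen_series (\<lambda>j. ?f j * (0 + 1 * real j)) 0 1 x"
  define G0 where "G0 = gen_series ?g \<alpha> \<beta> y"
  define G1 where "G1 = gen_series (\<lambda>k. ?g k * (\<alpha> + \<beta> * real k)) \<alpha> \<beta> y"
  define I where "I = (LINT t:{0<..1}|lborel. gen_series ?f 0 1 (x * t) * gen_series ?g \<alpha> \<beta> (y * t))"
  have Fx: "F u = gen_series ?f 0 1 u" if "u > 0" for u using that by (simp add: F_def F_LMB_eq)
  have Gx: "G u = of_real (gen_series ?g \<alpha> \<beta> u)" if "u > 0" for u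
    using that by (simp add: G_def \<alpha>_def \<beta>_def G_LMB_eq[OF \<theta> a _ pc cc])
  have eF: "euler_op (\<lambda>u. complex_of_real (F u) * G y) x = of_real F1 * of_real G0"
    unfolding F1_def by (rule euler_op_gen_series[OF f x]) (simp add: Fx Gx[OF y] G0_def)
  have eG: "euler_op (\<lambda>v. complex_of_real (F x) * G v) y = of_real G1 * of_real F0"
    unfolding G1_def by (rule euler_op_gen_series[OF g y]) (simp add: Fx[OF x] Gx F0_def)
  have int: "(LINT t:{0..1}|lborel. complex_of_real (F (x * t)) * G (y * t)) = of_real I"
    unfolding F_def G_def I_def \<alpha>_def \<beta>_def by (rule integral_F_LMB_G_LMB[OF \<theta> a x y pc cc])
  have sums01: "(\<lambda>k. d k * x ^ k) sums gen_series d 0 1 x" if "rapid d" for d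
    using gen_series_sums[OF that x, of 0 1] x by (simp add: powr_realpow)
  define H where "H = (\<lambda>k. \<Sum>j. ?f j * x ^ j / (?s k + real j + 1))"
  have I: "(\<lambda>k. ?g k * y powr ?s k * H k) sums I"
    unfolding I_def H_def sk by (rule integral_gen_series_product(1)[OF f g \<alpha> \<beta> x y])
  have Hs: "(\<lambda>j. ?f j * x ^ j / (?s k + real j + 1)) sums H k" for k
    unfolding H_def using integral_gen_series_product(2)[OF f g \<alpha> \<beta> x y s1] by (rule summable_sums)
  obtain C where C: "C > 0" "\<And>s N j. s > -1 \<Longrightarrow> N \<ge> 1 \<Longrightarrow> \<bar>ff_ratio N j * poch_ratio N s -
      rGamma (s + 1) * (1 + (s * (s + 1) - real j * (real j + 1)) / (2 * real N))\<bar>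
     \<le> C * exp (3 * (s + 1)) * (real j + 1) ^ 4 / real N ^ 2"
    using product_ratio_asymp by blast
  define b where "b = (\<lambda>k. \<bar>G_weight \<theta> k\<bar> * y powr ?s k * exp (3 * (?s k + 1)))"
  have b: "summable b" unfolding b_def using \<theta> y by (rule G_pole_powr_summable_exp)
  define d where "d = (\<lambda>j. \<bar>?f j\<bar> * x ^ j * (real j + 1) ^ 4)"
  have d: "summable d" unfolding d_def using \<theta> a x by (rule F_coeff_quartic_summable)
  \<comment> \<open>All denominators s + j + 1 are at least ?s 0 + 1 > 0, since the exponents
    increase with k; this turns C into B.\<close>
  define B where "B = C / (?s 0 + 1)"
  have "norm (complex_of_real (1 / real N * K_LMB \<theta> a N (x / real N) (y / real N))
        - ((LINT t:{0..1}|lborel. complex_of_real (F (x * t)) * G (y * t))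
           - 1 / (2 * of_nat N) *
             (euler_op (\<lambda>u. complex_of_real (F u) * G y) x
              - euler_op (\<lambda>v. complex_of_real (F x) * G v) y))) \<le> (suminf b * (suminf d * B)) / real N ^ 2"
    if N: "N \<ge> 1" for N
  proof -
    let ?W = "\<lambda>k. G_weight \<theta> k * y powr ?s k"
    let ?L = "\<lambda>k. \<Sum>j<N. ?f j * x ^ j * (ff_ratio N j * poch_ratio N (?s k) / (?s k + real j + 1))"
    let ?R = "\<lambda>k. rGamma (?s k + 1) * (H k - 1 / (2 * real N) * (F1 - ?s k * F0))"
    let ?S = "1 / real N * K_LMB \<theta> a N (x / real N) (y / real N) - (I - 1 / (2 * real N) * (F1 * G0 - G1 * F0))"
    have "(\<lambda>k. ?W k * ?L k - (?g k * y powr ?s k * H k - 1 / (2 * real N) *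
          (F1 * (?g k * y powr (\<alpha> + \<beta> * real k)) - ?g k * (\<alpha> + \<beta> * real k) * y powr (\<alpha> + \<beta> * real k) * F0))) sums ?S"
      unfolding G0_def G1_def
      by (intro sums_diff I sums_mult sums_mult2 gen_series_sums g g1 y K_LMB_scaled_sums \<theta> a x N)
    moreover have "?W k * ?L k - (?g k * y powr ?s k * H k - 1 / (2 * real N) *
          (F1 * (?g k * y powr (\<alpha> + \<beta> * real k)) - ?g k * (\<alpha> + \<beta> * real k) * y powr (\<alpha> + \<beta> * real k) * F0)) = ?W k * (?L k - ?R k)" for k
      unfolding sk[symmetric] G_coeff_eq by (simp add: algebra_simps diff_divide_distrib)
    ultimately have s: "(\<lambda>k. ?W k * (?L k - ?R k)) sums ?S" by simp
    have LR: "\<bar>?L k - ?R k\<bar> \<le> exp (3 * (?s k + 1)) * (suminf d * B / real N ^ 2)" for k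
    proof -
      have ne: "?s k + real j + 1 > 0" for j using s1[of k] by linarith
      have "(\<lambda>j. ?f j * x ^ j * (ff_ratio N j * poch_ratio N (?s k) / (?s k + real j + 1))) sums ?L k"
        using N by (intro sums_finite) (auto simp: ff_ratio_eq_0)
      moreover have "(\<lambda>j. rGamma (?s k + 1) * (?f j * x ^ j / (?s k + real j + 1) - 1 / (2 * real N) * (?f j * (0 + 1 * real j) * x ^ j - ?s k * (?f j * x ^ j)))) sums ?R k"
        unfolding F0_def F1_def by (intro sums_mult sums_diff Hs sums01 f f1)
      ultimately have "(\<lambda>j. ?f j * x ^ j * (ff_ratio N j * poch_ratio N (?s k) / (?s k + real j + 1)) -
         rGamma (?s k + 1) * (?f j * x ^ j / (?s k + real j + 1) - 1 / (2 * real N) * (?f j * (0 + 1 * real j) * x ^ j - ?s k * (?f j * x ^ j)))) sums (?L k - ?R k)"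
        by (rule sums_diff)
      moreover have "?f j * x ^ j * (ff_ratio N j * poch_ratio N (?s k) / (?s k + real j + 1)) -
         rGamma (?s k + 1) * (?f j * x ^ j / (?s k + real j + 1) - 1 / (2 * real N) * (?f j * (0 + 1 * real j) * x ^ j - ?s k * (?f j * x ^ j)))
         = ?f j * x ^ j * ((ff_ratio N j * poch_ratio N (?s k) - rGamma (?s k + 1) * (1 + (?s k * (?s k + 1) - real j * (real j + 1)) / (2 * real N))) / (?s k + real j + 1))" for j
      proof -
        \<comment> \<open>As (J - S) w = J (J + 1) - S (S + 1), division by w leaves just the
          difference of the two Euler eigenvalues in the 1/N term.\<close>
        have key: "X * (Q / w) - r * (X / w - h * (X * J - S * X)) = X * ((Q - r * (1 + (S * (S + 1) - J * (J + 1)) * h)) / w)"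
          if "w = S + J + 1" "w \<noteq> 0" for X Q w r h J S :: real
        proof -
          have Jw: "(J - S) * w = J * (J + 1) - S * (S + 1)" unfolding that(1) by (simp add: algebra_simps)
          have "1 + (S * (S + 1) - J * (J + 1)) * h = 1 - h * ((J - S) * w)" unfolding Jw by (simp add: algebra_simps)
          moreover have "X * (Q / w) - r * (X / w - h * (X * J - S * X)) = X * ((Q - r * (1 - h * ((J - S) * w))) / w)"
            using that(2) by (simp add: divide_simps) (simp add: algebra_simps)
          ultimately show ?thesis by simp
        qed
        have e1: "?f j * (0 + 1 * real j) * x ^ j = ?f j * x ^ j * real j" by simp
        have e2: "A / (2 * real N) = A * (1 / (2 * real N))" for A by simp
        show ?thesis
          unfolding e1 e2[of "?s k * (?s k + 1) - real j * (real j + 1)"]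
          by (rule key) (use ne[of j] in simp_all)
      qed
      ultimately have s: "(\<lambda>j. ?f j * x ^ j * ((ff_ratio N j * poch_ratio N (?s k) - rGamma (?s k + 1) * (1 + (?s k * (?s k + 1) - real j * (real j + 1)) / (2 * real N))) / (?s k + real j + 1))) sums (?L k - ?R k)"
        (is "?t sums _") by simp
      let ?E = "exp (3 * (?s k + 1))"
      have le: "norm (?t j) \<le> d j * (?E * (B / real N ^ 2))" for j
      proof -
        let ?A = "ff_ratio N j * poch_ratio N (?s k) - rGamma (?s k + 1) * (1 + (?s k * (?s k + 1) - real j * (real j + 1)) / (2 * real N))"
        have "\<bar>?A\<bar> / (?s k + real j + 1) \<le> (C * ?E * (real j + 1) ^ 4 / real N ^ 2) / (?s 0 + 1)"
          using C(2)[OF s1[of k] N, of j] s0[of k] s1[of 0] C(1) by (intro frac_le) auto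
        then have "\<bar>?f j\<bar> * x ^ j * (\<bar>?A\<bar> / (?s k + real j + 1)) \<le> \<bar>?f j\<bar> * x ^ j * ((C * ?E * (real j + 1) ^ 4 / real N ^ 2) / (?s 0 + 1))"
          using x by (intro mult_left_mono) auto
        also have "\<dots> = d j * (?E * (B / real N ^ 2))" by (simp add: d_def B_def mult_ac)
        finally show ?thesis using x ne[of j] by (simp add: abs_mult)
      qed
      have "norm (suminf ?t) \<le> (\<Sum>j. d j * (?E * (B / real N ^ 2)))"
        by (rule norm_suminf_le[OF le summable_mult2[OF d]])
      also have "\<dots> = suminf d * (?E * (B / real N ^ 2))" by (rule suminf_mult2[OF d, symmetric])
      finally show ?thesis using sums_unique[OF s] by (simp add: mult_ac)
    qed
    have le: "norm (?W k * (?L k - ?R k)) \<le> b k * (suminf d * B / real N ^ 2)" for k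
      using mult_left_mono[OF LR[of k], of "\<bar>G_weight \<theta> k\<bar> * y powr ?s k"] by (simp add: b_def abs_mult mult.assoc)
    have "norm (\<Sum>k. ?W k * (?L k - ?R k)) \<le> (\<Sum>k. b k * (suminf d * B / real N ^ 2))"
      by (rule norm_suminf_le[OF le summable_mult2[OF b]])
    also have "\<dots> = suminf b * (suminf d * B / real N ^ 2)" by (rule suminf_mult2[OF b, symmetric])
    finally have "\<bar>?S\<bar> \<le> suminf b * (suminf d * B) / real N ^ 2" using sums_unique[OF s] by simp
    moreover have "complex_of_real (1 / real N * K_LMB \<theta> a N (x / real N) (y / real N))
        - ((LINT t:{0..1}|lborel. complex_of_real (F (x * t)) * G (y * t))
           - 1 / (2 * of_nat N) *
             (euler_op (\<lambda>u. complex_of_real (F u) * G y) x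
              - euler_op (\<lambda>v. complex_of_real (F x) * G v) y)) = of_real ?S"
      unfolding int eF eG by simp
    ultimately show ?thesis by (simp only: norm_of_real)
  qed
  then show ?thesis by blast
qed

theorem proposition3p3:
  fixes \<theta> a c \<kappa> x y :: real
  assumes "\<theta> > 0" and "a > -1"
    and "poles_to_right \<theta> a c"
    and "convergent_contour \<theta> a c \<kappa>"
    and "x > 0" and "y > 0"
  defines "F \<equiv> F_LMB \<theta> a" and "G \<equiv> G_LMB \<theta> a c \<kappa>"
  shows
    "(\<lambda>N::nat. p_tilde \<theta> a (N - 1) (x / real N)
        - (F x - 1 / (2 * real N) * (euler_op F x + euler_op (euler_op F) x)))
       \<in> O(\<lambda>N. 1 / real N ^ 2) \<and>
     (\<lambda>N::nat. complex_of_real (q_tilde \<theta> a N (x / real N))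
        - (G x + 1 / (2 * of_nat N) * (euler_op G x + euler_op (euler_op G) x)))
       \<in> O(\<lambda>N. 1 / of_nat N ^ 2) \<and>
     (\<lambda>N::nat. complex_of_real (1 / real N * K_LMB \<theta> a N (x / real N) (y / real N))
        - ((LINT t:{0..1}|lborel. complex_of_real (F (x * t)) * G (y * t))
           - 1 / (2 * of_nat N) *
             (euler_op (\<lambda>u. complex_of_real (F u) * G y) x
              - euler_op (\<lambda>v. complex_of_real (F x) * G v) y)))
       \<in> O(\<lambda>N. 1 / of_nat N ^ 2)"
proof (intro conjI)
  show "(\<lambda>N::nat. p_tilde \<theta> a (N - 1) (x / real N)
        - (F x - 1 / (2 * real N) * (euler_op F x + euler_op (euler_op F) x)))
       \<in> O(\<lambda>N. 1 / real N ^ 2)"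
    using p_tilde_asymp[OF assms(1,2,5)] unfolding F_def
    by (intro bigo_inverse_squareI) (simp only: real_norm_def)
  show "(\<lambda>N::nat. complex_of_real (q_tilde \<theta> a N (x / real N))
        - (G x + 1 / (2 * of_nat N) * (euler_op G x + euler_op (euler_op G) x)))
       \<in> O(\<lambda>N. 1 / of_nat N ^ 2)"
    unfolding G_def by (rule bigo_inverse_squareI[OF q_tilde_asymp[OF assms(1,2,5,3,4)]])
  show "(\<lambda>N::nat. complex_of_real (1 / real N * K_LMB \<theta> a N (x / real N) (y / real N))
        - ((LINT t:{0..1}|lborel. complex_of_real (F (x * t)) * G (y * t))
           - 1 / (2 * of_nat N) *
             (euler_op (\<lambda>u. complex_of_real (F u) * G y) x
              - euler_op (\<lambda>v. complex_of_real (F x) * G v) y)))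
       \<in> O(\<lambda>N. 1 / of_nat N ^ 2)"
    unfolding F_def G_def by (rule bigo_inverse_squareI[OF K_LMB_asymp[OF assms(1,2,5,6,3,4)]])
qed

end
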